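(* Let $\Re$ be any realization functor for strict $3$-groupoids. Then there does not exist a strict $3$-groupoid $C$ such that $\Re(C)$ is weak-equivalent to the $3$-truncation (the $3$-type) of the homotopy type of the sphere $S^2$.
   Context: **Strict $n$-categories.** A strict $0$-category is a set. For $n\ge 1$, a strict $n$-category is a category enriched over the cartesian category of strict $(n-1)$-categories: a set of objects $Ob(C)$, a strict $(n-1)$-category $Hom_C(x,y)$ for each pair of objects, strictly associative composition morphisms $Hom_C(x,y)\times Hom_C(y,z)\to Hom_C(x,z)$, and strict identities $1_x\in Ob(Hom_C(x,x))$. Morphisms strictly preserve all the structure. **Strict $n$-groupoids** (no strict inverses required). A strict $0$-groupoid is a set $A$, with $\pi_0(A)=A$. For $n\ge 1$, a strict $n$-category $A$ is a strict $n$-groupoid if every $Hom_A(x,y)$ is a strict $(n-1)$-groupoid and the category $\tau_{\le 1}A$, with the same objects as $A$ and with morphism sets $\pi_0(Hom_A(x,y))$, is a groupoid in the usual sense; then $\pi_0(A)$ is the set of isomorphism classes of $\tau_{\le 1}A$. Let $nStrGpd$ be the category of strict $n$-groupoids with morphisms of strict $n$-categories. **Homotopy groups.** For a strict $n$-groupoid $A$ and $a\in Ob(A)$, $\pi_1(A,a)=\pi_0(Hom_A(a,a))$ and $\pi_i(A,a)=\pi_{i-1}(Hom_A(a,a),1_a)$ for $2\le i\le n$. The group structure comes from composition. Equivalently, $\pi_i(A,a)$ is the set of $i$-morphisms from the $(i-1)$-fold iterated identity of $a$ to itself, modulo the relation that two are joined by an $(i+1)$-morphism. **Realization functors.** A realization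 functor for strict $n$-groupoids is a functor $\Re: nStrGpd\to Top$ to topological spaces together with natural transformations $r: Ob(A)\to \Re(A)$ (a map from the set of objects to the set of points), $\zeta_0(A):\pi_0(A)\to\pi_0(\Re(A))$, and $\zeta_i(A,x):\pi_i(A,x)\to\pi_i(\Re(A),r(x))$ for $i \geq 1$, such that $\zeta_0(A)$ and the $\zeta_i(A,x)$, $1\le i\le n$, are isomorphisms (bijections for $i=0$, group isomorphisms for $i\ge1$), and such that $\pi_i(\Re(A),y)$ vanishes for all $i>n$ and all points $y$. Two spaces are weak-equivalent if they are connected by a zigzag of weak homotopy equivalences. *)

theory Defs
  imports "HOL-Analysis.Analysis" "HOL-Algebra.Group"
begin

section \<open>Blocks of a partition\<close>

text \<open>All sets of classes below are partitions \<open>P\<close>, given as sets of blocks. Operations on classes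
  are written with \<open>block P S\<close>, the block containing the representatives \<open>S\<close>.\<close>

definition block :: "'a set set \<Rightarrow> 'a set \<Rightarrow> 'a set" where
  "block P S = (THE X. X \<in> P \<and> S \<subseteq> X)"


section \<open>Strict n-categories\<close>

text \<open>A strict \<open>n\<close>-category is a category enriched over the cartesian category of strict
  \<open>(n-1)\<close>-categories. The type \<open>ncat\<close> contains the raw data and \<open>nfun\<close> the raw morphisms; cells of
  all dimensions are elements of the same type \<open>'a\<close>, which plays the role of a universe, and
  different hom-objects may share elements. Values outside the carriers are irrelevant, so that
  equality of morphisms is \<open>nfun_eq\<close> below. Composition is in diagrammatic order: \<open>Comp A x y z\<close> is
  a morphism from \<open>Hom A x y \<times> Hom A y z\<close> to \<open>Hom A x z\<close>.\<close>

datatype (dead 'a, dead 'b) nfun =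
    Fun0 (obf: "'a \<Rightarrow> 'b")
  | FunS (obf: "'a \<Rightarrow> 'b") (homf: "'a \<Rightarrow> 'a \<Rightarrow> ('a, 'b) nfun")

datatype (dead 'a) ncat =
    Cat0 (Ob: "'a set")
  | CatS (Ob: "'a set") (Hom: "'a \<Rightarrow> 'a \<Rightarrow> 'a ncat")
      (Comp: "'a \<Rightarrow> 'a \<Rightarrow> 'a \<Rightarrow> ('a \<times> 'a, 'a) nfun") (Ident: "'a \<Rightarrow> 'a")

primrec nfun_eq :: "nat \<Rightarrow> 'a ncat \<Rightarrow> ('a, 'b) nfun \<Rightarrow> ('a, 'b) nfun \<Rightarrow> bool" where
  "nfun_eq 0 A F G \<longleftrightarrow> (\<forall>x\<in>Ob A. obf F x = obf G x)"
| "nfun_eq (Suc n) A F G \<longleftrightarrow> (\<forall>x\<in>Ob A. obf F x = obf G x) \<and>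
     (\<forall>x\<in>Ob A. \<forall>y\<in>Ob A. nfun_eq n (Hom A x y) (homf F x y) (homf G x y))"

text \<open>\<open>nfun_of n f\<close> acts by \<open>f\<close> on the cells of every dimension; it provides identities, diagonals
  and the rearrangements of factors of products.\<close>

primrec nfun_of :: "nat \<Rightarrow> ('a \<Rightarrow> 'b) \<Rightarrow> ('a, 'b) nfun" where
  "nfun_of 0 f = Fun0 f"
| "nfun_of (Suc n) f = FunS f (\<lambda>_ _. nfun_of n f)"

abbreviation nfun_id :: "nat \<Rightarrow> ('a, 'a) nfun" where
  "nfun_id n \<equiv> nfun_of n (\<lambda>x. x)"

text \<open>The composite of \<open>F\<close> followed by \<open>G\<close>.\<close>

primrec nfun_comp :: "('b, 'c) nfun \<Rightarrow> ('a, 'b) nfun \<Rightarrow> ('a, 'c) nfun" where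
  "nfun_comp G (Fun0 f) = Fun0 (\<lambda>x. obf G (f x))"
| "nfun_comp G (FunS f h) =
     FunS (\<lambda>x. obf G (f x)) (\<lambda>x y. nfun_comp (homf G (f x) (f y)) (h x y))"

primrec nfun_prod :: "('a, 'c) nfun \<Rightarrow> ('b, 'd) nfun \<Rightarrow> ('a \<times> 'b, 'c \<times> 'd) nfun" where
  "nfun_prod (Fun0 f) G = Fun0 (map_prod f (obf G))"
| "nfun_prod (FunS f h) G = FunS (map_prod f (obf G))
     (\<lambda>(x, x') (y, y'). nfun_prod (h x y) (homf G x' y'))"

text \<open>\<open>nfun_point n A a\<close> sends everything to \<open>a\<close> and its iterated identities, i.e. it is the
  morphism from the terminal strict \<open>n\<close>-category to \<open>A\<close> that names the object \<open>a\<close>, precomposed with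
  the projection to the terminal object.\<close>

primrec nfun_point :: "nat \<Rightarrow> 'a ncat \<Rightarrow> 'a \<Rightarrow> ('b, 'a) nfun" where
  "nfun_point 0 A a = Fun0 (\<lambda>_. a)"
| "nfun_point (Suc n) A a = FunS (\<lambda>_. a) (\<lambda>_ _. nfun_point n (Hom A a a) (Ident A a))"

primrec ncat_prod :: "nat \<Rightarrow> 'a ncat \<Rightarrow> 'b ncat \<Rightarrow> ('a \<times> 'b) ncat" where
  "ncat_prod 0 A B = Cat0 (Ob A \<times> Ob B)"
| "ncat_prod (Suc n) A B = CatS (Ob A \<times> Ob B)
     (\<lambda>(x, x') (y, y'). ncat_prod n (Hom A x y) (Hom B x' y'))
     (\<lambda>(x, x') (y, y') (z, z').
        nfun_comp (nfun_prod (Comp A x y z) (Comp B x' y' z'))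
          (nfun_of n (\<lambda>((f, f'), (g, g')). ((f, g), (f', g')))))
     (\<lambda>(x, x'). (Ident A x, Ident B x'))"

text \<open>Morphisms of strict \<open>n\<close>-categories.\<close>

primrec is_nfun :: "nat \<Rightarrow> 'a ncat \<Rightarrow> 'b ncat \<Rightarrow> ('a, 'b) nfun \<Rightarrow> bool" where
  "is_nfun 0 A B F \<longleftrightarrow> is_Fun0 F \<and> obf F ` Ob A \<subseteq> Ob B"
| "is_nfun (Suc n) A B F \<longleftrightarrow> \<not> is_Fun0 F \<and> obf F ` Ob A \<subseteq> Ob B \<and>
     (\<forall>x\<in>Ob A. \<forall>y\<in>Ob A. is_nfun n (Hom A x y) (Hom B (obf F x) (obf F y)) (homf F x y)) \<and>
     (\<forall>x\<in>Ob A. obf (homf F x x) (Ident A x) = Ident B (obf F x)) \<and>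
     (\<forall>x\<in>Ob A. \<forall>y\<in>Ob A. \<forall>z\<in>Ob A.
        nfun_eq n (ncat_prod n (Hom A x y) (Hom A y z))
          (nfun_comp (homf F x z) (Comp A x y z))
          (nfun_comp (Comp B (obf F x) (obf F y) (obf F z))
             (nfun_prod (homf F x y) (homf F y z))))"

text \<open>The last three conditions are associativity and the two unit laws, as equations between
  morphisms of strict \<open>n\<close>-categories.\<close>

primrec strict_ncat :: "nat \<Rightarrow> 'a ncat \<Rightarrow> bool" where
  "strict_ncat 0 A \<longleftrightarrow> is_Cat0 A"
| "strict_ncat (Suc n) A \<longleftrightarrow> \<not> is_Cat0 A \<and>
     (\<forall>x\<in>Ob A. \<forall>y\<in>Ob A. strict_ncat n (Hom A x y)) \<and>
     (\<forall>x\<in>Ob A. \<forall>y\<in>Ob A. \<forall>z\<in>Ob A.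
        is_nfun n (ncat_prod n (Hom A x y) (Hom A y z)) (Hom A x z) (Comp A x y z)) \<and>
     (\<forall>x\<in>Ob A. Ident A x \<in> Ob (Hom A x x)) \<and>
     (\<forall>w\<in>Ob A. \<forall>x\<in>Ob A. \<forall>y\<in>Ob A. \<forall>z\<in>Ob A.
        nfun_eq n (ncat_prod n (ncat_prod n (Hom A w x) (Hom A x y)) (Hom A y z))
          (nfun_comp (Comp A w y z) (nfun_prod (Comp A w x y) (nfun_id n)))
          (nfun_comp (nfun_comp (Comp A w x z) (nfun_prod (nfun_id n) (Comp A x y z)))
             (nfun_of n (\<lambda>((f, g), h). (f, (g, h)))))) \<and>
     (\<forall>x\<in>Ob A. \<forall>y\<in>Ob A.
        nfun_eq n (Hom A x y)
          (nfun_comp (Comp A x x y)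
             (nfun_comp (nfun_prod (nfun_point n (Hom A x x) (Ident A x)) (nfun_id n))
               (nfun_of n (\<lambda>f. (f, f)))))
          (nfun_id n)) \<and>
     (\<forall>x\<in>Ob A. \<forall>y\<in>Ob A.
        nfun_eq n (Hom A x y)
          (nfun_comp (Comp A x y y)
             (nfun_comp (nfun_prod (nfun_id n) (nfun_point n (Hom A y y) (Ident A y)))
               (nfun_of n (\<lambda>f. (f, f)))))
          (nfun_id n))"


section \<open>Strict n-groupoids and their homotopy groups\<close>

record ('o, 'm) small_cat =
  Obj :: "'o set"
  Mor :: "'o \<Rightarrow> 'o \<Rightarrow> 'm set"
  Cmp :: "'o \<Rightarrow> 'o \<Rightarrow> 'o \<Rightarrow> 'm \<Rightarrow> 'm \<Rightarrow> 'm"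
  Idt :: "'o \<Rightarrow> 'm"

definition is_category :: "('o, 'm) small_cat \<Rightarrow> bool" where
  "is_category C \<longleftrightarrow>
     (\<forall>x\<in>Obj C. Idt C x \<in> Mor C x x) \<and>
     (\<forall>x\<in>Obj C. \<forall>y\<in>Obj C. \<forall>z\<in>Obj C. \<forall>f\<in>Mor C x y. \<forall>g\<in>Mor C y z. Cmp C x y z f g \<in> Mor C x z) \<and>
     (\<forall>w\<in>Obj C. \<forall>x\<in>Obj C. \<forall>y\<in>Obj C. \<forall>z\<in>Obj C. \<forall>f\<in>Mor C w x. \<forall>g\<in>Mor C x y. \<forall>h\<in>Mor C y z.
        Cmp C w y z (Cmp C w x y f g) h = Cmp C w x z f (Cmp C x y z g h)) \<and>
     (\<forall>x\<in>Obj C. \<forall>y\<in>Obj C. \<forall>f\<in>Mor C x y.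
        Cmp C x x y (Idt C x) f = f \<and> Cmp C x y y f (Idt C y) = f)"

definition is_inverse :: "('o, 'm) small_cat \<Rightarrow> 'o \<Rightarrow> 'o \<Rightarrow> 'm \<Rightarrow> 'm \<Rightarrow> bool" where
  "is_inverse C x y f g \<longleftrightarrow> Cmp C x y x f g = Idt C x \<and> Cmp C y x y g f = Idt C y"

definition is_groupoid :: "('o, 'm) small_cat \<Rightarrow> bool" where
  "is_groupoid C \<longleftrightarrow> is_category C \<and>
     (\<forall>x\<in>Obj C. \<forall>y\<in>Obj C. \<forall>f\<in>Mor C x y. \<exists>g\<in>Mor C y x. is_inverse C x y f g)"

definition iso_classes :: "('o, 'm) small_cat \<Rightarrow> 'o set set" where
  "iso_classes C = Obj C //
     {(x, y). x \<in> Obj C \<and> y \<in> Obj C \<and> (\<exists>f\<in>Mor C x y. \<exists>g\<in>Mor C y x. is_inverse C x y f g)}"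

text \<open>The category with objects \<open>S\<close> and sets of morphisms \<open>P x y\<close>, a set of classes of elements
  composed by \<open>c\<close> on representatives.\<close>

definition class_cat :: "'a set \<Rightarrow> ('a \<Rightarrow> 'a \<Rightarrow> 'a set set) \<Rightarrow>
    ('a \<Rightarrow> 'a \<Rightarrow> 'a \<Rightarrow> 'a \<times> 'a \<Rightarrow> 'a) \<Rightarrow> ('a \<Rightarrow> 'a) \<Rightarrow> ('a, 'a set) small_cat" where
  "class_cat S P c e =
     \<lparr>Obj = S, Mor = P,
      Cmp = (\<lambda>x y z X Y. block (P x z) (c x y z ` (X \<times> Y))),
      Idt = (\<lambda>x. block (P x x) {e x})\<rparr>"

text \<open>For a set \<open>S\<close>, \<open>\<pi>\<^sub>0 S = S\<close> is represented by the set of singletons, so that \<open>\<pi>\<^sub>0\<close> is a set of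
  classes of objects in every dimension.\<close>

primrec ncat_pi0 :: "'a ncat \<Rightarrow> 'a set set" where
  "ncat_pi0 (Cat0 S) = (\<lambda>x. {x}) ` S"
| "ncat_pi0 (CatS S H c e) =
     iso_classes (class_cat S (\<lambda>x y. ncat_pi0 (H x y)) (\<lambda>x y z. obf (c x y z)) e)"

definition tau1 :: "'a ncat \<Rightarrow> ('a, 'a set) small_cat" where
  "tau1 A = class_cat (Ob A) (\<lambda>x y. ncat_pi0 (Hom A x y)) (\<lambda>x y z. obf (Comp A x y z)) (Ident A)"

primrec strict_ngpd :: "nat \<Rightarrow> 'a ncat \<Rightarrow> bool" where
  "strict_ngpd 0 A \<longleftrightarrow> strict_ncat 0 A"
| "strict_ngpd (Suc n) A \<longleftrightarrow> strict_ncat (Suc n) A \<and>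
     (\<forall>x\<in>Ob A. \<forall>y\<in>Ob A. strict_ngpd n (Hom A x y)) \<and> is_groupoid (tau1 A)"

definition ncat_pi0_map :: "'a ncat \<Rightarrow> ('a, 'a) nfun \<Rightarrow> 'a set \<Rightarrow> 'a set" where
  "ncat_pi0_map B F X = block (ncat_pi0 B) (obf F ` X)"

text \<open>\<open>ncat_pi i A a\<close> is \<open>\<pi>\<^sub>i(A,a)\<close> for \<open>i \<ge> 1\<close>; nothing is specified for \<open>i = 0\<close>.\<close>

fun ncat_pi :: "nat \<Rightarrow> 'a ncat \<Rightarrow> 'a \<Rightarrow> 'a set monoid" where
  "ncat_pi (Suc 0) A a =
     \<lparr>carrier = ncat_pi0 (Hom A a a), mult = Cmp (tau1 A) a a a, one = Idt (tau1 A) a\<rparr>"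
| "ncat_pi (Suc (Suc i)) A a = ncat_pi (Suc i) (Hom A a a) (Ident A a)"

text \<open>\<open>ncat_pi_map i A B F a\<close> is the map \<open>\<pi>\<^sub>i(A,a) \<rightarrow> \<pi>\<^sub>i(B,F a)\<close> induced by \<open>F\<close>.\<close>

fun ncat_pi_map :: "nat \<Rightarrow> 'a ncat \<Rightarrow> 'a ncat \<Rightarrow> ('a, 'a) nfun \<Rightarrow> 'a \<Rightarrow> 'a set \<Rightarrow> 'a set" where
  "ncat_pi_map (Suc 0) A B F a X = ncat_pi0_map (Hom B (obf F a) (obf F a)) (homf F a a) X"
| "ncat_pi_map (Suc (Suc i)) A B F a X =
     ncat_pi_map (Suc i) (Hom A a a) (Hom B (obf F a) (obf F a)) (homf F a a) (Ident A a) X"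


section \<open>Homotopy groups of spaces and weak equivalences\<close>

definition cube :: "nat \<Rightarrow> (nat \<Rightarrow> real) topology" where
  "cube i = product_topology (\<lambda>_. top_of_set {0..1}) {..<i}"

definition cube_boundary :: "nat \<Rightarrow> (nat \<Rightarrow> real) set" where
  "cube_boundary i = {t \<in> topspace (cube i). \<exists>k<i. t k = 0 \<or> t k = 1}"

definition cube_loops :: "nat \<Rightarrow> 'b topology \<Rightarrow> 'b \<Rightarrow> ((nat \<Rightarrow> real) \<Rightarrow> 'b) set" where
  "cube_loops i X x = {p. continuous_map (cube i) X p \<and> p ` cube_boundary i \<subseteq> {x}}"

definition loop_classes :: "nat \<Rightarrow> 'b topology \<Rightarrow> 'b \<Rightarrow> ((nat \<Rightarrow> real) \<Rightarrow> 'b) set set" where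
  "loop_classes i X x = cube_loops i X x //
     {(p, q). homotopic_with (\<lambda>p. p ` cube_boundary i \<subseteq> {x}) (cube i) X p q}"

definition concat_loops :: "((nat \<Rightarrow> real) \<Rightarrow> 'b) \<Rightarrow> ((nat \<Rightarrow> real) \<Rightarrow> 'b) \<Rightarrow> (nat \<Rightarrow> real) \<Rightarrow> 'b" where
  "concat_loops p q t =
     (if t 0 \<le> 1/2 then p (t(0 := 2 * t 0)) else q (t(0 := 2 * t 0 - 1)))"

text \<open>\<open>top_pi i X x\<close> is \<open>\<pi>\<^sub>i(X,x)\<close>, meaningful for \<open>i \<ge> 1\<close> and \<open>x \<in> topspace X\<close>. The set \<open>\<pi>\<^sub>0(X)\<close> is
  \<open>path_components_of X\<close>.\<close>

definition top_pi :: "nat \<Rightarrow> 'b topology \<Rightarrow> 'b \<Rightarrow> ((nat \<Rightarrow> real) \<Rightarrow> 'b) set monoid" where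
  "top_pi i X x =
     \<lparr>carrier = loop_classes i X x,
      mult = (\<lambda>P Q. block (loop_classes i X x) {concat_loops p q | p q. p \<in> P \<and> q \<in> Q}),
      one = block (loop_classes i X x) {\<lambda>_. x}\<rparr>"

definition top_pi0_map :: "'c topology \<Rightarrow> ('b \<Rightarrow> 'c) \<Rightarrow> 'b set \<Rightarrow> 'c set" where
  "top_pi0_map Y f P = block (path_components_of Y) (f ` P)"

text \<open>\<open>top_pi_map i Y f x\<close> is the map \<open>\<pi>\<^sub>i(X,x) \<rightarrow> \<pi>\<^sub>i(Y,f x)\<close> induced by \<open>f : X \<rightarrow> Y\<close>.\<close>

definition top_pi_map :: "nat \<Rightarrow> 'c topology \<Rightarrow> ('b \<Rightarrow> 'c) \<Rightarrow> 'b \<Rightarrow>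
    ((nat \<Rightarrow> real) \<Rightarrow> 'b) set \<Rightarrow> ((nat \<Rightarrow> real) \<Rightarrow> 'c) set" where
  "top_pi_map i Y f x P = block (loop_classes i Y (f x)) ((\<lambda>p. f \<circ> p) ` P)"

definition top_pi0_bij :: "'b topology \<Rightarrow> 'c topology \<Rightarrow> ('b \<Rightarrow> 'c) \<Rightarrow> bool" where
  "top_pi0_bij X Y f \<longleftrightarrow>
     bij_betw (top_pi0_map Y f) (path_components_of X) (path_components_of Y)"

definition top_pi_iso :: "nat \<Rightarrow> 'b topology \<Rightarrow> 'c topology \<Rightarrow> ('b \<Rightarrow> 'c) \<Rightarrow> bool" where
  "top_pi_iso i X Y f \<longleftrightarrow>
     (\<forall>x\<in>topspace X. top_pi_map i Y f x \<in> iso (top_pi i X x) (top_pi i Y (f x)))"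

definition pi_vanish_above :: "nat \<Rightarrow> 'b topology \<Rightarrow> bool" where
  "pi_vanish_above n X \<longleftrightarrow>
     (\<forall>i>n. \<forall>x\<in>topspace X. carrier (top_pi i X x) = {\<one>\<^bsub>top_pi i X x\<^esub>})"

definition weak_homotopy_equivalence :: "'b topology \<Rightarrow> 'c topology \<Rightarrow> ('b \<Rightarrow> 'c) \<Rightarrow> bool" where
  "weak_homotopy_equivalence X Y f \<longleftrightarrow>
     continuous_map X Y f \<and> top_pi0_bij X Y f \<and> (\<forall>i\<ge>1. top_pi_iso i X Y f)"

text \<open>Zigzags of weak homotopy equivalences.\<close>

definition weak_equivalent :: "'b topology \<Rightarrow> 'b topology \<Rightarrow> bool" where
  "weak_equivalent = equivclp (\<lambda>X Y. \<exists>f. weak_homotopy_equivalence X Y f)"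

text \<open>\<open>T\<close> is an \<open>n\<close>-truncation (\<open>n\<close>-th Postnikov stage) of \<open>X\<close>. If \<open>X\<close> is a CW complex, such \<open>T\<close>
  are unique up to weak equivalence and closed under it.\<close>

definition is_truncation :: "nat \<Rightarrow> 'b topology \<Rightarrow> 'c topology \<Rightarrow> bool" where
  "is_truncation n X T \<longleftrightarrow>
     (\<exists>f. continuous_map X T f \<and> top_pi0_bij X T f \<and> (\<forall>i. 1 \<le> i \<and> i \<le> n \<longrightarrow> top_pi_iso i X T f)) \<and>
     pi_vanish_above n T"


section \<open>Realization functors\<close>

text \<open>\<open>R\<close> and \<open>Rm\<close> are the functor on objects and on morphisms \<open>F : A \<rightarrow> B\<close>; the assumption
  \<open>functor_cong\<close> says that \<open>Rm\<close> depends only on \<open>F\<close> as a morphism, not on its values outside the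
  carriers.\<close>

locale realization_functor =
  fixes n :: nat
    and R :: "'a ncat \<Rightarrow> 'b topology"
    and Rm :: "'a ncat \<Rightarrow> 'a ncat \<Rightarrow> ('a, 'a) nfun \<Rightarrow> 'b \<Rightarrow> 'b"
    and r :: "'a ncat \<Rightarrow> 'a \<Rightarrow> 'b"
    and \<zeta>0 :: "'a ncat \<Rightarrow> 'a set \<Rightarrow> 'b set"
    and \<zeta> :: "nat \<Rightarrow> 'a ncat \<Rightarrow> 'a \<Rightarrow> 'a set \<Rightarrow> ((nat \<Rightarrow> real) \<Rightarrow> 'b) set"
  assumes functor_continuous:
      "\<lbrakk>strict_ngpd n A; strict_ngpd n B; is_nfun n A B F\<rbrakk> \<Longrightarrow> continuous_map (R A) (R B) (Rm A B F)"
    and functor_cong: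
      "\<lbrakk>strict_ngpd n A; strict_ngpd n B; is_nfun n A B F; is_nfun n A B G; nfun_eq n A F G;
        p \<in> topspace (R A)\<rbrakk> \<Longrightarrow> Rm A B F p = Rm A B G p"
    and functor_id:
      "\<lbrakk>strict_ngpd n A; p \<in> topspace (R A)\<rbrakk> \<Longrightarrow> Rm A A (nfun_id n) p = p"
    and functor_comp:
      "\<lbrakk>strict_ngpd n A; strict_ngpd n B; strict_ngpd n C; is_nfun n A B F; is_nfun n B C G;
        p \<in> topspace (R A)\<rbrakk> \<Longrightarrow> Rm A C (nfun_comp G F) p = Rm B C G (Rm A B F p)"
    and r_point:
      "\<lbrakk>strict_ngpd n A; a \<in> Ob A\<rbrakk> \<Longrightarrow> r A a \<in> topspace (R A)"
    and r_natural:
      "\<lbrakk>strict_ngpd n A; strict_ngpd n B; is_nfun n A B F; a \<in> Ob A\<rbrakk> \<Longrightarrow>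
        Rm A B F (r A a) = r B (obf F a)"
    and \<zeta>0_bij:
      "strict_ngpd n A \<Longrightarrow> bij_betw (\<zeta>0 A) (ncat_pi0 A) (path_components_of (R A))"
    and \<zeta>0_natural:
      "\<lbrakk>strict_ngpd n A; strict_ngpd n B; is_nfun n A B F; X \<in> ncat_pi0 A\<rbrakk> \<Longrightarrow>
        top_pi0_map (R B) (Rm A B F) (\<zeta>0 A X) = \<zeta>0 B (ncat_pi0_map B F X)"
    and \<zeta>_iso:
      "\<lbrakk>strict_ngpd n A; a \<in> Ob A; 1 \<le> i; i \<le> n\<rbrakk> \<Longrightarrow>
        \<zeta> i A a \<in> iso (ncat_pi i A a) (top_pi i (R A) (r A a))"
    and \<zeta>_natural:
      "\<lbrakk>strict_ngpd n A; strict_ngpd n B; is_nfun n A B F; a \<in> Ob A; 1 \<le> i; i \<le> n;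
        X \<in> carrier (ncat_pi i A a)\<rbrakk> \<Longrightarrow>
        top_pi_map i (R B) (Rm A B F) (r A a) (\<zeta> i A a X) =
        \<zeta> i B (obf F a) (ncat_pi_map i A B F a X)"
    and pi_vanish:
      "strict_ngpd n A \<Longrightarrow> pi_vanish_above n (R A)"

end

theory Submission
  imports Defs
begin

text \<open>The composite of a generator of \<open>\<pi>\<^sub>2(S\<^sup>2)\<close> with the Hopf map \<open>S\<^sup>3 \<rightarrow> S\<^sup>2\<close> is essential, because a null
  homotopy would lift to a contraction of \<open>S\<^sup>3\<close>. This property is natural in the space, hence passes
  to the 3-type and along weak equivalences.

  In a strict 3-groupoid \<open>C\<close> it is impossible. Restricting \<open>C\<close> to one object \<open>c\<close> and the 1-cell \<open>1\<^sub>c\<close> keeps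
  \<open>\<pi>\<^sub>2\<close> and \<open>\<pi>\<^sub>3\<close>. On the groupoid of 2-cells and 3-cells that remains, the two compositions agree and are
  strictly commutative by the Eckmann--Hilton argument. Hence the arrows modulo the identities, with
  the tensor product, form an abelian group \<open>Q\<close> that contains \<open>\<pi>\<^sub>3\<close>, and the quotient map is a strict
  functor \<open>F\<close> to the threefold delooping of \<open>Q\<close>, which has trivial \<open>\<pi>\<^sub>2\<close>. The realization of \<open>F\<close> kills every
  composite of a map \<open>S\<^sup>2 \<rightarrow> \<Re>(C)\<close> with the Hopf map, but is injective on \<open>\<pi>\<^sub>3\<close>.

  The elements of \<open>Q\<close> have to be encoded in the universe \<open>'a\<close>. This is possible because \<open>'a\<close> is infinite,
  which follows from the infinity of \<open>\<pi>\<^sub>2(S\<^sup>2)\<close>.\<close>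

section \<open>Maps from a sphere with base point\<close>

text \<open>A realization functor is only known to match homotopy groups naturally; nothing says how
  composition with the Hopf map looks inside \<open>C\<close>. Hence the composite is never computed
  in \<open>C\<close>. A strict functor that is zero on pi_2 and injective on pi_3 is enough,
  because naturality then forces every Hopf composite to vanish. Such a functor cannot be expected
  of a weak 3-groupoid: there the tensor product of 2-cells commutes only up to a braiding, and the
  self-braiding of a 2-cell is its Hopf composite. Strictness turns the braiding into an identity,
  which is what makes composition and tensor product agree modulo identities. Weak inverses of
  2-cells then make it possible to cancel the identities again on pi_3. The other difficulty is base
  points. The zigzag moves them, and \<open>\<zeta>\<close> controls homotopy groups only at points
  \<open>r A a\<close>. Essentiality is therefore stated with free homotopies, and a free null
  homotopy is made based whenever a map of homotopy groups is applied.\<close>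

abbreviation usph :: "'e::euclidean_space set" where
  "usph \<equiv> sphere 0 1"

text \<open>Splitting off a height coordinate makes the dimension of the sphere equal to
  \<open>DIM('v)\<close>, hence to the dimension of the cube in \<open>cube_loops\<close>. The cases
  used are \<open>complex\<close> for the 2-sphere and \<open>complex \<times> real\<close> for the
  3-sphere.\<close>

abbreviation pole :: "'v::euclidean_space \<times> real" where
  "pole \<equiv> (0, 1)"

abbreviation homotopic_based ::
    "'b topology \<Rightarrow> 'b \<Rightarrow> ('v::euclidean_space \<times> real \<Rightarrow> 'b) \<Rightarrow> ('v \<times> real \<Rightarrow> 'b) \<Rightarrow> bool" where
  "homotopic_based X x \<equiv> homotopic_with (\<lambda>h. h pole = x) (top_of_set usph) X"

abbreviation homotopic_free ::
    "'b topology \<Rightarrow> ('e::euclidean_space \<Rightarrow> 'b) \<Rightarrow> ('e \<Rightarrow> 'b) \<Rightarrow> bool" where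
  "homotopic_free X \<equiv> homotopic_with (\<lambda>_. True) (top_of_set usph) X"

abbreviation cylinder :: "(real \<times> 'e::euclidean_space) topology" where
  "cylinder \<equiv> top_of_set ({0..1} \<times> usph)"

text \<open>The homotopy is free, so that the notion survives a change of base point;
  \<open>null_map_imp_based\<close> recovers the based version.\<close>

definition null_map :: "'b topology \<Rightarrow> ('e::euclidean_space \<Rightarrow> 'b) \<Rightarrow> bool" where
  "null_map X g \<longleftrightarrow> (\<exists>c. homotopic_free X g (\<lambda>_. c))"

lemma pole_in_usph [simp]: "pole \<in> usph"
  by (simp add: norm_Pair)

lemma homotopic_basedI:
  fixes h :: "real \<times> _ \<Rightarrow> _"
  assumes "continuous_map cylinder X h"
    and "\<And>x. x \<in> usph \<Longrightarrow> h (0, x) = f x" and "\<And>x. x \<in> usph \<Longrightarrow> h (1, x) = g x"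
    and "\<And>t. t \<in> {0..1} \<Longrightarrow> h (t, pole) = y"
  shows "homotopic_based X y f g"
  using assms by (subst homotopic_with) (auto simp: norm_Pair simp del: mem_sphere_0 intro!: exI[of _ h])

lemma homotopic_basedE:
  assumes "homotopic_based X y f g"
  obtains h :: "real \<times> _ \<Rightarrow> _" where "continuous_map cylinder X h"
    "\<And>x. x \<in> usph \<Longrightarrow> h (0, x) = f x" "\<And>x. x \<in> usph \<Longrightarrow> h (1, x) = g x"
    "\<And>t. t \<in> {0..1} \<Longrightarrow> h (t, pole) = y"
  using assms unfolding homotopic_with_def prod_topology_subtopology_eu by metis

lemma homotopic_freeI:
  fixes h :: "real \<times> _ \<Rightarrow> _"
  assumes "continuous_map cylinder X h"
    and "\<And>x. x \<in> usph \<Longrightarrow> h (0, x) = f x" and "\<And>x. x \<in> usph \<Longrightarrow> h (1, x) = g x"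
  shows "homotopic_free X f g"
  using assms by (subst homotopic_with) (auto simp del: mem_sphere_0 intro!: exI[of _ h])

lemma homotopic_freeE:
  assumes "homotopic_free X f g"
  obtains h :: "real \<times> _ \<Rightarrow> _" where "continuous_map cylinder X h"
    "\<And>x. x \<in> usph \<Longrightarrow> h (0, x) = f x" "\<And>x. x \<in> usph \<Longrightarrow> h (1, x) = g x"
  using assms unfolding homotopic_with_def prod_topology_subtopology_eu by metis

lemma homotopic_based_imp_free: "homotopic_based X y f g \<Longrightarrow> homotopic_free X f g"
  by (rule homotopic_with_mono) auto

lemma null_map_cong_free:
  assumes "homotopic_free X f g" shows "null_map X f \<longleftrightarrow> null_map X g"
  unfolding null_map_def using assms homotopic_with_trans homotopic_with_symD by (metis (full_types))

lemma null_map_compose: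
  assumes "null_map X f" "continuous_map X Y k"
  shows "null_map Y (\<lambda>x. k (f x))"
proof -
  obtain c where "homotopic_free X f (\<lambda>_. c)" using assms(1) by (auto simp: null_map_def)
  then have "homotopic_free Y (k \<circ> f) (k \<circ> (\<lambda>_. c))"
    using assms(2) by (rule homotopic_with_compose_continuous_map_left) auto
  then show ?thesis by (auto simp: null_map_def o_def)
qed

lemma null_map_compose_right:
  assumes "null_map X f" "continuous_on usph k" "k ` usph \<subseteq> usph"
  shows "null_map X (\<lambda>x. f (k x))"
proof -
  obtain c where "homotopic_free X f (\<lambda>_. c)" using assms(1) by (auto simp: null_map_def)
  then have "homotopic_free X (f \<circ> k) ((\<lambda>_. c) \<circ> k)"
    by (rule homotopic_with_compose_continuous_map_right) (use assms in auto)
  then show ?thesis by (auto simp: null_map_def o_def)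
qed

lemma homotopic_free_compose_right:
  assumes "homotopic_free X f g" "continuous_on usph k" "k ` usph \<subseteq> usph"
  shows "homotopic_free X (\<lambda>x. f (k x)) (\<lambda>x. g (k x))"
proof -
  have "homotopic_free X (f \<circ> k) (g \<circ> k)"
    using assms by (intro homotopic_with_compose_continuous_map_right[OF assms(1)]) auto
  then show ?thesis by (simp add: o_def)
qed

subsection \<open>Moving the base point along a path\<close>

text \<open>The map \<open>fold_map\<close> doubles the angle from the south pole, so that it stretches the lower
  hemisphere over the whole sphere and sends the equator to the north pole.\<close>

definition fold_map :: "'v::euclidean_space \<times> real \<Rightarrow> 'v \<times> real" where
  "fold_map x = pole - (2 * snd x) *\<^sub>R x"

text \<open>Change of base point along a path: the lower hemisphere carries \<open>g\<close>, and
  the upper one runs along \<open>\<delta>\<close> by height, so that the new base point is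
  \<open>\<delta> 1\<close>.\<close>

definition drag :: "(real \<Rightarrow> 'b) \<Rightarrow> ('v::euclidean_space \<times> real \<Rightarrow> 'b) \<Rightarrow> 'v \<times> real \<Rightarrow> 'b" where
  "drag \<delta> g x = (if 0 \<le> snd x then \<delta> (snd x) else g (fold_map x))"

lemma usph_prod_iff: "x \<in> usph \<longleftrightarrow> norm (fst x) ^ 2 + snd x ^ 2 = 1"
  for x :: "'v::euclidean_space \<times> real"
  by (cases x) (auto simp: norm_Pair real_sqrt_eq_1_iff)

lemma usph_snd_bounds:
  fixes x :: "'v::euclidean_space \<times> real"
  assumes "x \<in> usph" shows "-1 \<le> snd x" "snd x \<le> 1"
proof -
  have "snd x ^ 2 \<le> 1\<^sup>2" using assms unfolding usph_prod_iff
    by (metis le_add_same_cancel2 one_power2 zero_le_power2)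
  then have "\<bar>snd x\<bar> \<le> 1" using abs_le_square_iff[of "snd x" 1] by simp
  then show "-1 \<le> snd x" "snd x \<le> 1" by auto
qed

text \<open>Since \<open>snd x\<close> is the inner product of \<open>x\<close> with the pole,
  \<open>fold_map x\<close> is the reflection of the pole in the hyperplane orthogonal to
  \<open>x\<close>, which preserves the norm.\<close>

lemma fold_map_usph [simp]: "x \<in> usph \<Longrightarrow> fold_map x \<in> usph"
proof -
  assume "x \<in> usph"
  then have *: "norm (fst x) ^ 2 = 1 - snd x ^ 2" unfolding usph_prod_iff by simp
  have "norm (fst (fold_map x)) ^ 2 = (2 * snd x)\<^sup>2 * norm (fst x) ^ 2"
    by (simp add: fold_map_def power_mult_distrib)
  then have "norm (fst (fold_map x)) ^ 2 + snd (fold_map x) ^ 2 = 1"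
    unfolding * by (simp add: fold_map_def power2_eq_square algebra_simps)
  then show ?thesis unfolding usph_prod_iff .
qed

lemma fold_map_equator: "snd x = 0 \<Longrightarrow> fold_map x = pole"
  by (simp add: fold_map_def)

text \<open>The parameter \<open>z\<close> makes one continuity proof serve both single maps and
  homotopies. The two branches agree on the equator, where \<open>fold_map\<close> takes the value
  \<open>pole\<close>.\<close>

lemma continuous_map_drag:
  fixes g :: "'z::euclidean_space \<Rightarrow> 'v::euclidean_space \<times> real \<Rightarrow> 'b"
  assumes g: "continuous_map (top_of_set (Z \<times> usph)) X (\<lambda>(z, x). g z x)"
    and \<delta>: "continuous_map (top_of_set (Z \<times> {0..1})) X (\<lambda>(z, u). \<delta> z u)"
    and eq: "\<And>z. z \<in> Z \<Longrightarrow> g z pole = \<delta> z 0"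
  shows "continuous_map (top_of_set (Z \<times> usph)) X (\<lambda>(z, x). drag (\<delta> z) (g z) x)"
proof -
  let ?A = "top_of_set (Z \<times> (usph :: ('v \<times> real) set))"
  have "continuous_map ?A X (\<lambda>zx. if 0 \<le> snd (snd zx) then (\<lambda>(z, u). \<delta> z u) (fst zx, snd (snd zx))
      else (\<lambda>(z, x). g z x) (fst zx, fold_map (snd zx)))"
  proof (rule continuous_map_cases_le)
    show "continuous_map ?A euclideanreal (\<lambda>x. 0)" "continuous_map ?A euclideanreal (\<lambda>x. snd (snd x))"
      by (auto intro!: continuous_intros)
    show "continuous_map (subtopology ?A {x \<in> topspace ?A. 0 \<le> snd (snd x)}) X
       (\<lambda>zx. (\<lambda>(z, u). \<delta> z u) (fst zx, snd (snd zx)))"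
      unfolding subtopology_subtopology
      by (rule continuous_map_compose[OF _ \<delta>, unfolded o_def])
        (auto intro!: continuous_intros dest!: usph_snd_bounds(2)[unfolded mem_sphere_0])
    show "continuous_map (subtopology ?A {x \<in> topspace ?A. snd (snd x) \<le> 0}) X
       (\<lambda>zx. (\<lambda>(z, x). g z x) (fst zx, fold_map (snd zx)))"
      unfolding subtopology_subtopology
      apply (rule continuous_map_compose[OF _ g, unfolded o_def])
      using fold_map_usph by (fastforce intro!: continuous_intros simp: fold_map_def)
  qed (auto simp: fold_map_equator eq)
  then show ?thesis unfolding drag_def case_prod_unfold fst_conv snd_conv .
qed

lemma continuous_map_drag1:
  assumes g: "continuous_map (top_of_set usph) X g"
    and \<delta>: "continuous_map (top_of_set {0..1}) X \<delta>" and eq: "g pole = \<delta> 0"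
  shows "continuous_map (top_of_set usph) X (drag \<delta> g)"
proof -
  have "continuous_map (top_of_set ({0::real} \<times> usph)) X (\<lambda>(z, x). drag \<delta> g x)"
    by (rule continuous_map_drag)
      (auto simp: case_prod_unfold eq
        intro!: continuous_map_compose[OF _ g, unfolded o_def] continuous_map_compose[OF _ \<delta>, unfolded o_def] continuous_intros)
  then have "continuous_map (top_of_set usph) X (\<lambda>x. (\<lambda>(z, x). drag \<delta> g x) (0::real, x))"
    by (rule continuous_map_compose[unfolded o_def, rotated]) (auto intro!: continuous_intros)
  then show ?thesis by simp
qed

lemma drag_pole [simp]: "drag \<delta> g pole = \<delta> 1"
  by (simp add: drag_def)

lemma drag_cong:
  assumes "\<And>y. y \<in> usph \<Longrightarrow> g y = g' y" "x \<in> usph"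
  shows "drag \<delta> g x = drag \<delta> g' x"
  using assms(1)[OF fold_map_usph[OF assms(2)]] by (simp add: drag_def)

lemma drag_const_eq: "drag (\<lambda>_. g pole) g x = g (drag (\<lambda>_. pole) (\<lambda>x. x) x)"
  by (simp add: drag_def)

lemma drag_const_usph: "x \<in> usph \<Longrightarrow> drag (\<lambda>_. pole) (\<lambda>x. x) x \<in> usph"
  using fold_map_usph[of x] by (cases "0 \<le> snd x") (simp_all add: drag_def norm_Pair)

lemma continuous_on_drag_const: "continuous_on usph (drag (\<lambda>_. pole) (\<lambda>x. x))"
  using continuous_map_drag1[of euclidean "\<lambda>x. x" "\<lambda>_. pole"] by simp

text \<open>The straight segment to the identity is normalized. It could meet 0 only where the first
  map sends \<open>x\<close> to \<open>- x\<close>. In the upper hemisphere the value is the pole,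
  which excludes this; in the lower one only the south pole would remain, and
  \<open>fold_map\<close> fixes it.\<close>

lemma homotopic_based_fold:
  "homotopic_based (top_of_set usph) pole (drag (\<lambda>_. pole) (\<lambda>x. x)) (\<lambda>x::'v::euclidean_space \<times> real. x)"
proof -
  let ?f = "drag (\<lambda>_. pole) (\<lambda>x. x) :: 'v \<times> real \<Rightarrow> 'v \<times> real"
  define k where "k s x = (1 - s) *\<^sub>R ?f x + s *\<^sub>R x" for s and x :: "'v \<times> real"
  have nz: "k s x \<noteq> 0" if x: "x \<in> usph" and s: "s \<in> {0..1}" for s x
  proof
    assume k0: "k s x = 0"
    then have "(1 - s) *\<^sub>R ?f x = - (s *\<^sub>R x)" by (simp add: k_def add_eq_0_iff2)
    then have "norm ((1 - s) *\<^sub>R ?f x) = norm (s *\<^sub>R x)" by simp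
    then have "1 - s = s" using s x drag_const_usph[OF x] by simp
    then have s2: "s = 1/2" by simp
    have eq: "?f x = - x" using k0 unfolding k_def s2 by (simp add: scaleR_add_right[symmetric] add_eq_0_iff2)
    show False
    proof (cases "0 \<le> snd x")
      case True then show False using eq by (auto simp: drag_def prod_eq_iff)
    next
      case False
      then have e: "pole - (2 * snd x) *\<^sub>R x = - x" using eq by (simp add: drag_def fold_map_def)
      then have "fst x = (2 * snd x) *\<^sub>R fst x" "1 - 2 * snd x * snd x = - snd x"
        by (auto simp: prod_eq_iff)
      moreover have "2 * snd x \<noteq> 1" using False by auto
      ultimately have "fst x = 0" by (metis scaleR_one scaleR_right_imp_eq)
      then have "snd x ^ 2 = 1" using x unfolding usph_prod_iff by simp
      then have "snd x = -1" using False by (simp add: power2_eq_1_iff)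
      then show False using \<open>1 - 2 * snd x * snd x = - snd x\<close> by simp
    qed
  qed
  have ck: "continuous_on ({0..1} \<times> usph) (\<lambda>p. k (fst p) (snd p))"
    unfolding k_def
    by (intro continuous_intros continuous_on_compose2[OF continuous_on_drag_const]) auto
  show ?thesis
  proof (rule homotopic_basedI)
    show "continuous_map cylinder (top_of_set usph) (\<lambda>p. k (fst p) (snd p) /\<^sub>R norm (k (fst p) (snd p)))"
      using nz by (auto intro!: continuous_intros ck)
  next
    fix x :: "'v \<times> real" assume x: "x \<in> usph"
    show "k (fst (0, x)) (snd (0, x)) /\<^sub>R norm (k (fst (0, x)) (snd (0, x))) = ?f x"
      using drag_const_usph[OF x] by (simp add: k_def)
    show "k (fst (1, x)) (snd (1, x)) /\<^sub>R norm (k (fst (1, x)) (snd (1, x))) = x"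
      using x by (simp add: k_def)
  next
    fix t :: real assume "t \<in> {0..1}"
    then have "k t pole = pole" by (simp add: k_def scaleR_left_distrib[symmetric])
    then show "k (fst (t, pole)) (snd (t, pole)) /\<^sub>R norm (k (fst (t, pole)) (snd (t, pole))) = pole"
      by (simp add: norm_Pair)
  qed
qed

lemma homotopic_based_drag_const:
  assumes "continuous_map (top_of_set usph) X g"
  shows "homotopic_based X (g pole) (drag (\<lambda>_. g pole) g) g"
proof -
  have "homotopic_based X (g pole) (g \<circ> drag (\<lambda>_. pole) (\<lambda>x. x)) (g \<circ> (\<lambda>x. x))"
    by (rule homotopic_with_compose_continuous_map_left[OF homotopic_based_fold assms]) auto
  then show ?thesis by (simp add: o_def drag_const_eq[symmetric])
qed

lemma path_reparam:
  assumes "continuous_map (top_of_set {0..1}) X \<delta>" "continuous_on S k" "k ` S \<subseteq> {0..1::real}"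
  shows "continuous_map (top_of_set S) X (\<lambda>x. \<delta> (k x))"
  by (rule continuous_map_compose[OF _ assms(1), unfolded o_def]) (use assms in auto)

lemma usph_reparam:
  assumes "continuous_map (top_of_set T) X g" "continuous_on S k" "k ` S \<subseteq> T"
  shows "continuous_map (top_of_set S) X (\<lambda>x. g (k x))"
  by (rule continuous_map_compose[OF _ assms(1), unfolded o_def]) (use assms in auto)

text \<open>The path is shortened to its initial piece \<open>\<delta> (z * u)\<close>; at
  \<open>z = 0\<close> only the drag along a constant path is left, which is homotopic to
  \<open>g\<close>.\<close>

lemma homotopic_free_drag:
  assumes g: "continuous_map (top_of_set usph) X g"
    and \<delta>: "continuous_map (top_of_set {0..1}) X \<delta>" and eq: "g pole = \<delta> 0"
  shows "homotopic_free X g (drag \<delta> g)"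
proof -
  have "continuous_map cylinder X (\<lambda>(z, x). drag (\<lambda>u. \<delta> (z * u)) g x)"
    by (rule continuous_map_drag)
      (auto simp: case_prod_unfold eq mult_le_one
        intro!: usph_reparam[OF g] path_reparam[OF \<delta>] continuous_intros)
  then have "homotopic_free X (drag (\<lambda>_. g pole) g) (drag \<delta> g)"
    by (rule homotopic_freeI) (auto simp: eq)
  then show ?thesis
    using homotopic_based_imp_free[OF homotopic_based_drag_const[OF g]]
    by (meson homotopic_with_symD homotopic_with_trans)
qed

lemma homotopic_based_drag:
  assumes h: "homotopic_based X y g g'"
    and \<delta>: "continuous_map (top_of_set {0..1}) X \<delta>" and eq: "\<delta> 0 = y"
  shows "homotopic_based X (\<delta> 1) (drag \<delta> g) (drag \<delta> g')"
proof -
  from h obtain h :: "real \<times> _ \<Rightarrow> _" where h: "continuous_map cylinder X h"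
    "\<And>x. x \<in> usph \<Longrightarrow> h (0, x) = g x" "\<And>x. x \<in> usph \<Longrightarrow> h (1, x) = g' x"
    "\<And>t. t \<in> {0..1} \<Longrightarrow> h (t, pole) = y" by (rule homotopic_basedE) blast
  have "continuous_map cylinder X (\<lambda>(z, x). drag \<delta> (\<lambda>x. h (z, x)) x)"
    by (rule continuous_map_drag[where \<delta> = "\<lambda>_. \<delta>"])
      (use h in \<open>auto simp: case_prod_unfold eq intro!: path_reparam[OF \<delta>] continuous_intros\<close>)
  then show ?thesis
    by (rule homotopic_basedI) (simp_all only: case_prod_conv drag_pole drag_cong[OF h(2)] drag_cong[OF h(3)])
qed

text \<open>Going out along \<open>\<delta>\<close> up to time \<open>z\<close> and back again fixes
  the base point throughout; letting \<open>z\<close> tend to 0 leaves two drags along constant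
  paths. This makes the change of base point injective on classes.\<close>

lemma homotopic_based_drag_back:
  assumes g: "continuous_map (top_of_set usph) X g"
    and \<delta>: "continuous_map (top_of_set {0..1}) X \<delta>" and eq: "\<delta> 0 = g pole"
  shows "homotopic_based X (g pole) (drag (\<lambda>u. \<delta> (1 - u)) (drag \<delta> g)) g"
proof -
  have 1: "continuous_map cylinder X (\<lambda>(z, x). drag (\<lambda>u. \<delta> (z * u)) g x)"
    by (rule continuous_map_drag)
      (auto simp: case_prod_unfold eq mult_le_one
        intro!: usph_reparam[OF g] path_reparam[OF \<delta>] continuous_intros)
  have "continuous_map cylinder X
      (\<lambda>(z, x). drag (\<lambda>u. \<delta> (z * (1 - u))) (drag (\<lambda>u. \<delta> (z * u)) g) x)"
    by (rule continuous_map_drag[OF 1])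
      (auto simp: case_prod_unfold eq mult_le_one
        intro!: path_reparam[OF \<delta>] continuous_intros)
  then have "homotopic_based X (g pole) (drag (\<lambda>_. g pole) (drag (\<lambda>_. g pole) g))
      (drag (\<lambda>u. \<delta> (1 - u)) (drag \<delta> g))"
    by (rule homotopic_basedI) (auto simp: eq)
  moreover have "homotopic_based X (g pole) (drag (\<lambda>_. g pole) (drag (\<lambda>_. g pole) g)) (drag (\<lambda>_. g pole) g)"
  proof -
    have "g pole \<in> topspace X"
      using continuous_map_image_subset_topspace[OF g] pole_in_usph by (metis image_subset_iff topspace_euclidean_subtopology)
    then have "continuous_map (top_of_set {0..1::real}) X (\<lambda>_. g pole)" by simp
    from homotopic_based_drag_const[OF continuous_map_drag1[OF g this refl]] show ?thesis by simp
  qed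
  ultimately show ?thesis
    using homotopic_based_drag_const[OF g] by (meson homotopic_with_symD homotopic_with_trans)
qed

text \<open>The base point moves along a path \<open>\<delta>\<close> during a free null homotopy.
  Each stage is dragged back along the part of \<open>\<delta>\<close> already covered, so that the
  base point stays put.\<close>

lemma null_map_imp_based:
  assumes n: "null_map X g"
  shows "homotopic_based X (g pole) g (\<lambda>_. g pole)"
proof -
  from n obtain c and h :: "real \<times> _ \<Rightarrow> _" where h: "continuous_map cylinder X h"
    "\<And>x. x \<in> usph \<Longrightarrow> h (0, x) = g x" "\<And>x. x \<in> usph \<Longrightarrow> h (1, x) = c"
    unfolding null_map_def by (elim exE homotopic_freeE) blast
  define \<delta> where "\<delta> u = h (u, pole)" for u
  have g: "continuous_map (top_of_set usph) X g"
    using n unfolding null_map_def using homotopic_with_imp_continuous_maps by blast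
  have \<delta>: "continuous_map (top_of_set {0..1}) X \<delta>"
    unfolding \<delta>_def by (rule usph_reparam[OF h(1)]) (auto intro!: continuous_intros simp: norm_Pair)
  have gp: "\<delta> 0 = g pole" "\<delta> 1 = c" using h by (auto simp: \<delta>_def norm_Pair)
  \<comment> \<open>At stage \<open>z\<close> the path \<open>\<delta> (z * (1 - u))\<close> starts
    at the current position of the pole and ends at the original base point.\<close>
  have "continuous_map cylinder X
      (\<lambda>(z, x). drag (\<lambda>u. \<delta> (z * (1 - u))) (\<lambda>x. h (z, x)) x)"
    by (rule continuous_map_drag)
      (auto simp: case_prod_unfold mult_le_one \<delta>_def
        intro!: path_reparam[OF \<delta>, unfolded \<delta>_def] continuous_intros h(1))
  then have 1: "homotopic_based X (g pole) (drag (\<lambda>_. g pole) g) (drag (\<lambda>u. \<delta> (1 - u)) (\<lambda>_. c))"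
    by (rule homotopic_basedI) (simp_all only: case_prod_conv mult_0 mult_1 gp diff_self drag_pole mult_zero_right drag_cong[OF h(2)] drag_cong[OF h(3)] mult_zero_left)
  \<comment> \<open>The last stage is a constant map with a tail along the reversed path. Here
    \<open>max 0\<close> puts the lower hemisphere at the start of that tail, and the tail is
    retracted to its end.\<close>
  have "continuous_map cylinder X
      (\<lambda>p. \<delta> ((1 - fst p) * (1 - max 0 (snd (snd p)))))"
    by (rule path_reparam[OF \<delta>])
      (auto dest!: usph_snd_bounds(2)[unfolded mem_sphere_0] intro!: continuous_intros mult_nonneg_nonneg mult_le_one)
  then have 2: "homotopic_based X (g pole) (drag (\<lambda>u. \<delta> (1 - u)) (\<lambda>_. c)) (\<lambda>_. g pole)"
    by (rule homotopic_basedI) (use gp in \<open>auto simp: drag_def max_def\<close>)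
  show ?thesis
    using homotopic_with_trans[OF homotopic_with_trans[OF homotopic_with_symD[OF homotopic_based_drag_const[OF g]] 1] 2] .
qed

section \<open>Collapsing the boundary of a cube\<close>

text \<open>Positive in the interior of the box and zero on its boundary. In cube coordinates
  \<open>y = 2 * t - 1\<close> each factor is \<open>t * (1 - t)\<close>.\<close>

definition box_gap :: "'v::euclidean_space \<Rightarrow> real" where
  "box_gap y = (\<Prod>b\<in>Basis. (1 - (y \<bullet> b)\<^sup>2) / 4)"

text \<open>This is the inverse stereographic projection of \<open>y / box_gap y\<close>, with denominators cleared.\<close>

definition box_collapse :: "'v::euclidean_space \<Rightarrow> 'v \<times> real" where
  "box_collapse y = (1 / ((norm y)\<^sup>2 + (box_gap y)\<^sup>2)) *\<^sub>R
     ((2 * box_gap y) *\<^sub>R y, (norm y)\<^sup>2 - (box_gap y)\<^sup>2)"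

abbreviation unit_box :: "'v::euclidean_space set" where
  "unit_box \<equiv> {y. \<forall>b\<in>Basis. \<bar>y \<bullet> b\<bar> \<le> 1}"

lemma continuous_on_box_gap [continuous_intros]:
  "continuous_on S f \<Longrightarrow> continuous_on S (\<lambda>x. box_gap (f x))"
  unfolding box_gap_def by (intro continuous_intros) auto

lemma box_gap_zero: "box_gap (0 :: 'v::euclidean_space) > 0"
  by (simp add: box_gap_def)

lemma box_collapse_denom: "(norm y)\<^sup>2 + (box_gap y)\<^sup>2 > 0"
  for y :: "'v::euclidean_space"
proof (cases "y = 0")
  case True then show ?thesis using box_gap_zero[where 'v='v] by simp
qed (simp add: add_pos_nonneg)

lemma box_gap_nonneg: "y \<in> unit_box \<Longrightarrow> box_gap y \<ge> 0"
  unfolding box_gap_def by (intro prod_nonneg) (auto simp: abs_square_le_1)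

lemma box_gap_eq_0_iff: "box_gap y = 0 \<longleftrightarrow> (\<exists>b\<in>Basis. \<bar>y \<bullet> b\<bar> = 1)"
proof -
  have "(1 - r\<^sup>2) / 4 = 0 \<longleftrightarrow> \<bar>r\<bar> = 1" for r :: real
    using abs_square_eq_1[of r] by (auto simp del: abs_square_eq_1)
  then show ?thesis by (simp add: box_gap_def del: divide_eq_0_iff)
qed

lemma box_gap_antimono:
  assumes "\<And>b. b \<in> Basis \<Longrightarrow> \<bar>y \<bullet> b\<bar> \<le> \<bar>z \<bullet> b\<bar>" "z \<in> unit_box"
  shows "box_gap z \<le> box_gap y"
  unfolding box_gap_def
proof (rule prod_mono, intro conjI)
  fix b :: 'a assume b: "b \<in> Basis"
  show "0 \<le> (1 - (z \<bullet> b)\<^sup>2) / 4" using assms(2) b by (auto simp: abs_square_le_1)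
  have "(y \<bullet> b)\<^sup>2 \<le> (z \<bullet> b)\<^sup>2" using assms(1)[OF b] by (simp add: abs_le_square_iff)
  then show "(1 - (z \<bullet> b)\<^sup>2) / 4 \<le> (1 - (y \<bullet> b)\<^sup>2) / 4" by simp
qed

lemma box_collapse_usph: "box_collapse y \<in> usph"
proof -
  define q d n where "q = (norm y)\<^sup>2 + (box_gap y)\<^sup>2" and "d = box_gap y" and "n = norm y"
  have q: "q > 0" "q = n\<^sup>2 + d\<^sup>2" using box_collapse_denom by (auto simp: q_def d_def n_def)
  have "norm (fst (box_collapse y)) ^ 2 = (2 * d * n / q)\<^sup>2"
    by (simp add: box_collapse_def power_mult_distrib power_divide d_def n_def q_def)
  moreover have "snd (box_collapse y) = (n\<^sup>2 - d\<^sup>2) / q"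
    by (simp add: box_collapse_def d_def n_def q_def)
  moreover have "(2 * d * n / q)\<^sup>2 + ((n\<^sup>2 - d\<^sup>2) / q)\<^sup>2 = 1"
  proof -
    have "(2 * d * n)\<^sup>2 + (n\<^sup>2 - d\<^sup>2)\<^sup>2 = q\<^sup>2"
      unfolding q(2) by (simp add: power2_eq_square algebra_simps)
    then show ?thesis using q(1) by (simp add: power_divide add_divide_distrib[symmetric])
  qed
  ultimately show ?thesis unfolding usph_prod_iff by simp
qed

lemma box_collapse_eq_pole_iff: "box_collapse y = pole \<longleftrightarrow> box_gap y = 0"
proof
  assume eq: "box_collapse y = pole"
  define d n where "d = (box_gap y)\<^sup>2" and "n = (norm y)\<^sup>2"
  have "n + d > 0" using box_collapse_denom[of y] by (simp add: d_def n_def)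
  moreover have "(n - d) / (n + d) = 1"
    using arg_cong[OF eq, of snd] unfolding box_collapse_def d_def n_def
    by (simp only: snd_scaleR snd_conv real_scaleR_def times_divide_eq_left mult_1)
  ultimately have "d = 0" by (simp add: divide_eq_1_iff)
  then show "box_gap y = 0" by (simp add: d_def)
next
  assume "box_gap y = 0"
  then show "box_collapse y = pole" using box_collapse_denom[of y] by (simp add: box_collapse_def)
qed


text \<open>Stereographic projection from the pole inverts the collapse up to the rescaling of
  \<open>y\<close> by its gap.\<close>

lemma box_collapse_ratio:
  assumes "box_gap y \<noteq> 0"
  shows "(1 / (1 - snd (box_collapse y))) *\<^sub>R fst (box_collapse y) = (1 / box_gap y) *\<^sub>R y"
proof -
  define d where "d = box_gap y"
  define q where "q = (norm y)\<^sup>2 + d\<^sup>2"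
  have q: "q > 0" and n: "(norm y)\<^sup>2 = q - d\<^sup>2" using box_collapse_denom by (auto simp: q_def d_def)
  have d: "d \<noteq> 0" using assms by (simp add: d_def)
  have "1 - snd (box_collapse y) = 2 * d\<^sup>2 / q"
    using q unfolding box_collapse_def d_def[symmetric] q_def[symmetric] n by (simp add: field_simps)
  moreover have "fst (box_collapse y) = (2 * d / q) *\<^sub>R y"
    unfolding box_collapse_def d_def[symmetric] q_def[symmetric] by simp
  ultimately show ?thesis using q d
    by (simp add: d_def[symmetric] power2_eq_square)
qed

text \<open>Stereographic projection shows that \<open>y\<close> and \<open>z\<close> lie on one
  ray, at distances proportional to their gaps. The gap does not increase along a ray, so the point
  closer to the origin has both the smaller and the larger gap, and the gaps agree.\<close>

lemma box_collapse_inj: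
  assumes y: "y \<in> unit_box" and z: "z \<in> unit_box"
    and eq: "box_collapse y = box_collapse z" and ny: "box_gap y \<noteq> 0"
  shows "y = z"
proof -
  have nz: "box_gap z \<noteq> 0" using eq ny box_collapse_eq_pole_iff by metis
  have yz: "(1 / box_gap y) *\<^sub>R y = (1 / box_gap z) *\<^sub>R z"
    using box_collapse_ratio[OF ny] box_collapse_ratio[OF nz] eq by simp
  have pos: "box_gap y > 0" "box_gap z > 0" using box_gap_nonneg y z ny nz by force+
  have *: "box_gap y = box_gap z" if le: "box_gap y \<le> box_gap z" and yz: "(1 / box_gap y) *\<^sub>R y = (1 / box_gap z) *\<^sub>R z"
    and pos: "box_gap y > 0" "box_gap z > 0" and z: "z \<in> unit_box" for y z :: 'a
  proof -
    have "(box_gap y / box_gap z) *\<^sub>R z = box_gap y *\<^sub>R ((1 / box_gap y) *\<^sub>R y)"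
      unfolding yz by simp
    then have "y = (box_gap y / box_gap z) *\<^sub>R z" using pos by simp
    then have "\<bar>y \<bullet> b\<bar> = (box_gap y / box_gap z) * \<bar>z \<bullet> b\<bar>" for b
      using pos by (metis abs_mult abs_of_pos divide_pos_pos inner_scaleR_left)
    moreover have "(box_gap y / box_gap z) * \<bar>z \<bullet> b\<bar> \<le> 1 * \<bar>z \<bullet> b\<bar>" for b
      using le pos by (intro mult_right_mono) auto
    ultimately have "box_gap z \<le> box_gap y" by (intro box_gap_antimono z) auto
    with le show ?thesis by simp
  qed
  have "box_gap y = box_gap z"
    using *[of y z] *[of z y] yz pos y z by (cases "box_gap y \<le> box_gap z") auto
  then show ?thesis using yz pos by simp
qed

text \<open>With \<open>v\<close> the stereographic projection of \<open>x\<close>, a preimage is a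
  solution of \<open>y = box_gap y *\<^sub>R v\<close> on the ray through \<open>v\<close>, and the
  intermediate value theorem provides one.\<close>

lemma box_collapse_surj:
  assumes "x \<in> usph"
  shows "\<exists>y\<in>unit_box. box_collapse (y :: 'v::euclidean_space) = x"
proof (cases "x = pole")
  case True
  obtain b :: 'v where "b \<in> Basis" by (meson nonempty_Basis ex_in_conv)
  then have "b \<in> unit_box" "box_collapse b = pole"
    by (auto simp: box_collapse_eq_pole_iff box_gap_eq_0_iff inner_Basis intro!: bexI[of _ b])
  then show ?thesis using True by blast
next
  case False
  obtain w h where x: "x = (w, h)" by (cases x)
  have wh: "(norm w)\<^sup>2 = 1 - h\<^sup>2" using assms unfolding usph_prod_iff by (simp add: x)
  have h: "h < 1"
  proof (rule ccontr)
    assume "\<not> h < 1"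
    then have "h = 1" using usph_snd_bounds[OF assms] by (simp add: x)
    with wh False show False by (simp add: x)
  qed
  define v where "v = (1 / (1 - h)) *\<^sub>R w"
  obtain y where y: "y \<in> unit_box" "y = box_gap y *\<^sub>R v"
  proof (cases "v = 0")
    case True then show ?thesis using that[of 0] by simp
  next
    case False
    \<comment> \<open>Division by the sup norm moves \<open>v\<close> to the point \<open>u\<close>
      where its ray leaves the box.\<close>
    define m where "m = infnorm v"
    have m: "m > 0" using False by (simp add: m_def infnorm_pos_lt)
    define u where "u = (1 / m) *\<^sub>R v"
    have u1: "\<bar>u \<bullet> b\<bar> \<le> 1" if "b \<in> Basis" for b
      using Basis_le_infnorm[OF that, of v] m by (simp add: u_def m_def[symmetric])
    obtain b where b: "b \<in> Basis" "\<bar>v \<bullet> b\<bar> = m"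
    proof -
      have "m \<in> (\<lambda>i. \<bar>v \<bullet> i\<bar>) ` Basis" unfolding m_def infnorm_Max by (rule Max_in) auto
      then show ?thesis using that by auto
    qed
    have ub: "\<bar>u \<bullet> b\<bar> = 1" using b m by (simp add: u_def)
    \<comment> \<open>The function is negative at the origin, where the gap is positive, and equals
      1 at \<open>u\<close>, where the gap vanishes.\<close>
    have "\<exists>\<rho>. 0 \<le> \<rho> \<and> \<rho> \<le> 1 \<and> \<rho> - m * box_gap (\<rho> *\<^sub>R u) = 0"
    proof (rule IVT')
      show "0 - m * box_gap (0 *\<^sub>R u) \<le> 0" using m box_gap_zero[where 'v='v] by simp
      have "box_gap u = 0" using ub b by (auto simp: box_gap_eq_0_iff)
      then show "0 \<le> 1 - m * box_gap (1 *\<^sub>R u)" by simp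
    qed (auto intro!: continuous_intros)
    then obtain \<rho> where \<rho>: "0 \<le> \<rho>" "\<rho> \<le> 1" "\<rho> = m * box_gap (\<rho> *\<^sub>R u)" by auto
    show ?thesis
    proof (rule that[of "\<rho> *\<^sub>R u"])
      show "\<rho> *\<^sub>R u \<in> unit_box" using \<rho> u1 by (auto simp: abs_mult intro!: mult_le_one)
      have "\<rho> *\<^sub>R u = (\<rho> / m) *\<^sub>R v" by (simp add: u_def)
      also have "\<rho> / m = box_gap (\<rho> *\<^sub>R u)" using \<rho>(3) m by (simp add: field_simps)
      finally show "\<rho> *\<^sub>R u = box_gap (\<rho> *\<^sub>R u) *\<^sub>R v" .
    qed
  qed
  define d where "d = box_gap y"
  have d: "d \<noteq> 0"
  proof
    assume "d = 0"
    then have "y = 0" using y(2) by (simp add: d_def)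
    then show False using \<open>d = 0\<close> box_gap_zero[where 'v='v] by (simp add: d_def)
  qed
  have yd: "y = d *\<^sub>R v" using y(2) by (simp add: d_def)
  define r where "r = 1 - h"
  have r: "r > 0" "h = 1 - r" using h by (auto simp: r_def)
  have nv: "(norm v)\<^sup>2 = (2 - r) / r"
  proof -
    have "(norm v)\<^sup>2 = (1 - h\<^sup>2) / r\<^sup>2" by (simp add: v_def wh[symmetric] power_mult_distrib power_divide r_def)
    also have "1 - h\<^sup>2 = r * (2 - r)" by (simp add: r(2) power2_eq_square algebra_simps)
    finally show ?thesis using r(1) by (simp add: power2_eq_square)
  qed
  have ny: "(norm y)\<^sup>2 = d\<^sup>2 * ((2 - r) / r)" unfolding yd by (simp add: power_mult_distrib nv)
  have "(2 - r) / r + 1 = 2 / r" using r(1) by (simp add: field_simps)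
  then have q: "(norm y)\<^sup>2 + (box_gap y)\<^sup>2 = d\<^sup>2 * (2 / r)"
    unfolding ny d_def[symmetric] by (metis distrib_left mult.right_neutral)
  have "box_collapse y = x"
  proof (rule prod_eqI)
    have "fst (box_collapse y) = (1 / (d\<^sup>2 * (2 / r)) * (2 * d)) *\<^sub>R y"
      unfolding box_collapse_def q unfolding d_def[symmetric] by simp
    also have "\<dots> = (1 / (d\<^sup>2 * (2 / r)) * (2 * d) * (d / r)) *\<^sub>R w"
      by (simp add: yd v_def r_def)
    also have "1 / (d\<^sup>2 * (2 / r)) * (2 * d) * (d / r) = 1"
      using d r(1) by (simp add: power2_eq_square)
    finally show "fst (box_collapse y) = fst x" by (simp add: x)
    have "snd (box_collapse y) = (d\<^sup>2 * ((2 - r) / r) - d\<^sup>2) / (d\<^sup>2 * (2 / r))"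
      unfolding box_collapse_def q unfolding ny d_def[symmetric] by simp
    also have "d\<^sup>2 * ((2 - r) / r) - d\<^sup>2 = (d\<^sup>2 * (2 / r)) * (1 - r)"
      using r(1) by (simp add: field_simps)
    also have "\<dots> / (d\<^sup>2 * (2 / r)) = h" using d r by simp
    finally show "snd (box_collapse y) = snd x" by (simp add: x)
  qed
  with y(1) show ?thesis by blast
qed

section \<open>From the box in a Euclidean space to the cube with numbered coordinates\<close>

definition basis_enum :: "nat \<Rightarrow> 'v::euclidean_space" where
  "basis_enum = (SOME e. bij_betw e {..<DIM('v)} Basis)"

lemma basis_enum: "bij_betw (basis_enum :: nat \<Rightarrow> 'v::euclidean_space) {..<DIM('v)} Basis"
proof -
  have "\<exists>e :: nat \<Rightarrow> 'v. bij_betw e {..<DIM('v)} Basis"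
    using ex_bij_betw_nat_finite[of "Basis :: 'v set"] by (simp add: atLeast0LessThan)
  then show ?thesis unfolding basis_enum_def by (rule someI_ex)
qed

definition cube_box :: "(nat \<Rightarrow> real) \<Rightarrow> 'v::euclidean_space" where
  "cube_box t = (\<Sum>k<DIM('v). (2 * t k - 1) *\<^sub>R basis_enum k)"

definition cube_collapse :: "(nat \<Rightarrow> real) \<Rightarrow> 'v::euclidean_space \<times> real" where
  "cube_collapse t = box_collapse (cube_box t)"

lemma basis_enum_inner:
  "j < DIM('v) \<Longrightarrow> k < DIM('v) \<Longrightarrow>
    (basis_enum j :: 'v::euclidean_space) \<bullet> basis_enum k = (if j = k then 1 else 0)"
  using basis_enum[where 'v='v] bij_betwE[OF basis_enum[where 'v='v]]
  by (auto simp: inner_Basis bij_betw_def dest: inj_onD)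

lemma cube_box_inner:
  assumes "k < DIM('v)"
  shows "(cube_box t :: 'v::euclidean_space) \<bullet> basis_enum k = 2 * t k - 1"
proof -
  have "(cube_box t :: 'v) \<bullet> basis_enum k =
      (\<Sum>j<DIM('v). (2 * t j - 1) * ((basis_enum j :: 'v) \<bullet> basis_enum k))"
    by (simp add: cube_box_def inner_sum_left)
  also have "\<dots> = (\<Sum>j<DIM('v). if j = k then 2 * t j - 1 else 0)"
    by (rule sum.cong) (auto simp: basis_enum_inner assms)
  finally show ?thesis using assms by (simp add: sum.delta)
qed

lemma Basis_enum_ball: "(\<forall>b\<in>Basis. P (b :: 'v::euclidean_space)) \<longleftrightarrow> (\<forall>k<DIM('v). P (basis_enum k))"
proof -
  have "(Basis :: 'v set) = basis_enum ` {..<DIM('v)}" using basis_enum[where 'v='v] by (simp add: bij_betw_def)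
  then have "(\<forall>b\<in>Basis. P b) \<longleftrightarrow> (\<forall>b \<in> basis_enum ` {..<DIM('v)}. P b)" by (rule arg_cong)
  then show ?thesis by (simp only: ball_simps) (simp only: Ball_def lessThan_iff)
qed

lemma topspace_cube: "topspace (cube n) = (\<Pi>\<^sub>E i\<in>{..<n}. {0..1})"
  by (simp add: cube_def)

lemma cube_box_unit_box: "t \<in> topspace (cube DIM('v)) \<Longrightarrow> cube_box t \<in> (unit_box :: 'v::euclidean_space set)"
  by (auto simp: Basis_enum_ball cube_box_inner topspace_cube PiE_iff abs_le_iff)

lemma cube_box_inj:
  assumes "t \<in> topspace (cube DIM('v))" "s \<in> topspace (cube DIM('v))"
    and eq: "cube_box t = (cube_box s :: 'v::euclidean_space)"
  shows "t = s"
proof (rule PiE_ext[OF assms(1,2)[unfolded topspace_cube]])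
  fix i assume "i \<in> {..<DIM('v)}"
  then have "2 * t i - 1 = 2 * s i - 1" using eq cube_box_inner[where 'v='v] by (metis lessThan_iff)
  then show "t i = s i" by simp
qed

lemma cube_box_surj:
  assumes "y \<in> (unit_box :: 'v::euclidean_space set)"
  shows "\<exists>t\<in>topspace (cube DIM('v)). cube_box t = y"
proof
  let ?t = "restrict (\<lambda>k. (1 + y \<bullet> basis_enum k) / 2) {..<DIM('v)}"
  show "?t \<in> topspace (cube DIM('v))"
    using assms by (auto simp: topspace_cube Basis_enum_ball abs_le_iff)
  show "cube_box ?t = y"
  proof (rule euclidean_eqI)
    fix b :: 'v assume "b \<in> Basis"
    then obtain k where "k < DIM('v)" "b = basis_enum k"
      using basis_enum[where 'v='v] by (auto simp: bij_betw_def)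
    then show "cube_box ?t \<bullet> b = y \<bullet> b" by (simp add: cube_box_inner field_simps)
  qed
qed

lemma cube_boundary_iff:
  assumes "t \<in> topspace (cube DIM('v))"
  shows "t \<in> cube_boundary DIM('v) \<longleftrightarrow> cube_collapse t = (pole :: 'v::euclidean_space \<times> real)"
proof -
  have "(\<exists>b\<in>Basis. \<bar>(cube_box t :: 'v) \<bullet> b\<bar> = 1) \<longleftrightarrow> (\<exists>k<DIM('v). \<bar>2 * t k - 1\<bar> = 1)"
    using Basis_enum_ball[where P="\<lambda>b. \<bar>(cube_box t :: 'v) \<bullet> b\<bar> \<noteq> 1"] cube_box_inner[where 'v='v]
    by (metis (no_types, lifting))
  also have "\<dots> \<longleftrightarrow> (\<exists>k<DIM('v). t k = 0 \<or> t k = 1)" by (auto simp: abs_if)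
  finally show ?thesis
    using assms by (simp add: cube_collapse_def box_collapse_eq_pole_iff box_gap_eq_0_iff cube_boundary_def)
qed

text \<open>The collapse identifies nothing but boundary points, so a map that is constant on the
  boundary descends to the sphere.\<close>

lemma cube_collapse_eqD:
  assumes "t \<in> topspace (cube DIM('v))" "s \<in> topspace (cube DIM('v))"
    and "cube_collapse t = (cube_collapse s :: 'v::euclidean_space \<times> real)"
  shows "t = s \<or> t \<in> cube_boundary DIM('v) \<and> s \<in> cube_boundary DIM('v)"
  using box_collapse_inj[OF cube_box_unit_box[OF assms(1)] cube_box_unit_box[OF assms(2)]]
    cube_box_inj[OF assms(1,2)] assms(3) box_collapse_eq_pole_iff
    cube_boundary_iff[OF assms(1)] cube_boundary_iff[OF assms(2)]
  unfolding cube_collapse_def by metis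

lemma cube_collapse_image:
  "cube_collapse ` topspace (cube DIM('v)) = (usph :: ('v::euclidean_space \<times> real) set)"
proof (intro equalityI subsetI)
  fix x :: "'v \<times> real" assume "x \<in> cube_collapse ` topspace (cube DIM('v))"
  then show "x \<in> usph" unfolding cube_collapse_def using box_collapse_usph by blast
next
  fix x :: "'v \<times> real" assume "x \<in> usph"
  from box_collapse_surj[OF this] obtain y :: 'v where y: "y \<in> unit_box" "box_collapse y = x" by blast
  from cube_box_surj[OF y(1)] obtain t where "t \<in> topspace (cube DIM('v))" "cube_box t = y" by blast
  then show "x \<in> cube_collapse ` topspace (cube DIM('v))"
    using y(2) unfolding cube_collapse_def by (auto intro: image_eqI[of _ _ t])
qed

lemma continuous_map_cube_proj: "k < n \<Longrightarrow> continuous_map (cube n) euclideanreal (\<lambda>t. t k)"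
  unfolding cube_def
  using continuous_map_product_projection[of k "{..<n}" "\<lambda>_. top_of_set {0..1::real}"]
  by (simp add: continuous_map_in_subtopology)

lemma continuous_map_cube_box: "continuous_map (cube DIM('v)) euclidean (cube_box :: _ \<Rightarrow> 'v::euclidean_space)"
  unfolding cube_box_def
proof (rule continuous_map_sum)
  fix k assume k: "k \<in> {..<DIM('v)}"
  have "continuous_map (cube DIM('v)) euclidean ((\<lambda>u. (2 * u - 1) *\<^sub>R (basis_enum k :: 'v)) \<circ> (\<lambda>t. t k))"
    by (rule continuous_map_compose[OF continuous_map_cube_proj]) (use k in \<open>auto intro!: continuous_intros\<close>)
  then show "continuous_map (cube DIM('v)) euclidean (\<lambda>t. (2 * t k - 1) *\<^sub>R (basis_enum k :: 'v))"
    by (simp add: o_def)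
qed auto

lemma continuous_map_cube_collapse:
  "continuous_map (cube DIM('v)) (top_of_set usph) (cube_collapse :: _ \<Rightarrow> 'v::euclidean_space \<times> real)"
proof -
  have "continuous_on UNIV (box_collapse :: 'v \<Rightarrow> _)"
    unfolding box_collapse_def using box_collapse_denom[where 'v='v]
    by (intro continuous_intros) (metis less_irrefl)
  then have "continuous_map (cube DIM('v)) euclidean (box_collapse \<circ> (cube_box :: _ \<Rightarrow> 'v))"
    by (intro continuous_map_compose[OF continuous_map_cube_box]) simp
  then show ?thesis
    by (intro continuous_map_into_subtopology)
      (use box_collapse_usph in \<open>auto simp: o_def cube_collapse_def[abs_def] simp del: mem_sphere_0 mem_sphere\<close>)
qed

lemma compact_space_cube: "compact_space (cube n)"
  unfolding cube_def by (simp add: compact_space_product_topology compact_space_subtopology)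

lemma quotient_map_cube_collapse:
  "quotient_map (cube DIM('v)) (top_of_set usph) (cube_collapse :: _ \<Rightarrow> 'v::euclidean_space \<times> real)"
  by (rule T1_Spaces.continuous_imp_quotient_map)
    (auto simp: continuous_map_cube_collapse compact_space_cube cube_collapse_image Hausdorff_space_subtopology simp del: mem_sphere_0 mem_sphere)

abbreviation cube_cylinder :: "nat \<Rightarrow> (real \<times> (nat \<Rightarrow> real)) topology" where
  "cube_cylinder n \<equiv> prod_topology (top_of_set {0..1}) (cube n)"

text \<open>The product of a quotient map with the interval is again a continuous surjection from a
  compact space to a Hausdorff space; this is what lets homotopies descend.\<close>

lemma quotient_map_cylinder:
  "quotient_map (cube_cylinder DIM('v)) cylinder
     (\<lambda>(s, t). (s, cube_collapse t :: 'v::euclidean_space \<times> real))"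
proof (rule T1_Spaces.continuous_imp_quotient_map)
  show "continuous_map (cube_cylinder DIM('v)) cylinder
     (\<lambda>(s, t). (s, cube_collapse t :: 'v \<times> real))"
    using continuous_map_prod_top[of "top_of_set {0..1::real}" "cube DIM('v)" "top_of_set {0..1::real}" "top_of_set (usph :: ('v \<times> real) set)" "\<lambda>x. x" cube_collapse]
      continuous_map_cube_collapse[where 'v='v] by simp
  show "compact_space (cube_cylinder DIM('v))"
    by (simp add: compact_space_prod_topology compact_space_cube compact_space_subtopology)
  show "(\<lambda>(s, t). (s, cube_collapse t :: 'v \<times> real)) ` topspace (cube_cylinder DIM('v)) =
      topspace cylinder"
    using cube_collapse_image[where 'v='v] by (force simp: image_iff)
qed (auto simp: Hausdorff_space_subtopology)

section \<open>Homotopy groups through maps of spheres\<close>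

lemma block_eqI:
  assumes "X \<in> P" "S \<subseteq> X" "S \<noteq> {}" "\<And>Y. Y \<in> P \<Longrightarrow> Y \<inter> X \<noteq> {} \<Longrightarrow> Y = X"
  shows "block P S = X"
  unfolding block_def
proof (rule the_equality)
  fix Y assume "Y \<in> P \<and> S \<subseteq> Y"
  then show "Y = X" using assms by blast
qed (use assms in auto)

lemma quotient_map_lift:
  assumes "quotient_map X Y f" "continuous_map X Z h"
    and "\<And>x y. \<lbrakk>x \<in> topspace X; y \<in> topspace X; f x = f y\<rbrakk> \<Longrightarrow> h x = h y"
  shows "\<exists>g. continuous_map Y Z g \<and> (\<forall>x\<in>topspace X. g (f x) = h x)"
  using quotient_map_lift_exists[OF assms(1,2)] assms(3) by metis

lemma continuous_map_usph_in_topspace: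
  assumes "continuous_map (top_of_set usph) X g" "z \<in> usph" shows "g z \<in> topspace X"
  using continuous_map_image_subset_topspace[OF assms(1)] assms(2) by (metis image_subset_iff topspace_euclidean_subtopology)

section \<open>Classes of loops on cubes and of based maps of spheres\<close>

abbreviation loop_homotopic ::
    "nat \<Rightarrow> 'b topology \<Rightarrow> 'b \<Rightarrow> ((nat \<Rightarrow> real) \<Rightarrow> 'b) \<Rightarrow> ((nat \<Rightarrow> real) \<Rightarrow> 'b) \<Rightarrow> bool" where
  "loop_homotopic i X x \<equiv> homotopic_with (\<lambda>p. p ` cube_boundary i \<subseteq> {x}) (cube i) X"

definition loop_class ::
    "nat \<Rightarrow> 'b topology \<Rightarrow> 'b \<Rightarrow> ((nat \<Rightarrow> real) \<Rightarrow> 'b) \<Rightarrow> ((nat \<Rightarrow> real) \<Rightarrow> 'b) set" where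
  "loop_class i X x p = {q. loop_homotopic i X x p q}"

lemma loop_homotopic_refl: "p \<in> cube_loops i X x \<Longrightarrow> loop_homotopic i X x p p"
  by (simp add: cube_loops_def)

lemma loop_classes_eq: "loop_classes i X x = loop_class i X x ` cube_loops i X x"
  by (auto simp: loop_classes_def quotient_def loop_class_def)

lemma loop_class_eq_iff:
  assumes "p \<in> cube_loops i X x" "q \<in> cube_loops i X x"
  shows "loop_class i X x p = loop_class i X x q \<longleftrightarrow> loop_homotopic i X x p q"
proof
  assume "loop_class i X x p = loop_class i X x q"
  moreover have "q \<in> loop_class i X x q" using loop_homotopic_refl[OF assms(2)] by (simp add: loop_class_def)
  ultimately show "loop_homotopic i X x p q" by (metis loop_class_def mem_Collect_eq)
next
  assume "loop_homotopic i X x p q"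
  then show "loop_class i X x p = loop_class i X x q"
    unfolding loop_class_def using homotopic_with_trans homotopic_with_symD by blast
qed

lemma block_loop_classes:
  assumes "p \<in> cube_loops i X x" "p \<in> S" "S \<subseteq> loop_class i X x p"
  shows "block (loop_classes i X x) S = loop_class i X x p"
proof (rule block_eqI)
  fix Y assume Y: "Y \<in> loop_classes i X x" and ne: "Y \<inter> loop_class i X x p \<noteq> {}"
  then obtain q where q: "q \<in> cube_loops i X x" "Y = loop_class i X x q" by (auto simp: loop_classes_eq)
  from ne q obtain r where "loop_homotopic i X x q r" "loop_homotopic i X x p r"
    by (auto simp: loop_class_def)
  then have "loop_homotopic i X x q p" using homotopic_with_trans homotopic_with_symD by blast
  then show "Y = loop_class i X x p" using q loop_class_eq_iff[OF q(1) assms(1)] by simp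
qed (use assms in \<open>auto simp: loop_classes_eq\<close>)

lemma loop_homotopic_compose:
  assumes "loop_homotopic i X x p q" "continuous_map X Y f"
  shows "loop_homotopic i Y (f x) (f \<circ> p) (f \<circ> q)"
  using assms by (rule homotopic_with_compose_continuous_map_left) auto

lemma top_pi_map_loop_class:
  assumes f: "continuous_map X Y f" and p: "p \<in> cube_loops i X x"
  shows "top_pi_map i Y f x (loop_class i X x p) = loop_class i Y (f x) (f \<circ> p)"
  unfolding top_pi_map_def
proof (rule block_loop_classes)
  show "f \<circ> p \<in> cube_loops i Y (f x)"
    using p continuous_map_compose[OF _ f] by (auto simp: cube_loops_def)
  show "f \<circ> p \<in> (\<lambda>p. f \<circ> p) ` loop_class i X x p"
    using loop_homotopic_refl[OF p] by (auto simp: loop_class_def)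
  show "(\<lambda>p. f \<circ> p) ` loop_class i X x p \<subseteq> loop_class i Y (f x) (f \<circ> p)"
    using loop_homotopic_compose[OF _ f] by (auto simp: loop_class_def)
qed

definition sphere_maps :: "'b topology \<Rightarrow> 'b \<Rightarrow> ('v::euclidean_space \<times> real \<Rightarrow> 'b) set" where
  "sphere_maps X x = {g. continuous_map (top_of_set usph) X g \<and> g pole = x}"

definition sphere_class ::
    "'b topology \<Rightarrow> 'b \<Rightarrow> ('v::euclidean_space \<times> real \<Rightarrow> 'b) \<Rightarrow> ((nat \<Rightarrow> real) \<Rightarrow> 'b) set" where
  "sphere_class X x g = loop_class DIM('v) X x (\<lambda>t. g (cube_collapse t))"

lemma sphere_maps_compose:
  "g \<in> sphere_maps X x \<Longrightarrow> continuous_map X Y f \<Longrightarrow> (\<lambda>z. f (g z)) \<in> sphere_maps Y (f x)"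
  using continuous_map_compose[of _ X g Y f] by (auto simp: sphere_maps_def o_def)

lemma sphere_maps_cube_loops:
  assumes "g \<in> sphere_maps X x"
  shows "(\<lambda>t. g (cube_collapse t :: 'v::euclidean_space \<times> real)) \<in> cube_loops DIM('v) X x"
proof -
  have "continuous_map (cube DIM('v)) X (g \<circ> cube_collapse)"
    using assms continuous_map_compose[OF continuous_map_cube_collapse] by (auto simp: sphere_maps_def)
  moreover have "cube_collapse t = (pole :: 'v \<times> real)" if "t \<in> cube_boundary DIM('v)" for t
    using that cube_boundary_iff[where 'v='v, of t] by (simp add: cube_boundary_def)
  ultimately show ?thesis using assms by (auto simp: cube_loops_def sphere_maps_def o_def)
qed

lemma cube_loop_factors:
  fixes X :: "'b topology"
  assumes p: "p \<in> cube_loops DIM('v) X x"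
  obtains g :: "'v::euclidean_space \<times> real \<Rightarrow> 'b"
  where "g \<in> sphere_maps X x" "\<And>t. t \<in> topspace (cube DIM('v)) \<Longrightarrow> g (cube_collapse t) = p t"
proof -
  have "p t = p s" if "t \<in> topspace (cube DIM('v))" "s \<in> topspace (cube DIM('v))"
    "cube_collapse t = (cube_collapse s :: 'v \<times> real)" for t s
    using cube_collapse_eqD[OF that] p by (auto simp: cube_loops_def)
  moreover have "continuous_map (cube DIM('v)) X p" using p by (simp add: cube_loops_def)
  ultimately obtain g :: "'v \<times> real \<Rightarrow> 'b" where g: "continuous_map (top_of_set usph) X g"
    "\<And>t. t \<in> topspace (cube DIM('v)) \<Longrightarrow> g (cube_collapse t) = p t"
    using quotient_map_lift_exists[OF quotient_map_cube_collapse[where 'v='v], of X p] by metis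
  obtain t where t: "t \<in> topspace (cube DIM('v))" "cube_collapse t = (pole :: 'v \<times> real)"
    using cube_collapse_image[where 'v='v] pole_in_usph by (metis imageE)
  then have "p t = x" using p cube_boundary_iff[where 'v='v, of t] by (auto simp: cube_loops_def)
  then have "g pole = x" using g(2)[OF t(1)] t(2) by simp
  then show ?thesis using that g by (simp add: sphere_maps_def)
qed

text \<open>From left to right, the homotopy on the cube takes the value \<open>x\<close> on the
  boundary at every time, hence it is compatible with the collapse and factors through the cylinder
  over the sphere.\<close>

lemma loop_homotopic_sphere_iff:
  fixes g :: "'v::euclidean_space \<times> real \<Rightarrow> 'b"
  shows "loop_homotopic DIM('v) X x (\<lambda>t. g (cube_collapse t)) (\<lambda>t. g' (cube_collapse t)) \<longleftrightarrow>
    homotopic_based X x g g'"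
proof
  assume "homotopic_based X x g g'"
  then have "loop_homotopic DIM('v) X x (g \<circ> cube_collapse) (g' \<circ> cube_collapse)"
  proof (rule homotopic_with_compose_continuous_map_right[OF _ continuous_map_cube_collapse])
    fix j :: "'v \<times> real \<Rightarrow> 'b" assume "j pole = x"
    moreover have "cube_collapse t = (pole :: 'v \<times> real)" if "t \<in> cube_boundary DIM('v)" for t
      using that cube_boundary_iff[where 'v='v, of t] by (simp add: cube_boundary_def)
    ultimately show "(j \<circ> cube_collapse) ` cube_boundary DIM('v) \<subseteq> {x}" by auto
  qed
  then show "loop_homotopic DIM('v) X x (\<lambda>t. g (cube_collapse t)) (\<lambda>t. g' (cube_collapse t))"
    by (simp add: o_def)
next
  assume "loop_homotopic DIM('v) X x (\<lambda>t. g (cube_collapse t)) (\<lambda>t. g' (cube_collapse t))"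
  then obtain h where h: "continuous_map (cube_cylinder DIM('v)) X h"
    "\<And>t. h (0, t) = g (cube_collapse t)" "\<And>t. h (1, t) = g' (cube_collapse t)"
    "\<And>s. s \<in> {0..1} \<Longrightarrow> (\<lambda>t. h (s, t)) ` cube_boundary DIM('v) \<subseteq> {x}"
    unfolding homotopic_with_def by blast
  have "h a = h b" if ab: "a \<in> topspace (cube_cylinder DIM('v))"
    "b \<in> topspace (cube_cylinder DIM('v))"
    "(\<lambda>(s, t). (s, cube_collapse t :: 'v \<times> real)) a = (\<lambda>(s, t). (s, cube_collapse t)) b" for a b
  proof -
    obtain s t t' where st: "a = (s, t)" "b = (s, t')" "cube_collapse t = (cube_collapse t' :: 'v \<times> real)"
      "s \<in> {0..1}" "t \<in> topspace (cube DIM('v))" "t' \<in> topspace (cube DIM('v))"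
      using ab by (cases a; cases b) auto
    show ?thesis using cube_collapse_eqD[OF st(5,6,3)] h(4)[OF st(4)] by (auto simp: st(1,2))
  qed
  note hab = this
  obtain k :: "real \<times> ('v \<times> real) \<Rightarrow> 'b" where k: "continuous_map cylinder X k"
    "\<And>a. a \<in> topspace (cube_cylinder DIM('v)) \<Longrightarrow>
      k ((\<lambda>(s, t). (s, cube_collapse t)) a) = h a"
    using quotient_map_lift[OF quotient_map_cylinder[where 'v='v] h(1) hab] by blast
  have k': "k (s, cube_collapse t) = h (s, t)" if "s \<in> {0..1}" "t \<in> topspace (cube DIM('v))" for s t
    using k(2)[of "(s, t)"] that by simp
  have surj: "\<exists>t \<in> topspace (cube DIM('v)). cube_collapse t = y" if "y \<in> usph" for y :: "'v \<times> real"
    using that cube_collapse_image[where 'v='v] by (metis imageE)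
  show "homotopic_based X x g g'"
  proof (rule homotopic_basedI[OF k(1)])
    fix y :: "'v \<times> real" assume "y \<in> usph"
    then obtain t where "t \<in> topspace (cube DIM('v))" "cube_collapse t = y" using surj by blast
    then show "k (0, y) = g y" "k (1, y) = g' y" using k'[of 0 t] k'[of 1 t] h by auto
  next
    fix s :: real assume s: "s \<in> {0..1}"
    obtain t where t: "t \<in> topspace (cube DIM('v))" "cube_collapse t = (pole :: 'v \<times> real)"
      using surj[OF pole_in_usph] by blast
    then have "t \<in> cube_boundary DIM('v)" using cube_boundary_iff[where 'v='v] by blast
    then show "k (s, pole) = x" using k'[OF s t(1)] t(2) h(4)[OF s] by auto
  qed
qed

lemma sphere_class_eq_iff:
  assumes "g \<in> sphere_maps X x" "g' \<in> sphere_maps X x"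
  shows "sphere_class X x g = sphere_class X x g' \<longleftrightarrow> homotopic_based X x g g'"
  unfolding sphere_class_def
  using loop_class_eq_iff[OF sphere_maps_cube_loops[OF assms(1)] sphere_maps_cube_loops[OF assms(2)]]
  by (simp add: loop_homotopic_sphere_iff)

lemma sphere_class_image:
  "sphere_class X x ` (sphere_maps X x :: ('v::euclidean_space \<times> real \<Rightarrow> 'b) set) = loop_classes DIM('v) X x"
proof (intro equalityI subsetI)
  fix P assume "P \<in> loop_classes DIM('v) X x"
  then obtain p where p: "p \<in> cube_loops DIM('v) X x" "P = loop_class DIM('v) X x p"
    by (auto simp: loop_classes_eq)
  obtain g :: "'v \<times> real \<Rightarrow> 'b" where g: "g \<in> sphere_maps X x"
    "\<And>t. t \<in> topspace (cube DIM('v)) \<Longrightarrow> g (cube_collapse t) = p t"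
    using cube_loop_factors[where 'v='v, OF p(1)] by blast
  \<comment> \<open>The two loops are only known to agree on the cube, since \<open>p\<close> is
    arbitrary outside it; so they are homotopic rather than equal.\<close>
  have "loop_homotopic DIM('v) X x (\<lambda>t. g (cube_collapse t)) p"
  proof (rule homotopic_with_equal)
    show "(\<lambda>t. g (cube_collapse t)) ` cube_boundary DIM('v) \<subseteq> {x}"
      using sphere_maps_cube_loops[OF g(1)] by (simp add: cube_loops_def)
  qed (use p sphere_maps_cube_loops[OF g(1)] g(2) in \<open>auto simp: cube_loops_def\<close>)
  then have "P = sphere_class X x g"
    unfolding p(2) sphere_class_def using loop_class_eq_iff[OF sphere_maps_cube_loops[OF g(1)] p(1)] by simp
  then show "P \<in> sphere_class X x ` (sphere_maps X x :: ('v \<times> real \<Rightarrow> 'b) set)" using g(1) by blast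
next
  fix P assume "P \<in> sphere_class X x ` (sphere_maps X x :: ('v \<times> real \<Rightarrow> 'b) set)"
  then show "P \<in> loop_classes DIM('v) X x"
    using sphere_maps_cube_loops by (fastforce simp: sphere_class_def loop_classes_eq)
qed

lemma top_pi_map_sphere_class:
  fixes g :: "'v::euclidean_space \<times> real \<Rightarrow> 'b"
  assumes "continuous_map X Y f" "g \<in> sphere_maps X x"
  shows "top_pi_map DIM('v) Y f x (sphere_class X x g) = sphere_class Y (f x) (\<lambda>z. f (g z))"
  using top_pi_map_loop_class[OF assms(1) sphere_maps_cube_loops[OF assms(2)]]
  by (simp add: sphere_class_def o_def)

text \<open>A condition at a single base point, unlike \<open>top_pi_iso\<close>, because a
  realization functor gives information only at the points \<open>r A a\<close>.\<close>

definition pi_bij :: "nat \<Rightarrow> 'b topology \<Rightarrow> 'c topology \<Rightarrow> ('b \<Rightarrow> 'c) \<Rightarrow> 'b \<Rightarrow> bool" where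
  "pi_bij n X Y f x \<longleftrightarrow> bij_betw (top_pi_map n Y f x) (loop_classes n X x) (loop_classes n Y (f x))"

lemma top_pi_iso_imp_pi_bij: "top_pi_iso n X Y f \<Longrightarrow> x \<in> topspace X \<Longrightarrow> pi_bij n X Y f x"
  by (auto simp: top_pi_iso_def pi_bij_def top_pi_def iso_def)

text \<open>Formulated with injectivity so that it covers the functor to the delooping, whose group
  of 3-cells may be larger than pi_3.\<close>

lemma pi_bij_inj:
  fixes g :: "'v::euclidean_space \<times> real \<Rightarrow> 'b"
  assumes f: "continuous_map X Y f" and bij: "inj_on (top_pi_map DIM('v) Y f x) (loop_classes DIM('v) X x)"
    and g: "g \<in> sphere_maps X x" "g' \<in> sphere_maps X x"
    and hom: "homotopic_based Y (f x) (\<lambda>z. f (g z)) (\<lambda>z. f (g' z))"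
  shows "homotopic_based X x g g'"
proof -
  have "top_pi_map DIM('v) Y f x (sphere_class X x g) = top_pi_map DIM('v) Y f x (sphere_class X x g')"
    unfolding top_pi_map_sphere_class[OF f g(1)] top_pi_map_sphere_class[OF f g(2)]
    using sphere_class_eq_iff[OF sphere_maps_compose[OF g(1) f] sphere_maps_compose[OF g(2) f]] hom by simp
  moreover have "sphere_class X x g \<in> loop_classes DIM('v) X x" "sphere_class X x g' \<in> loop_classes DIM('v) X x"
    unfolding sphere_class_image[symmetric] using g by auto
  ultimately have "sphere_class X x g = sphere_class X x g'"
    using bij by (simp add: inj_on_eq_iff)
  then show ?thesis using sphere_class_eq_iff[OF g] by simp
qed

lemma pi_bij_surj:
  fixes k :: "'v::euclidean_space \<times> real \<Rightarrow> 'c" and X :: "'b topology"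
  assumes f: "continuous_map X Y f" and bij: "pi_bij DIM('v) X Y f x" and k: "k \<in> sphere_maps Y (f x)"
  obtains g :: "'v \<times> real \<Rightarrow> 'b" where "g \<in> sphere_maps X x" "homotopic_based Y (f x) (\<lambda>z. f (g z)) k"
proof -
  have "sphere_class Y (f x) k \<in> loop_classes DIM('v) Y (f x)"
    unfolding sphere_class_image[symmetric] using k by auto
  then obtain P where P: "P \<in> loop_classes DIM('v) X x" "sphere_class Y (f x) k = top_pi_map DIM('v) Y f x P"
    using bij unfolding pi_bij_def bij_betw_def by (metis imageE)
  then obtain g :: "'v \<times> real \<Rightarrow> 'b" where g: "g \<in> sphere_maps X x" "P = sphere_class X x g"
    unfolding sphere_class_image[symmetric] by auto
  have "sphere_class Y (f x) (\<lambda>z. f (g z)) = sphere_class Y (f x) k"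
    using P(2) g(2) top_pi_map_sphere_class[OF f g(1)] by simp
  then show ?thesis using that[OF g(1)] sphere_class_eq_iff[OF sphere_maps_compose[OF g(1) f] k] by simp
qed

lemma sphere_maps_null_if_singleton:
  fixes g :: "'v::euclidean_space \<times> real \<Rightarrow> 'b"
  assumes "loop_classes DIM('v) X x \<subseteq> {P}" "g \<in> sphere_maps X x"
  shows "null_map X g"
proof -
  have "x \<in> topspace X"
    using assms(2) continuous_map_usph_in_topspace[OF _ pole_in_usph, of X g] by (simp add: sphere_maps_def)
  then have c: "(\<lambda>_ :: 'v \<times> real. x) \<in> sphere_maps X x" by (simp add: sphere_maps_def)
  have "sphere_class X x g = sphere_class X x (\<lambda>_ :: 'v \<times> real. x)"
    using subsetD[OF assms(1), unfolded sphere_class_image[symmetric], OF imageI[OF assms(2)]]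
      subsetD[OF assms(1), unfolded sphere_class_image[symmetric], OF imageI[OF c]] by (metis singletonD)
  then show ?thesis
    using homotopic_based_imp_free[OF iffD1[OF sphere_class_eq_iff[OF assms(2) c]]] unfolding null_map_def by blast
qed

lemma path_between:
  assumes "path_connected_space X" "x \<in> topspace X" "y \<in> topspace X"
  obtains \<delta> where "continuous_map (top_of_set {0..1::real}) X \<delta>" "\<delta> 0 = x" "\<delta> 1 = y"
  using assms unfolding path_connected_space_def pathin_def by metis

lemma rebase_sphere_map:
  assumes "path_connected_space X" "continuous_map (top_of_set usph) X g" "y \<in> topspace X"
  obtains g' where "g' \<in> sphere_maps X y" "homotopic_free X g g'"
proof -
  have "g pole \<in> topspace X"
    by (rule continuous_map_usph_in_topspace[OF assms(2) pole_in_usph])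
  then obtain \<delta> where \<delta>: "continuous_map (top_of_set {0..1::real}) X \<delta>" "\<delta> 0 = g pole" "\<delta> 1 = y"
    by (rule path_between[OF assms(1) _ assms(3)])
  show ?thesis
    using that[of "drag \<delta> g"] homotopic_free_drag[OF assms(2) \<delta>(1) \<delta>(2)[symmetric]]
      continuous_map_drag1[OF assms(2) \<delta>(1) \<delta>(2)[symmetric]] \<delta>(3)
    by (simp add: sphere_maps_def)
qed

text \<open>Chosen representatives of the classes at \<open>x\<close> are dragged to
  \<open>y\<close>; dragging back recovers them up to based homotopy, so distinct classes stay
  distinct.\<close>

lemma infinite_loop_classes_path:
  fixes X :: "'b topology"
  assumes pc: "path_connected_space X" "x \<in> topspace X" "y \<in> topspace X"
    and inf: "infinite (loop_classes DIM('v::euclidean_space) X x)"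
  shows "infinite (loop_classes DIM('v) X y)"
proof -
  obtain \<delta> where \<delta>: "continuous_map (top_of_set {0..1::real}) X \<delta>" "\<delta> 0 = x" "\<delta> 1 = y"
    using path_between[OF pc] .
  have "\<forall>P \<in> loop_classes DIM('v) X x. \<exists>g :: 'v \<times> real \<Rightarrow> 'b. g \<in> sphere_maps X x \<and> P = sphere_class X x g"
    unfolding sphere_class_image[symmetric] by blast
  then obtain G :: "_ \<Rightarrow> 'v \<times> real \<Rightarrow> 'b" where
    G: "\<And>P. P \<in> loop_classes DIM('v) X x \<Longrightarrow> G P \<in> sphere_maps X x \<and> P = sphere_class X x (G P)"
    by metis
  have D: "drag \<delta> (G P) \<in> sphere_maps X y" if "P \<in> loop_classes DIM('v) X x" for P
    using G[OF that] continuous_map_drag1[OF _ \<delta>(1), of "G P"] \<delta> by (simp add: sphere_maps_def)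
  have inj: "inj_on (\<lambda>P. sphere_class X y (drag \<delta> (G P))) (loop_classes DIM('v) X x)"
  proof (rule inj_onI)
    fix P Q assume P: "P \<in> loop_classes DIM('v) X x" and Q: "Q \<in> loop_classes DIM('v) X x"
      and eq: "sphere_class X y (drag \<delta> (G P)) = sphere_class X y (drag \<delta> (G Q))"
    have "homotopic_based X y (drag \<delta> (G P)) (drag \<delta> (G Q))"
      using sphere_class_eq_iff[OF D[OF P] D[OF Q]] eq by simp
    moreover have "continuous_map (top_of_set {0..1::real}) X (\<lambda>u. \<delta> (1 - u))"
      by (rule path_reparam[OF \<delta>(1)]) (auto intro!: continuous_intros)
    ultimately have a: "homotopic_based X x (drag (\<lambda>u. \<delta> (1 - u)) (drag \<delta> (G P))) (drag (\<lambda>u. \<delta> (1 - u)) (drag \<delta> (G Q)))"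
      using homotopic_based_drag[of y X "drag \<delta> (G P)" "drag \<delta> (G Q)" "\<lambda>u. \<delta> (1 - u)"] \<delta> by simp
    have b: "homotopic_based X x (drag (\<lambda>u. \<delta> (1 - u)) (drag \<delta> (G R))) (G R)"
      if "R \<in> loop_classes DIM('v) X x" for R
      using homotopic_based_drag_back[OF _ \<delta>(1), of "G R"] G[OF that] \<delta>(2) by (auto simp: sphere_maps_def)
    have "homotopic_based X x (G P) (G Q)"
      using homotopic_with_trans[OF homotopic_with_trans[OF homotopic_with_symD[OF b[OF P]] a] b[OF Q]] .
    then show "P = Q" using G[OF P] G[OF Q] sphere_class_eq_iff by metis
  qed
  have "(\<lambda>P. sphere_class X y (drag \<delta> (G P))) ` loop_classes DIM('v) X x \<subseteq> loop_classes DIM('v) X y"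
  proof (rule image_subsetI)
    fix P assume "P \<in> loop_classes DIM('v) X x"
    from imageI[OF D[OF this], of "sphere_class X y"]
    show "sphere_class X y (drag \<delta> (G P)) \<in> loop_classes DIM('v) X y" unfolding sphere_class_image .
  qed
  from inj_on_finite[OF inj this] show ?thesis using inf by blast
qed

section \<open>The Hopf map\<close>

definition hopf2 :: "complex \<times> complex \<Rightarrow> complex \<times> real" where
  "hopf2 p = (2 * fst p * cnj (snd p), (cmod (snd p))\<^sup>2 - (cmod (fst p))\<^sup>2)"

text \<open>Identifies the 3-sphere in the form with a height coordinate with the unit sphere of
  complex 2-space. The pole becomes \<open>(0, \<i>)\<close>, which the Hopf map sends to the pole,
  so \<open>hopf\<close> is a based map.\<close>

definition pair_of :: "(complex \<times> real) \<times> real \<Rightarrow> complex \<times> complex" where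
  "pair_of x = (fst (fst x), Complex (snd (fst x)) (snd x))"

definition of_pair :: "complex \<times> complex \<Rightarrow> (complex \<times> real) \<times> real" where
  "of_pair p = ((fst p, Re (snd p)), Im (snd p))"

definition hopf :: "(complex \<times> real) \<times> real \<Rightarrow> complex \<times> real" where
  "hopf x = hopf2 (pair_of x)"

text \<open>\<open>line_proj n\<close> is the orthogonal projection of \<open>\<complex>\<^sup>2\<close> onto the complex line that corresponds to the
  point \<open>n\<close> of the Riemann sphere.\<close>

definition line_proj :: "complex \<times> real \<Rightarrow> complex \<times> complex \<Rightarrow> complex \<times> complex" where
  "line_proj n p = ((of_real (1 - snd n) * fst p + fst n * snd p) / 2,
                    (cnj (fst n) * fst p + of_real (1 + snd n) * snd p) / 2)"

text \<open>Moves a unit vector into the fibre over a nearby point \<open>n\<close>; it is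
  meaningful as long as \<open>n\<close> is not antipodal to \<open>hopf2 p\<close>.\<close>

definition transport :: "complex \<times> real \<Rightarrow> complex \<times> complex \<Rightarrow> complex \<times> complex" where
  "transport n p = line_proj n p /\<^sub>R norm (line_proj n p)"

lemma norm_pair_sq: "(norm p)\<^sup>2 = (cmod (fst p))\<^sup>2 + (cmod (snd p))\<^sup>2"
  by (cases p) (simp add: norm_Pair)

lemma pair_of_of_pair [simp]: "pair_of (of_pair p) = p" "of_pair (pair_of x) = x"
  by (simp_all add: pair_of_def of_pair_def)

lemma norm_pair_of [simp]: "norm (pair_of x) = norm x"
  by (cases x; cases "fst x") (simp add: pair_of_def norm_Pair cmod_def)

lemma norm_of_pair [simp]: "norm (of_pair p) = norm p"
  using norm_pair_of[of "of_pair p"] by simp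

lemma norm_hopf2: "norm p = 1 \<Longrightarrow> norm (hopf2 p) = 1"
proof -
  assume "norm p = 1"
  define a b where "a = (cmod (fst p))\<^sup>2" and "b = (cmod (snd p))\<^sup>2"
  have ab: "a + b = 1" using \<open>norm p = 1\<close> norm_pair_sq[of p] by (simp add: a_def b_def)
  have "(norm (hopf2 p))\<^sup>2 = 4 * a * b + (b - a)\<^sup>2"
    by (simp add: hopf2_def norm_Pair norm_mult power_mult_distrib a_def b_def)
  also have "\<dots> = (a + b)\<^sup>2" by (simp add: power2_eq_square algebra_simps)
  finally have "(norm (hopf2 p))\<^sup>2 = 1\<^sup>2" by (simp add: ab)
  then show ?thesis by (rule power2_eq_imp_eq) auto
qed

lemma continuous_on_hopf2 [continuous_intros]: "continuous_on S f \<Longrightarrow> continuous_on S (\<lambda>x. hopf2 (f x))"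
  unfolding hopf2_def by (intro continuous_intros)

lemma continuous_on_pair_of [continuous_intros]: "continuous_on S f \<Longrightarrow> continuous_on S (\<lambda>x. pair_of (f x))"
  unfolding pair_of_def Complex_eq by (intro continuous_intros)

lemma continuous_on_of_pair [continuous_intros]: "continuous_on S f \<Longrightarrow> continuous_on S (\<lambda>x. of_pair (f x))"
  unfolding of_pair_def by (intro continuous_intros)

lemma continuous_on_line_proj [continuous_intros]:
  "continuous_on S f \<Longrightarrow> continuous_on S g \<Longrightarrow> continuous_on S (\<lambda>x. line_proj (f x) (g x))"
  unfolding line_proj_def by (intro continuous_intros) auto

lemma hopf_usph: "x \<in> usph \<Longrightarrow> hopf x \<in> usph"
  by (simp add: hopf_def norm_hopf2)

lemma continuous_on_hopf: "continuous_on S hopf"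
  unfolding hopf_def by (intro continuous_intros)

lemma hopf_pole: "hopf pole = pole"
  by (simp add: hopf_def hopf2_def pair_of_def cmod_def)

lemma hopf2_scale: "hopf2 (c *\<^sub>R p) = c\<^sup>2 *\<^sub>R hopf2 p"
  by (simp add: hopf2_def power2_eq_square scaleR_conv_of_real norm_mult algebra_simps)

text \<open>For \<open>n = (w, h)\<close> on the sphere, \<open>line_proj n\<close> is the Hermitian
  matrix with rows \<open>(1 - h, w)\<close> and \<open>(cnj w, 1 + h)\<close>, halved. It is
  idempotent because \<open>w * cnj w = 1 - h * h\<close>, and its image is the fibre line over
  \<open>n\<close>.\<close>

lemma line_proj_facts:
  fixes p :: "complex \<times> complex" and n :: "complex \<times> real"
  assumes n: "norm n = 1" and p: "norm p = 1"
  shows hopf2_line_proj: "hopf2 (line_proj n p) = (norm (line_proj n p))\<^sup>2 *\<^sub>R n"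
    and norm_line_proj: "2 * (norm (line_proj n p))\<^sup>2 = 1 + n \<bullet> hopf2 p"
proof -
  obtain w h where nn: "n = (w, h)" by (cases n)
  obtain u v where pp: "p = (u, v)" by (cases p)
  obtain a b where ab: "line_proj n p = (a, b)" by (cases "line_proj n p")
  define H where "H = complex_of_real h"
  have wh: "w * cnj w = 1 - H * H"
  proof -
    have "(cmod w)\<^sup>2 + h\<^sup>2 = 1" using n norm_pair_sq by (simp add: nn norm_Pair)
    then have "(cmod w)\<^sup>2 = 1 - h * h" by (simp add: power2_eq_square)
    then have "complex_of_real ((cmod w)\<^sup>2) = of_real (1 - h * h)" by (simp only:)
    then show ?thesis by (simp only: complex_norm_square H_def of_real_diff of_real_1 of_real_mult)
  qed
  have uv: "u * cnj u + v * cnj v = 1"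
  proof -
    have "complex_of_real ((cmod u)\<^sup>2 + (cmod v)\<^sup>2) = 1" using p norm_pair_sq[of p] by (simp add: pp)
    then show ?thesis by (simp only: of_real_add complex_norm_square)
  qed
  have a2: "2 * a = (1 - H) * u + w * v" and b2: "2 * b = cnj w * u + (1 + H) * v"
    using ab by (auto simp: line_proj_def nn pp H_def)
  have ca2: "2 * cnj a = (1 - H) * cnj u + cnj w * cnj v" and cb2: "2 * cnj b = w * cnj u + (1 + H) * cnj v"
    using arg_cong[OF a2, of cnj] arg_cong[OF b2, of cnj] by (auto simp: H_def)
  \<comment> \<open>\<open>r1\<close> and \<open>r2\<close> are the equations of the line over
    \<open>n\<close>, satisfied by the projected vector \<open>(a, b)\<close>.\<close>
  have r1: "w * b = (1 + H) * a"
  proof -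
    have "2 * (w * b) = w * (2 * b)" by simp
    also have "\<dots> = (w * cnj w) * u + w * (1 + H) * v" unfolding b2 by (simp add: algebra_simps)
    also have "\<dots> = (1 + H) * (2 * a)" unfolding wh a2 by (simp add: algebra_simps)
    finally show ?thesis by simp
  qed
  have r2: "cnj w * a = (1 - H) * b"
  proof -
    have "2 * (cnj w * a) = cnj w * (2 * a)" by simp
    also have "\<dots> = cnj w * (1 - H) * u + (w * cnj w) * v" unfolding a2 by (simp add: algebra_simps)
    also have "\<dots> = (1 - H) * (2 * b)" unfolding wh b2 by (simp add: algebra_simps)
    finally show ?thesis by simp
  qed
  have r1': "cnj w * cnj b = (1 + H) * cnj a" and r2': "w * cnj a = (1 - H) * cnj b"
    using arg_cong[OF r1, of cnj] arg_cong[OF r2, of cnj] by (auto simp: H_def)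
  \<comment> \<open>\<open>S\<close> is the Hermitian product of \<open>p\<close> with its
    projection; for an orthogonal projection it equals the squared norm of the projection.\<close>
  define S where "S = cnj u * a + cnj v * b"
  have aa: "2 * (a * cnj a) = (1 - H) * S"
  proof -
    have "2 * (a * cnj a) = a * (2 * cnj a)" by simp
    also have "\<dots> = (1 - H) * cnj u * a + (cnj w * a) * cnj v" unfolding ca2 by (simp add: algebra_simps)
    also have "\<dots> = (1 - H) * S" unfolding r2 S_def by (simp add: algebra_simps)
    finally show ?thesis .
  qed
  have bb: "2 * (b * cnj b) = (1 + H) * S"
  proof -
    have "2 * (b * cnj b) = b * (2 * cnj b)" by simp
    also have "\<dots> = (w * b) * cnj u + (1 + H) * cnj v * b" unfolding cb2 by (simp add: algebra_simps)
    also have "\<dots> = (1 + H) * S" unfolding r1 S_def by (simp add: algebra_simps)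
    finally show ?thesis .
  qed
  have S: "a * cnj a + b * cnj b = S"
  proof -
    have "2 * (a * cnj a + b * cnj b) = 2 * S" unfolding distrib_left aa bb by (simp add: algebra_simps)
    then show ?thesis by (simp only: mult_cancel_left) simp
  qed
  have nS: "complex_of_real ((norm (line_proj n p))\<^sup>2) = S"
    unfolding norm_pair_sq ab of_real_add complex_norm_square fst_conv snd_conv S ..
  have h1: "2 * a * cnj b = S * w"
  proof -
    have "2 * a * cnj b = ((1 + H) * a) * cnj b + a * ((1 - H) * cnj b)" by (simp add: algebra_simps)
    also have "\<dots> = (a * cnj a + b * cnj b) * w" unfolding r1[symmetric] r2'[symmetric] by (simp add: algebra_simps)
    finally show ?thesis unfolding S .
  qed
  have "2 * (b * cnj b - a * cnj a) = 2 * (S * H)" unfolding right_diff_distrib aa bb by (simp add: algebra_simps)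
  then have h2: "b * cnj b - a * cnj a = S * H" by (simp only: mult_cancel_left) simp
  show "hopf2 (line_proj n p) = (norm (line_proj n p))\<^sup>2 *\<^sub>R n"
  proof (rule prod_eqI)
    show "fst (hopf2 (line_proj n p)) = fst ((norm (line_proj n p))\<^sup>2 *\<^sub>R n)"
      unfolding fst_scaleR scaleR_conv_of_real nS unfolding ab using h1 by (simp add: hopf2_def nn)
    have "complex_of_real ((cmod b)\<^sup>2 - (cmod a)\<^sup>2) = complex_of_real ((norm (line_proj n p))\<^sup>2 * h)"
      unfolding of_real_diff of_real_mult nS complex_norm_square h2 H_def ..
    then show "snd (hopf2 (line_proj n p)) = snd ((norm (line_proj n p))\<^sup>2 *\<^sub>R n)"
      unfolding of_real_eq_iff by (simp only: hopf2_def ab snd_conv fst_conv snd_scaleR real_scaleR_def) (simp add: nn)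
  qed
  have "2 * S = cnj u * (2 * a) + cnj v * (2 * b)" by (simp add: S_def algebra_simps)
  also have "\<dots> = (u * cnj u + v * cnj v) + H * (v * cnj v - u * cnj u) + (w * (cnj u * v) + cnj (w * (cnj u * v)))"
    unfolding a2 b2 by (simp add: algebra_simps)
  also have "\<dots> = complex_of_real (1 + h * ((cmod v)\<^sup>2 - (cmod u)\<^sup>2) + 2 * Re (w * (cnj u * v)))"
    unfolding uv by (simp only: of_real_add of_real_1 of_real_mult of_real_diff complex_norm_square H_def complex_add_cnj)
  finally have "complex_of_real (2 * (norm (line_proj n p))\<^sup>2) =
      complex_of_real (1 + h * ((cmod v)\<^sup>2 - (cmod u)\<^sup>2) + 2 * Re (w * (cnj u * v)))"
    using nS by simp
  then have "2 * (norm (line_proj n p))\<^sup>2 = 1 + h * ((cmod v)\<^sup>2 - (cmod u)\<^sup>2) + 2 * Re (w * (cnj u * v))"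
    by (simp only: of_real_eq_iff)
  also have "2 * Re (w * (cnj u * v)) = w \<bullet> (2 * u * cnj v)"
    by (simp add: inner_complex_def algebra_simps)
  finally show "2 * (norm (line_proj n p))\<^sup>2 = 1 + n \<bullet> hopf2 p"
    by (simp add: nn pp hopf2_def algebra_simps)
qed

text \<open>By \<open>norm_line_proj\<close> the projection vanishes only if \<open>n\<close> and
  \<open>hopf2 p\<close> are antipodal, that is, at distance 2.\<close>

lemma line_proj_nonzero:
  assumes "norm n = 1" "norm p = 1" "norm (n - hopf2 p) < 2"
  shows "line_proj n p \<noteq> 0"
proof
  assume "line_proj n p = 0"
  then have "n \<bullet> hopf2 p = -1" using norm_line_proj[OF assms(1,2)] by simp
  moreover have "(norm (n - hopf2 p))\<^sup>2 = n \<bullet> n + hopf2 p \<bullet> hopf2 p - 2 * (n \<bullet> hopf2 p)"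
    by (simp add: power2_norm_eq_inner inner_diff_left inner_diff_right inner_commute)
  ultimately have "(norm (n - hopf2 p))\<^sup>2 = 2\<^sup>2"
    using assms(1) norm_hopf2[OF assms(2)] by (simp add: power2_norm_eq_inner[symmetric])
  then have "norm (n - hopf2 p) = 2" by (rule power2_eq_imp_eq) auto
  then show False using assms(3) by simp
qed

lemma transport_facts:
  assumes "norm n = 1" "norm p = 1" "norm (n - hopf2 p) < 2"
  shows norm_transport: "norm (transport n p) = 1" and hopf2_transport: "hopf2 (transport n p) = n"
  using line_proj_nonzero[OF assms] hopf2_line_proj[OF assms(1,2)]
  by (simp_all add: transport_def hopf2_scale power_inverse)

text \<open>Fibres of the Hopf map are circles: two points of a fibre differ by a phase, which is
  their Hermitian product and therefore depends continuously on both.\<close>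

lemma hopf2_fibre:
  assumes "norm p = 1" "norm q = 1" "hopf2 p = hopf2 q"
  defines "l \<equiv> fst q * cnj (fst p) + snd q * cnj (snd p)"
  shows "q = (l * fst p, l * snd p)" "cmod l = 1"
proof -
  obtain u v where p: "p = (u, v)" by (cases p)
  obtain u' v' where q: "q = (u', v')" by (cases q)
  have n: "(cmod u)\<^sup>2 + (cmod v)\<^sup>2 = 1" "(cmod u')\<^sup>2 + (cmod v')\<^sup>2 = 1"
    using assms(1,2) norm_pair_sq[of p] norm_pair_sq[of q] by (simp_all add: p q)
  have h: "u * cnj v = u' * cnj v'" "(cmod v)\<^sup>2 - (cmod u)\<^sup>2 = (cmod v')\<^sup>2 - (cmod u')\<^sup>2"
    using assms(3) by (simp_all add: p q hopf2_def)
  have c: "u * cnj u = u' * cnj u'" "v * cnj v = v' * cnj v'"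
  proof -
    have "(cmod u)\<^sup>2 = (cmod u')\<^sup>2" "(cmod v)\<^sup>2 = (cmod v')\<^sup>2" using n h(2) by linarith+
    then show "u * cnj u = u' * cnj u'" "v * cnj v = v' * cnj v'" by (metis complex_norm_square)+
  qed
  have nc: "u' * cnj u' + v' * cnj v' = 1"
    using n(2) by (metis complex_norm_square of_real_1 of_real_add)
  have h': "cnj u * v = cnj u' * v'" using arg_cong[OF h(1), of cnj] by simp
  have "l * u = u' * (u * cnj u) + v' * (u * cnj v)" by (simp add: l_def p q algebra_simps)
  also have "\<dots> = u' * (u' * cnj u' + v' * cnj v')" unfolding c h by (simp add: algebra_simps)
  finally have lu: "l * u = u'" by (simp add: nc)
  have "l * v = u' * (cnj u * v) + v' * (v * cnj v)" by (simp add: l_def p q algebra_simps)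
  also have "\<dots> = v' * (u' * cnj u' + v' * cnj v')" unfolding c h' by (simp add: algebra_simps)
  finally have lv: "l * v = v'" by (simp add: nc)
  show "q = (l * fst p, l * snd p)" by (simp add: p q lu lv)
  have "1 = (cmod l)\<^sup>2 * ((cmod u)\<^sup>2 + (cmod v)\<^sup>2)"
    using n(2) unfolding lu[symmetric] lv[symmetric] by (simp add: norm_mult power_mult_distrib algebra_simps)
  then have "(cmod l)\<^sup>2 = 1\<^sup>2" using n(1) by simp
  then show "cmod l = 1" by (rule power2_eq_imp_eq) auto
qed

lemma transport_self: "norm p = 1 \<Longrightarrow> transport (hopf2 p) p = p"
proof -
  assume p: "norm p = 1"
  obtain u v where pp: "p = (u, v)" by (cases p)
  have n: "(cmod u)\<^sup>2 + (cmod v)\<^sup>2 = 1" using p norm_pair_sq[of p] by (simp add: pp)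
  then have "1 - ((cmod v)\<^sup>2 - (cmod u)\<^sup>2) = 2 * (cmod u)\<^sup>2" "1 + ((cmod v)\<^sup>2 - (cmod u)\<^sup>2) = 2 * (cmod v)\<^sup>2"
    by simp_all
  then have "complex_of_real (1 - ((cmod v)\<^sup>2 - (cmod u)\<^sup>2)) = 2 * (u * cnj u)"
    "complex_of_real (1 + ((cmod v)\<^sup>2 - (cmod u)\<^sup>2)) = 2 * (v * cnj v)"
    by (simp_all only: of_real_mult of_real_numeral complex_norm_square)
  then have "line_proj (hopf2 p) p = ((u * cnj u + v * cnj v) * u, (u * cnj u + v * cnj v) * v)"
    by (simp add: line_proj_def hopf2_def pp algebra_simps)
  moreover have "u * cnj u + v * cnj v = 1" using n by (metis complex_norm_square of_real_1 of_real_add)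
  ultimately have "line_proj (hopf2 p) p = p" by (simp add: pp)
  then show ?thesis using p by (simp add: transport_def)
qed

text \<open>Homotopies are lifted through the Hopf map in short steps, by projecting the previous lift
  onto the line over the new point.\<close>

lemma hopf2_homotopy_lifting:
  fixes H :: "real \<times> 'k::euclidean_space \<Rightarrow> complex \<times> real"
  assumes K: "compact K" and H: "continuous_on ({0..1} \<times> K) H" "\<And>s x. s \<in> {0..1} \<Longrightarrow> x \<in> K \<Longrightarrow> norm (H (s, x)) = 1"
    and L0: "continuous_on K L0" "\<And>x. x \<in> K \<Longrightarrow> norm (L0 x) = 1" "\<And>x. x \<in> K \<Longrightarrow> hopf2 (L0 x) = H (0, x)"
  obtains L where "continuous_on ({0..1} \<times> K) L"
    "\<And>s x. s \<in> {0..1} \<Longrightarrow> x \<in> K \<Longrightarrow> norm (L (s, x)) = 1 \<and> hopf2 (L (s, x)) = H (s, x)"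
    "\<And>x. x \<in> K \<Longrightarrow> L (0, x) = L0 x"
proof -
  have "uniformly_continuous_on ({0..1} \<times> K) H"
    using H(1) K by (intro compact_uniformly_continuous compact_Times) auto
  then obtain e where e: "e > 0" "\<And>a b. \<lbrakk>a \<in> {0..1} \<times> K; b \<in> {0..1} \<times> K; dist b a < e\<rbrakk> \<Longrightarrow>
        dist (H b) (H a) < 2"
    unfolding uniformly_continuous_on_def by (metis zero_less_numeral)
  obtain N :: nat where N: "N > 0" "1 / N < e"
    using e(1) by (metis gr0I inverse_eq_divide of_nat_0_less_iff ex_inverse_of_nat_less)
  \<comment> \<open>\<open>m k\<close> is the clock stopped at time \<open>k / N\<close>. The
    induction lifts the homotopy run by this clock; the next clock differs by less than
    \<open>e\<close>, so the values differ by less than 2 and \<open>transport\<close>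
    applies.\<close>
  define m where "m k s = min s (real k / real N)" for k s
  have m01: "m k s \<in> {0..1}" if "s \<in> {0..1}" for k s using that by (auto simp: m_def)
  have mstep: "\<bar>m (Suc k) s - m k s\<bar> \<le> 1 / N" for k s
  proof -
    have "1 / real N > 0" "real (Suc k) / real N = 1 / real N + real k / real N"
      using N(1) by (simp_all add: add_divide_distrib)
    then show ?thesis by (simp only: m_def)
  qed
  have "\<exists>L. continuous_on ({0..1} \<times> K) L \<and>
      (\<forall>s\<in>{0..1}. \<forall>x\<in>K. norm (L (s, x)) = 1 \<and> hopf2 (L (s, x)) = H (m k s, x)) \<and> (\<forall>x\<in>K. L (0, x) = L0 x)" for k
  proof (induction k)
    case 0
    have "continuous_on ({0..1} \<times> K) (\<lambda>z. L0 (snd z))"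
      by (rule continuous_on_compose2[OF L0(1)]) (auto intro!: continuous_intros)
    then show ?case using L0 by (intro exI[of _ "\<lambda>z. L0 (snd z)"]) (auto simp: m_def)
  next
    case (Suc k)
    then obtain L where L: "continuous_on ({0..1} \<times> K) L"
      "\<And>s x. s \<in> {0..1} \<Longrightarrow> x \<in> K \<Longrightarrow> norm (L (s, x)) = 1"
      "\<And>s x. s \<in> {0..1} \<Longrightarrow> x \<in> K \<Longrightarrow> hopf2 (L (s, x)) = H (m k s, x)"
      "\<And>x. x \<in> K \<Longrightarrow> L (0, x) = L0 x" by blast
    define n where "n z = H (m (Suc k) (fst z), snd z)" for z
    have nn: "norm (n (s, x)) = 1" if "s \<in> {0..1}" "x \<in> K" for s x
      using H(2)[OF m01[OF that(1)] that(2)] by (simp add: n_def)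
    have close: "norm (n (s, x) - hopf2 (L (s, x))) < 2" if "s \<in> {0..1}" "x \<in> K" for s x
    proof -
      have "dist (m (Suc k) s, x) (m k s, x) < e"
        using mstep[of k s] N(2) by (simp add: dist_Pair_Pair dist_real_def)
      then show ?thesis
        using e(2)[of "(m k s, x)" "(m (Suc k) s, x)"] m01[OF that(1)] that(2) L(3)[OF that]
        by (simp add: n_def dist_norm)
    qed
    have cn: "continuous_on ({0..1} \<times> K) n"
      unfolding n_def by (rule continuous_on_compose2[OF H(1)])
        (use m01 in \<open>auto simp: m_def intro!: continuous_intros\<close>)
    define L' where "L' z = transport (n z) (L z)" for z
    have "continuous_on ({0..1} \<times> K) L'"
      unfolding L'_def transport_def
      by (intro continuous_intros cn L(1)) (use line_proj_nonzero[OF nn L(2) close] in auto)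
    moreover have "norm (L' (s, x)) = 1 \<and> hopf2 (L' (s, x)) = H (m (Suc k) s, x)" if "s \<in> {0..1}" "x \<in> K" for s x
      using transport_facts[OF nn[OF that] L(2)[OF that] close[OF that]] by (simp add: L'_def n_def)
    \<comment> \<open>At time 0 all clocks agree, so transport goes to the point already lifted and
      changes nothing.\<close>
    moreover have "L' (0, x) = L0 x" if "x \<in> K" for x
    proof -
      have "n (0, x) = hopf2 (L (0, x))" using L(3)[of 0 x] that by (simp add: n_def m_def)
      then show ?thesis using transport_self[OF L(2)[of 0 x]] L(4) that by (simp add: L'_def)
    qed
    ultimately show ?case by blast
  qed
  from this[of N] obtain L where L: "continuous_on ({0..1} \<times> K) L"
    "\<And>s x. s \<in> {0..1} \<Longrightarrow> x \<in> K \<Longrightarrow> norm (L (s, x)) = 1 \<and> hopf2 (L (s, x)) = H (m N s, x)"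
    "\<And>x. x \<in> K \<Longrightarrow> L (0, x) = L0 x" by blast
  have "m N s = s" if "s \<in> {0..1}" for s using that N(1) by (simp add: m_def)
  then show ?thesis using that[OF L(1)] L(2,3) by simp
qed

text \<open>The null homotopy is lifted starting at the identity of the 3-sphere. The lift ends at a
  map \<open>l\<close> into the single fibre over \<open>c\<close>, which misses some point of the
  sphere and so can be contracted.\<close>

lemma hopf_not_null: "\<not> null_map (top_of_set usph) hopf"
proof
  assume "null_map (top_of_set usph) hopf"
  then obtain c where "homotopic_free (top_of_set usph) hopf (\<lambda>_. c)" by (auto simp: null_map_def)
  then obtain H :: "real \<times> ((complex \<times> real) \<times> real) \<Rightarrow> complex \<times> real" where
    H: "continuous_map cylinder (top_of_set usph) H"
    "\<And>x. x \<in> usph \<Longrightarrow> H (0, x) = hopf x" "\<And>x. x \<in> usph \<Longrightarrow> H (1, x) = c"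
    by (rule homotopic_freeE) blast
  have Hn: "norm (H (s, x)) = 1" if "s \<in> {0..1}" "x \<in> usph" for s x
    using H(1) that by (auto simp: Pi_iff)
  obtain L where L: "continuous_on ({0..1} \<times> usph) L"
    "\<And>s x. s \<in> {0..1} \<Longrightarrow> x \<in> usph \<Longrightarrow> norm (L (s, x)) = 1 \<and> hopf2 (L (s, x)) = H (s, x)"
    "\<And>x. x \<in> usph \<Longrightarrow> L (0, x) = pair_of x"
  proof (rule hopf2_homotopy_lifting[of "usph :: ((complex \<times> real) \<times> real) set" H pair_of])
    show "continuous_on ({0..1} \<times> usph) H" using H(1) by simp
  qed (use Hn H(2) in \<open>auto intro!: continuous_intros simp: hopf_def\<close>)
  define l where "l x = of_pair (L (1, x))" for x
  have L1: "continuous_on usph (\<lambda>x. L (1, x))"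
    by (rule continuous_on_compose2[OF L(1)]) (auto intro!: continuous_intros)
  have l: "norm (l x) = 1" "hopf (l x) = c" if "x \<in> usph" for x
    using L(2)[of 1 x] H(3) that by (auto simp: l_def hopf_def)
  \<comment> \<open>A point outside the fibre over \<open>c\<close>. As \<open>- e\<close> has the
    same image as \<open>e\<close>, the map \<open>l\<close> never takes the value
    \<open>- e\<close>, and the segment from \<open>l x\<close> to \<open>e\<close> avoids
    0.\<close>
  obtain e :: "(complex \<times> real) \<times> real" where e: "norm e = 1" "hopf e \<noteq> c"
  proof (cases "c = pole")
    case True
    have "hopf ((1, 0), 0) \<noteq> pole" by (simp add: hopf_def hopf2_def pair_of_def)
    then show ?thesis using that[of "((1, 0), 0)"] True by (simp add: norm_Pair)
  next
    case False
    then show ?thesis using that[of pole] hopf_pole by (simp add: norm_Pair)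
  qed
  have hopf_minus: "hopf (- e) = hopf e"
    by (simp add: hopf_def pair_of_def hopf2_def cmod_def complex_eq_iff)
  define k where "k s x = (1 - s) *\<^sub>R l x + s *\<^sub>R e" for s x
  have k0: "k s x \<noteq> 0" if s: "s \<in> {0..1}" and x: "x \<in> usph" for s x
  proof
    assume "k s x = 0"
    then have eq: "(1 - s) *\<^sub>R l x = - (s *\<^sub>R e)" by (simp add: k_def add_eq_0_iff2)
    then have "norm ((1 - s) *\<^sub>R l x) = norm (s *\<^sub>R e)" by simp
    then have s2: "s = 1/2" using s l(1)[OF x] e(1) by simp
    have "l x = - e" using eq unfolding s2 by (simp flip: scaleR_minus_right)
    then show False using l(2)[OF x] e(2) hopf_minus by simp
  qed
  have "homotopic_free (top_of_set usph) (\<lambda>x. x) l"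
  proof (rule homotopic_freeI)
    show "continuous_map cylinder (top_of_set usph) (\<lambda>z. of_pair (L z))"
      using L(1,2) by (auto intro!: continuous_intros)
  qed (use L(3) in \<open>auto simp: l_def\<close>)
  moreover have "homotopic_free (top_of_set usph) l (\<lambda>_. e)"
  proof (rule homotopic_freeI)
    have "continuous_on ({0..1} \<times> usph) (\<lambda>z. l (snd z))"
      unfolding l_def by (intro continuous_intros continuous_on_compose2[OF L1]) auto
    then have "continuous_on ({0..1} \<times> usph) (\<lambda>z. k (fst z) (snd z))"
      unfolding k_def by (intro continuous_intros)
    then show "continuous_map cylinder (top_of_set usph)
        (\<lambda>z. k (fst z) (snd z) /\<^sub>R norm (k (fst z) (snd z)))"
      using k0 by (auto intro!: continuous_intros)
  qed (use l e in \<open>auto simp: k_def\<close>)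
  ultimately have "homotopic_free (top_of_set usph) (\<lambda>x. x) (\<lambda>_. e)"
    by (rule homotopic_with_trans)
  then have "contractible (usph :: ((complex \<times> real) \<times> real) set)"
    unfolding contractible_def id_def by blast
  then show False by (simp add: contractible_sphere)
qed

section \<open>Infinitely many elements in the second homotopy group of the 2-sphere\<close>

definition square_gap :: "(nat \<Rightarrow> real) \<Rightarrow> real" where
  "square_gap t = t 0 * (1 - t 0) * (t 1 * (1 - t 1))"

definition square_complex :: "(nat \<Rightarrow> real) \<Rightarrow> complex" where
  "square_complex t = Complex (2 * t 0 - 1) (2 * t 1 - 1)"

text \<open>On the boundary of the square, where \<open>square_gap\<close> vanishes, \<open>wind_lift N\<close> takes values in the Hopf
  fibre over the pole, and its second component winds \<open>N\<close> times around the unit circle.\<close>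

definition wind_lift :: "nat \<Rightarrow> (nat \<Rightarrow> real) \<Rightarrow> complex \<times> complex" where
  "wind_lift N t = (1 / norm (of_real (square_gap t) :: complex, square_complex t ^ N)) *\<^sub>R
     (of_real (square_gap t), square_complex t ^ N)"

text \<open>\<open>square_complex\<close> vanishes only at the centre of the square, where the gap
  is positive.\<close>

lemma wind_lift_denom: "norm (of_real (square_gap t) :: complex, square_complex t ^ N) \<noteq> 0"
proof -
  have "square_gap t \<noteq> 0 \<or> square_complex t \<noteq> 0"
    by (auto simp: square_gap_def square_complex_def complex_eq_iff)
  then show ?thesis by (auto simp: zero_prod_def)
qed

lemma wind_lift_norm: "norm (wind_lift N t) = 1"
  unfolding wind_lift_def norm_scaleR using wind_lift_denom[of t N] by simp

lemma continuous_on_wind_lift: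
  assumes "continuous_on S (\<lambda>r. g r 0)" "continuous_on S (\<lambda>r. g r 1)"
  shows "continuous_on S (\<lambda>r. wind_lift N (g r))"
proof -
  have "continuous_on S (\<lambda>r. (of_real (square_gap (g r)) :: complex, square_complex (g r) ^ N))"
    unfolding square_gap_def square_complex_def Complex_eq using assms by (intro continuous_intros)
  then show ?thesis
    unfolding wind_lift_def
    by (intro continuous_on_scaleR continuous_on_divide continuous_on_const continuous_on_norm ballI wind_lift_denom)
qed

lemma hopf2_fst_zero: "fst p = 0 \<Longrightarrow> norm p = 1 \<Longrightarrow> hopf2 p = pole"
  using norm_pair_sq[of p] by (simp add: hopf2_def)

lemma hopf2_pole_iff: "norm p = 1 \<Longrightarrow> hopf2 p = pole \<longleftrightarrow> fst p = 0"
proof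
  assume "norm p = 1" "hopf2 p = pole"
  then have "(cmod (snd p))\<^sup>2 - (cmod (fst p))\<^sup>2 = 1" "(cmod (fst p))\<^sup>2 + (cmod (snd p))\<^sup>2 = 1"
    using norm_pair_sq[of p] by (simp_all add: hopf2_def)
  then have "(cmod (fst p))\<^sup>2 = 0" by linarith
  then show "fst p = 0" by simp
qed (simp add: hopf2_fst_zero)

lemma square_gap_boundary: "t \<in> cube_boundary 2 \<Longrightarrow> square_gap t = 0"
  by (auto simp: cube_boundary_def square_gap_def less_2_cases_iff)

lemma wind_loop: "(\<lambda>t. hopf2 (wind_lift N t)) \<in> cube_loops 2 (top_of_set usph) pole"
proof -
  \<comment> \<open>\<open>wind_lift\<close> reads only the coordinates 0 and 1, so continuity can
    be checked on the plane.\<close>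
  define f where "f r = (let t = (\<lambda>i::nat. if i = 0 then fst r else snd r) in hopf2 (wind_lift N t))" for r :: "real \<times> real"
  have "continuous_on UNIV f"
    unfolding f_def Let_def by (intro continuous_intros continuous_on_wind_lift) (auto intro!: continuous_intros)
  moreover have "continuous_map (cube 2) (prod_topology euclidean euclidean) (\<lambda>t. (t 0, t 1))"
    by (intro continuous_map_pairedI continuous_map_cube_proj) auto
  ultimately have "continuous_map (cube 2) euclidean (f \<circ> (\<lambda>t. (t 0, t 1)))"
    by (intro continuous_map_compose[of _ euclidean]) auto
  moreover have "f \<circ> (\<lambda>t. (t 0, t 1)) = (\<lambda>t. hopf2 (wind_lift N t))"
    by (auto simp: f_def fun_eq_iff wind_lift_def square_gap_def square_complex_def)
  ultimately have "continuous_map (cube 2) (top_of_set usph) (\<lambda>t. hopf2 (wind_lift N t))"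
    using wind_lift_norm norm_hopf2 by (intro continuous_map_into_subtopology) auto
  moreover have "hopf2 (wind_lift N t) = pole" if "t \<in> cube_boundary 2" for t
    using square_gap_boundary[OF that] wind_lift_norm[of N t] by (intro hopf2_fst_zero) (auto simp: wind_lift_def)
  ultimately show ?thesis by (auto simp: cube_loops_def)
qed

text \<open>The values of \<open>f\<close> are integer multiples of \<open>2 * pi * \<i>\<close>,
  hence distinct values are at least \<open>2 * pi\<close> apart. Applied below to differences of
  logarithms, it replaces a theory of winding numbers.\<close>

lemma exp_eq_1_imp_const:
  fixes f :: "real \<Rightarrow> complex"
  assumes f: "continuous_on {0..1} f" "\<And>t. t \<in> {0..1} \<Longrightarrow> exp (f t) = 1"
  shows "f 0 = f 1"
proof -
  have "f constant_on {0..1}"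
  proof (rule continuous_discrete_range_constant[OF _ f(1)])
    fix x assume x: "x \<in> {0..1::real}"
    have "2 * pi \<le> norm (f y - f x)" if y: "y \<in> {0..1}" "f y \<noteq> f x" for y
    proof -
      obtain m n :: int where "Re (f x) = 0" "Im (f x) = of_int (2 * m) * pi" "Re (f y) = 0" "Im (f y) = of_int (2 * n) * pi"
        using f(2)[OF x] f(2)[OF y(1)] unfolding exp_eq_1 by blast
      moreover from this y(2) have "m \<noteq> n" by (auto simp: complex_eq_iff)
      ultimately have "f y - f x = Complex 0 (of_int (n - m) * (2 * pi))"
        by (simp add: complex_eq_iff algebra_simps)
      then have "norm (f y - f x) = \<bar>of_int (n - m)\<bar> * (2 * pi)"
        by (simp add: cmod_def abs_mult)
      moreover have "1 \<le> \<bar>of_int (n - m) :: real\<bar>" using \<open>m \<noteq> n\<close> by linarith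
      ultimately show ?thesis using mult_right_mono[of 1 "\<bar>of_int (n - m) :: real\<bar>" "2 * pi"] by simp
    qed
    then show "\<exists>e>0. \<forall>y. y \<in> {0..1} \<and> f y \<noteq> f x \<longrightarrow> e \<le> norm (f y - f x)"
      by (intro exI[of _ "2 * pi"]) auto
  qed simp
  then show ?thesis by (auto simp: constant_on_def)
qed

text \<open>Radial projection of the unit circle to the boundary of the square. It keeps the
  argument, so \<open>square_complex\<close> has argument \<open>2 * pi * \<theta>\<close> along the
  rim.\<close>

definition square_rim :: "real \<Rightarrow> real \<times> real" where
  "square_rim \<theta> = (let m = max \<bar>cos (2 * pi * \<theta>)\<bar> \<bar>sin (2 * pi * \<theta>)\<bar> in
     ((1 + cos (2 * pi * \<theta>) / m) / 2, (1 + sin (2 * pi * \<theta>) / m) / 2))"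

text \<open>Restricted to the two indices because points of \<open>cube 2\<close> are extensional
  functions.\<close>

definition square_point :: "real \<times> real \<Rightarrow> nat \<Rightarrow> real" where
  "square_point r = (\<lambda>i\<in>{..<2}. if i = 0 then fst r else snd r)"

lemma square_point_simps [simp]: "square_point r 0 = fst r" "square_point r (Suc 0) = snd r"
  by (simp_all add: square_point_def)

lemma square_point_cube: "r \<in> {0..1} \<times> {0..1} \<Longrightarrow> square_point r \<in> topspace (cube 2)"
  by (auto simp: topspace_cube square_point_def)

lemma continuous_map_square_point:
  "continuous_map (top_of_set ({0..1} \<times> {0..1})) (cube 2) square_point"
  unfolding cube_def
proof (rule continuous_map_componentwise[THEN iffD2], intro conjI ballI)
  show "square_point ` topspace (top_of_set ({0..1} \<times> {0..1})) \<subseteq> extensional {..<2}"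
    by (auto simp: square_point_def)
  fix k :: nat assume "k \<in> {..<2}"
  then have "k = 0 \<or> k = 1" by auto
  then show "continuous_map (top_of_set ({0..1} \<times> {0..1})) (top_of_set {0..1}) (\<lambda>r. square_point r k)"
    by (auto intro!: continuous_intros)
qed

lemma rim_denom: "max \<bar>cos x\<bar> \<bar>sin x\<bar> > (0::real)"
  using sin_zero_abs_cos_one[of x] by (cases "sin x = 0") (auto simp: less_max_iff_disj)

lemma square_rim:
  shows square_rim_in: "square_rim \<theta> \<in> {0..1} \<times> {0..1}"
    and square_rim_gap: "square_gap (square_point (square_rim \<theta>)) = 0"
    and square_rim_wind: "snd (wind_lift N (square_point (square_rim \<theta>))) = exp (\<i> * of_real (2 * pi * N * \<theta>))"
    and square_rim_ends: "square_rim 0 = square_rim 1"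
proof -
  define c s where "c = cos (2 * pi * \<theta>)" and "s = sin (2 * pi * \<theta>)"
  define m where "m = max \<bar>c\<bar> \<bar>s\<bar>"
  have m: "m > 0" using rim_denom by (simp add: m_def c_def s_def)
  have rim: "square_rim \<theta> = ((1 + c / m) / 2, (1 + s / m) / 2)"
    by (simp add: square_rim_def Let_def m_def c_def s_def)
  have cs: "\<bar>c / m\<bar> \<le> 1" "\<bar>s / m\<bar> \<le> 1" "\<bar>c / m\<bar> = 1 \<or> \<bar>s / m\<bar> = 1"
    using m by (auto simp: m_def divide_le_eq max_def)
  show "square_rim \<theta> \<in> {0..1} \<times> {0..1}" using cs(1,2) unfolding rim abs_le_iff by auto
  show gap: "square_gap (square_point (square_rim \<theta>)) = 0"
    using cs(3) unfolding rim square_gap_def by (auto simp: abs_if split: if_splits)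
  have z: "square_complex (square_point (square_rim \<theta>)) = of_real (1 / m) * exp (\<i> * of_real (2 * pi * \<theta>))"
    by (simp add: square_complex_def rim complex_eq_iff Re_exp Im_exp c_def s_def add_divide_distrib)
  have zN: "square_complex (square_point (square_rim \<theta>)) ^ N = of_real ((1 / m) ^ N) * exp (\<i> * of_real (2 * pi * N * \<theta>))"
    unfolding z power_mult_distrib exp_of_nat_mult[symmetric] by (simp add: algebra_simps)
  have "snd (wind_lift N (square_point (square_rim \<theta>))) =
      (1 / ((1 / m) ^ N)) *\<^sub>R (of_real ((1 / m) ^ N) * exp (\<i> * of_real (2 * pi * N * \<theta>)))"
    unfolding wind_lift_def gap zN using m by (simp add: norm_Pair norm_mult norm_power norm_divide)
  also have "\<dots> = exp (\<i> * of_real (2 * pi * N * \<theta>))"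
    using m by (simp add: scaleR_conv_of_real)
  finally show "snd (wind_lift N (square_point (square_rim \<theta>))) = exp (\<i> * of_real (2 * pi * N * \<theta>))" .
  show "square_rim 0 = square_rim 1" by (simp add: square_rim_def Let_def)
qed

lemma continuous_on_square_rim: "continuous_on S square_rim"
  unfolding square_rim_def Let_def
  by (intro continuous_intros) (use rim_denom in \<open>auto simp: less_le\<close>)

text \<open>The homotopy is lifted through the Hopf map, starting at \<open>wind_lift N\<close>.
  Along the rim the lift stays in the circle over the pole, so its winding number is defined and
  constant in time. It is \<open>N\<close> at the start and turns out to be \<open>M\<close> at the
  end.\<close>

lemma wind_loop_inj:
  assumes hom: "loop_homotopic 2 (top_of_set usph) pole (\<lambda>t. hopf2 (wind_lift N t)) (\<lambda>t. hopf2 (wind_lift M t))"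
  shows "N = M"
proof -
  let ?K = "{0..1} \<times> {0..1} :: (real \<times> real) set"
  obtain h where h: "continuous_map (prod_topology (top_of_set {0..1::real}) (cube 2)) (top_of_set usph) h"
    "\<And>t. h (0, t) = hopf2 (wind_lift N t)" "\<And>t. h (1, t) = hopf2 (wind_lift M t)"
    "\<And>s. s \<in> {0..1} \<Longrightarrow> (\<lambda>t. h (s, t)) ` cube_boundary 2 \<subseteq> {pole}"
    using hom unfolding homotopic_with_def by blast
  define H where "H z = h (fst z, square_point (snd z))" for z
  have "continuous_map (prod_topology (top_of_set {0..1::real}) (top_of_set ?K)) (top_of_set usph) (h \<circ> (\<lambda>(s, r). (s, square_point r)))"
    by (intro continuous_map_compose[OF _ h(1)])
      (use continuous_map_prod_top[of "top_of_set {0..1::real}" "top_of_set ?K" "top_of_set {0..1::real}" "cube 2" "\<lambda>x. x" square_point]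
        continuous_map_square_point in simp)
  then have "continuous_map (top_of_set ({0..1} \<times> ?K)) (top_of_set usph) H"
    by (simp add: H_def[abs_def] o_def case_prod_unfold)
  then have H: "continuous_on ({0..1} \<times> ?K) H" "\<And>s r. s \<in> {0..1} \<Longrightarrow> r \<in> ?K \<Longrightarrow> norm (H (s, r)) = 1"
    by (auto simp: Pi_iff)
  have wl: "continuous_on ?K (\<lambda>r. wind_lift N (square_point r))" for N
    by (intro continuous_on_wind_lift) (auto intro!: continuous_intros)
  obtain L where L: "continuous_on ({0..1} \<times> ?K) L"
    "\<And>s r. s \<in> {0..1} \<Longrightarrow> r \<in> ?K \<Longrightarrow> norm (L (s, r)) = 1 \<and> hopf2 (L (s, r)) = H (s, r)"
    "\<And>r. r \<in> ?K \<Longrightarrow> L (0, r) = wind_lift N (square_point r)"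
    by (rule hopf2_homotopy_lifting[of ?K H "\<lambda>r. wind_lift N (square_point r)"])
      (use H wl wind_lift_norm h(2) in \<open>auto simp: H_def compact_Times\<close>)
  have rim: "square_rim \<theta> \<in> ?K" for \<theta> by (rule square_rim_in)
  have rimb: "square_point (square_rim \<theta>) \<in> cube_boundary 2" for \<theta>
  proof -
    have "square_gap (square_point (square_rim \<theta>)) = 0" by (rule square_rim_gap)
    then have "\<exists>k<2. square_point (square_rim \<theta>) k = 0 \<or> square_point (square_rim \<theta>) k = 1"
      by (auto simp: square_gap_def less_2_cases_iff)
    then show ?thesis using square_point_cube[OF rim] by (simp add: cube_boundary_def)
  qed
  \<comment> \<open>On the boundary the homotopy stays at the pole, whose fibre consists of the unit
    vectors with first component 0.\<close>
  have fz: "fst (L (s, square_rim \<theta>)) = 0" if "s \<in> {0..1}" for s \<theta>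
  proof -
    have "hopf2 (L (s, square_rim \<theta>)) = pole"
      using L(2)[OF that rim] h(4)[OF that] rimb by (auto simp: H_def)
    then show ?thesis using hopf2_pole_iff L(2)[OF that rim] by blast
  qed
  define F where "F z = snd (L (fst z, square_rim (snd z)))" for z
  have F: "continuous_on ({0..1} \<times> {0..1}) F"
  proof -
    have "continuous_on ({0..1} \<times> {0..1}) (\<lambda>z :: real \<times> real. square_rim (snd z))"
      by (rule continuous_on_compose2[OF continuous_on_square_rim[of UNIV]]) (auto intro!: continuous_intros)
    then have a: "continuous_on ({0..1} \<times> {0..1}) (\<lambda>z :: real \<times> real. (fst z, square_rim (snd z)))"
      by (intro continuous_intros)
    have b: "(\<lambda>z :: real \<times> real. (fst z, square_rim (snd z))) ` ({0..1} \<times> {0..1}) \<subseteq> {0..1} \<times> ?K"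
      using rim by (intro image_subsetI SigmaI) (simp_all add: mem_Times_iff)
    show ?thesis
      unfolding F_def using continuous_on_snd[OF continuous_on_compose2[OF L(1) a b]] .
  qed
  have F0: "F z \<noteq> 0" if "z \<in> {0..1} \<times> {0..1}" for z
  proof
    assume "F z = 0"
    then have "L (fst z, square_rim (snd z)) = 0" using fz that by (auto simp: F_def prod_eq_iff)
    moreover have "fst z \<in> {0..1}" using that by auto
    ultimately show False using L(2)[OF _ rim, of "fst z" "snd z"] by simp
  qed
  have "contractible ({0..1} \<times> {0..1} :: (real \<times> real) set)"
    by (intro convex_imp_contractible convex_Times) auto
  then obtain g where g: "continuous_on ({0..1} \<times> {0..1}) g" "\<And>z. z \<in> {0..1} \<times> {0..1} \<Longrightarrow> F z = exp (g z)"
    using continuous_logarithm_on_contractible[OF F _ F0] by blast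
  \<comment> \<open>The end of the lift and \<open>wind_lift M\<close> lie over the same map, so
    they differ by a phase \<open>l\<close>. The phase is defined on the whole square, which is
    contractible; it therefore has a logarithm and does not wind along the rim.\<close>
  define l where "l r = fst (L (1, r)) * cnj (fst (wind_lift M (square_point r))) + snd (L (1, r)) * cnj (snd (wind_lift M (square_point r)))" for r
  have l: "L (1, r) = (l r * fst (wind_lift M (square_point r)), l r * snd (wind_lift M (square_point r)))" "cmod (l r) = 1"
    if "r \<in> ?K" for r
    unfolding l_def using L(2)[of 1 r] that h(3) wind_lift_norm
    by (intro hopf2_fibre; simp add: H_def)+
  have "continuous_on ?K l"
    unfolding l_def by (intro continuous_intros wl continuous_on_compose2[OF L(1)]) auto
  moreover have "contractible ?K" by (intro convex_imp_contractible convex_Times) auto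
  moreover have "l r \<noteq> 0" if "r \<in> ?K" for r using l(2)[OF that] by auto
  ultimately obtain k where k: "continuous_on ?K k" "\<And>r. r \<in> ?K \<Longrightarrow> l r = exp (k r)"
    using continuous_logarithm_on_contractible by blast
  have g0: "continuous_on {0..1} (\<lambda>\<theta>. g (0, \<theta>))" and g1: "continuous_on {0..1} (\<lambda>\<theta>. g (1, \<theta>))"
    and ga: "continuous_on {0..1} (\<lambda>s. g (s, 0))" and gb: "continuous_on {0..1} (\<lambda>s. g (s, 1))"
    by (rule continuous_on_compose2[OF g(1)]; auto intro!: continuous_intros)+
  have krim: "continuous_on {0..1} (\<lambda>\<theta>. k (square_rim \<theta>))"
    by (rule continuous_on_compose2[OF k(1) continuous_on_square_rim]) (intro image_subsetI rim)
  \<comment> \<open>Along the rim, \<open>g\<close> and the explicit exponent of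
    \<open>wind_lift N\<close> are logarithms of the same function, so their difference is
    constant.\<close>
  have e0: "g (0, 0) - \<i> * of_real (2 * pi * N * 0) = g (0, 1) - \<i> * of_real (2 * pi * N * 1)"
  proof (rule exp_eq_1_imp_const[of "\<lambda>\<theta>. g (0, \<theta>) - \<i> * of_real (2 * pi * N * \<theta>)"])
    fix \<theta> :: real assume "\<theta> \<in> {0..1}"
    then have "exp (g (0, \<theta>)) = exp (\<i> * of_real (2 * pi * N * \<theta>))"
      using g(2)[of "(0, \<theta>)"] L(3)[OF rim] square_rim_wind by (simp add: F_def)
    then show "exp (g (0, \<theta>) - \<i> * of_real (2 * pi * N * \<theta>)) = 1" by (simp add: exp_diff)
  qed (intro continuous_intros g0)
  have e1: "g (1, 0) - \<i> * of_real (2 * pi * M * 0) - k (square_rim 0) = g (1, 1) - \<i> * of_real (2 * pi * M * 1) - k (square_rim 1)"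
  proof (rule exp_eq_1_imp_const[of "\<lambda>\<theta>. g (1, \<theta>) - \<i> * of_real (2 * pi * M * \<theta>) - k (square_rim \<theta>)"])
    fix \<theta> :: real assume "\<theta> \<in> {0..1}"
    then have "exp (g (1, \<theta>)) = exp (k (square_rim \<theta>)) * exp (\<i> * of_real (2 * pi * M * \<theta>))"
      using g(2)[of "(1, \<theta>)"] l(1)[OF rim] k(2)[OF rim] square_rim_wind[of M \<theta>] by (simp add: F_def)
    then show "exp (g (1, \<theta>) - \<i> * of_real (2 * pi * M * \<theta>) - k (square_rim \<theta>)) = 1" by (simp add: exp_diff)
  qed (intro continuous_intros g1 krim)
  \<comment> \<open>The increment of \<open>g\<close> around the rim at time \<open>s\<close> is
    \<open>2 * pi * \<i>\<close> times the winding number at that time.\<close>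
  have e2: "g (0, 1) - g (0, 0) = g (1, 1) - g (1, 0)"
  proof (rule exp_eq_1_imp_const[of "\<lambda>s. g (s, 1) - g (s, 0)"])
    fix s :: real assume "s \<in> {0..1}"
    then have "exp (g (s, 1)) = exp (g (s, 0))"
      using g(2)[of "(s, 0)"] g(2)[of "(s, 1)"] square_rim_ends by (simp add: F_def)
    then show "exp (g (s, 1) - g (s, 0)) = 1" by (simp add: exp_diff)
  qed (intro continuous_intros ga gb)
  have "\<i> * of_real (2 * pi * N) = g (0, 1) - g (0, 0)"
    using e0 unfolding mult_zero_right of_real_0 diff_zero mult_1_right by (simp only: algebra_simps)
  moreover have "\<i> * of_real (2 * pi * M) = g (1, 1) - g (1, 0)"
    using e1 unfolding mult_zero_right of_real_0 diff_zero mult_1_right square_rim_ends by (simp only: algebra_simps add_left_cancel)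
  ultimately have "\<i> * complex_of_real (2 * pi * N) = \<i> * complex_of_real (2 * pi * M)" using e2 by simp
  then have "complex_of_real (2 * pi * N) = complex_of_real (2 * pi * M)" by (simp only: mult_cancel_left) simp
  then have "2 * pi * real N = 2 * pi * real M" by (simp only: of_real_eq_iff)
  then show ?thesis by simp
qed

section \<open>Spaces that carry an essential composite with the Hopf map\<close>

text \<open>Path connectedness allows the base point of \<open>g\<close> to be moved. The infinity
  of pi_2 is carried along the zigzag so that it reaches \<open>R C\<close>, where it shows that the
  universe is infinite.\<close>

definition hopf_essential :: "'b topology \<Rightarrow> bool" where
  "hopf_essential X \<longleftrightarrow> path_connected_space X \<and>
     (\<exists>g. continuous_map (top_of_set usph) X g \<and> \<not> null_map X (\<lambda>x. g (hopf x))) \<and>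
     (\<forall>x\<in>topspace X. infinite (loop_classes 2 X x))"

text \<open>Path connectedness means at most one path component, which is invariant under a
  bijection of the sets of components.\<close>

lemma path_connected_space_pi0_bij:
  assumes "top_pi0_bij X Y f"
  shows "path_connected_space X \<longleftrightarrow> path_connected_space Y"
proof -
  have iff: "path_connected_space Z \<longleftrightarrow> (\<forall>P\<in>path_components_of Z. \<forall>Q\<in>path_components_of Z. P = Q)" for Z :: "'z topology"
  proof
    assume "path_connected_space Z"
    then have "path_components_of Z \<subseteq> {topspace Z}" by (simp add: path_components_of_subset_singleton)
    then show "\<forall>P\<in>path_components_of Z. \<forall>Q\<in>path_components_of Z. P = Q" by blast
  next
    assume all: "\<forall>P\<in>path_components_of Z. \<forall>Q\<in>path_components_of Z. P = Q"
    have "path_components_of Z \<subseteq> {SOME S. S \<in> path_components_of Z}"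
    proof
      fix P assume P: "P \<in> path_components_of Z"
      then have "(SOME S. S \<in> path_components_of Z) \<in> path_components_of Z" by (rule someI)
      with all P show "P \<in> {SOME S. S \<in> path_components_of Z}" by simp
    qed
    then show "path_connected_space Z" using path_components_of_subset_singleton by blast
  qed
  have Y: "path_components_of Y = top_pi0_map Y f ` path_components_of X"
    and inj: "inj_on (top_pi0_map Y f) (path_components_of X)"
    using assms by (auto simp: top_pi0_bij_def bij_betw_def)
  show ?thesis unfolding iff Y using inj by (simp add: inj_on_def) metis
qed

lemma homotopic_based_const_imp_null: "homotopic_based X x g (\<lambda>_. c) \<Longrightarrow> null_map X g"
  unfolding null_map_def by (intro exI) (rule homotopic_based_imp_free)

text \<open>After moving the base point of \<open>g\<close> to \<open>f x\<close>, surjectivity on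
  pi_2 lifts \<open>g\<close> to \<open>k\<close> up to homotopy. A null homotopy of
  \<open>k\<close> composed with \<open>hopf\<close> would push forward to one of the composite of
  \<open>g\<close>.\<close>

lemma hopf_composite_lift:
  fixes f :: "'b \<Rightarrow> 'c"
  assumes Y: "path_connected_space Y" and f: "continuous_map X Y f" "pi_bij 2 X Y f x" and x: "x \<in> topspace X"
    and g: "continuous_map (top_of_set usph) Y g" "\<not> null_map Y (\<lambda>z. g (hopf z))"
  obtains k where "k \<in> sphere_maps X x" "\<not> null_map X (\<lambda>z. k (hopf z))"
proof -
  have fx: "f x \<in> topspace Y"
    using f(1) x by (meson continuous_map_image_subset_topspace image_subset_iff)
  obtain g' where g': "g' \<in> sphere_maps Y (f x)" "homotopic_free Y g g'"
    using rebase_sphere_map[OF Y g(1) fx] by blast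
  have "pi_bij DIM(complex) X Y f x" using f(2) by simp
  from pi_bij_surj[OF f(1) this g'(1)] obtain k where
    k: "k \<in> sphere_maps X x" "homotopic_based Y (f x) (\<lambda>z. f (k z)) g'" by blast
  have "homotopic_free Y (\<lambda>z. f (k z)) g"
    by (rule homotopic_with_trans[OF homotopic_based_imp_free[OF k(2)] homotopic_with_symD[OF g'(2)]])
  from null_map_cong_free[OF homotopic_free_compose_right[OF this continuous_on_hopf image_subsetI[OF hopf_usph]]]
  have "\<not> null_map X (\<lambda>z. k (hopf z))"
    using null_map_compose[OF _ f(1), of "\<lambda>z. k (hopf z)"] g(2) by blast
  with k(1) show ?thesis by (rule that)
qed

text \<open>As \<open>hopf\<close> fixes the pole, the composite with \<open>k\<close> is based at
  \<open>x\<close> and represents an element of pi_3, where injectivity applies to the null homotopy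
  once it is made based.\<close>

lemma null_map_hopf_reflect:
  fixes f :: "'b \<Rightarrow> 'c"
  assumes f: "continuous_map X Y f" "inj_on (top_pi_map 3 Y f x) (loop_classes 3 X x)"
    and k: "k \<in> sphere_maps X x" and null: "null_map Y (\<lambda>z. f (k (hopf z)))"
  shows "null_map X (\<lambda>z. k (hopf z))"
proof -
  have c: "continuous_map (top_of_set usph) X k" "k pole = x" using k by (simp_all add: sphere_maps_def)
  have hom: "homotopic_based Y (f x) (\<lambda>z. f (k (hopf z))) (\<lambda>_. f x)"
    using null_map_imp_based[OF null] by (simp add: hopf_pole c(2))
  have "continuous_map (top_of_set usph) X (\<lambda>z. k (hopf z))"
    by (rule usph_reparam[OF c(1) continuous_on_hopf]) (use hopf_usph in blast)
  then have kh: "(\<lambda>z. k (hopf z)) \<in> sphere_maps X x" by (simp add: sphere_maps_def hopf_pole c(2))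
  have const: "(\<lambda>_. x) \<in> sphere_maps X x"
    using continuous_map_usph_in_topspace[OF c(1) pole_in_usph] c(2) by (simp add: sphere_maps_def)
  have inj: "inj_on (top_pi_map DIM(complex \<times> real) Y f x) (loop_classes DIM(complex \<times> real) X x)"
    using f(2) by simp
  show ?thesis by (rule homotopic_based_const_imp_null[OF pi_bij_inj[OF f(1) inj kh const hom]])
qed

lemma hopf_essential_push:
  fixes f :: "'b \<Rightarrow> 'c"
  assumes f: "continuous_map X Y f" "top_pi0_bij X Y f" "top_pi_iso 2 X Y f" "top_pi_iso 3 X Y f"
    and X: "hopf_essential X"
  shows "hopf_essential Y"
  unfolding hopf_essential_def
proof (intro conjI ballI)
  show pc: "path_connected_space Y"
    using path_connected_space_pi0_bij[OF f(2)] X by (simp add: hopf_essential_def)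
  obtain g where g: "continuous_map (top_of_set usph) X g" "\<not> null_map X (\<lambda>x. g (hopf x))"
    using X by (auto simp: hopf_essential_def)
  have x: "g pole \<in> topspace X" by (rule continuous_map_usph_in_topspace[OF g(1) pole_in_usph])
  show "\<exists>k. continuous_map (top_of_set usph) Y k \<and> \<not> null_map Y (\<lambda>x. k (hopf x))"
  proof (intro exI conjI notI)
    show "continuous_map (top_of_set usph) Y (f \<circ> g)" by (rule continuous_map_compose[OF g(1) f(1)])
    assume "null_map Y (\<lambda>x. (f \<circ> g) (hopf x))"
    then have "null_map Y (\<lambda>x. f (g (hopf x)))" by simp
    from null_map_hopf_reflect[OF f(1) _ _ this, of "g pole"] show False
      using top_pi_iso_imp_pi_bij[OF f(4) x] g unfolding pi_bij_def bij_betw_def sphere_maps_def by blast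
  qed
  fix y assume y: "y \<in> topspace Y"
  have "infinite (loop_classes 2 X (g pole))" using X x by (simp add: hopf_essential_def)
  then have "infinite (loop_classes 2 Y (f (g pole)))"
    using top_pi_iso_imp_pi_bij[OF f(3) x] unfolding pi_bij_def by (simp add: bij_betw_finite)
  moreover have "f (g pole) \<in> topspace Y" using f(1) x by (meson continuous_map_image_subset_topspace image_subset_iff)
  ultimately show "infinite (loop_classes 2 Y y)"
    using infinite_loop_classes_path[where 'v=complex, OF pc _ y] by simp
qed

lemma hopf_essential_pull:
  fixes f :: "'b \<Rightarrow> 'c"
  assumes f: "continuous_map X Y f" "top_pi0_bij X Y f" "top_pi_iso 2 X Y f"
    and Y: "hopf_essential Y"
  shows "hopf_essential X"
  unfolding hopf_essential_def
proof (intro conjI ballI)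
  have pc: "path_connected_space Y" using Y by (simp add: hopf_essential_def)
  then show "path_connected_space X" using path_connected_space_pi0_bij[OF f(2)] by simp
  obtain g where g: "continuous_map (top_of_set usph) Y g" "\<not> null_map Y (\<lambda>x. g (hopf x))"
    using Y by (auto simp: hopf_essential_def)
  have "g pole \<in> topspace Y" by (rule continuous_map_usph_in_topspace[OF g(1) pole_in_usph])
  then have "path_components_of Y \<noteq> {}" by (auto simp: path_components_of_def)
  then have "path_components_of X \<noteq> {}" using f(2) by (auto simp: top_pi0_bij_def bij_betw_def)
  then obtain P where "P \<in> path_components_of X" by blast
  then obtain x where x: "x \<in> topspace X" by (auto simp: path_components_of_def)
  have fx: "f z \<in> topspace Y" if "z \<in> topspace X" for z
    using f(1) that by (meson continuous_map_image_subset_topspace image_subset_iff)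
  obtain k where "k \<in> sphere_maps X x" "\<not> null_map X (\<lambda>x. k (hopf x))"
    by (rule hopf_composite_lift[OF pc f(1) top_pi_iso_imp_pi_bij[OF f(3) x] x g])
  then show "\<exists>k. continuous_map (top_of_set usph) X k \<and> \<not> null_map X (\<lambda>x. k (hopf x))"
    by (auto simp: sphere_maps_def)
  fix z assume z: "z \<in> topspace X"
  have "infinite (loop_classes 2 Y (f z))" using Y fx[OF z] by (simp add: hopf_essential_def)
  then show "infinite (loop_classes 2 X z)"
    using top_pi_iso_imp_pi_bij[OF f(3) z] unfolding pi_bij_def by (simp add: bij_betw_finite)
qed

lemma hopf_essential_weak_homotopy_equivalence:
  assumes "weak_homotopy_equivalence X Y f"
  shows "hopf_essential X \<longleftrightarrow> hopf_essential Y"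
proof -
  have f: "continuous_map X Y f" "top_pi0_bij X Y f" "top_pi_iso 2 X Y f" "top_pi_iso 3 X Y f"
    using assms by (simp_all add: weak_homotopy_equivalence_def)
  show ?thesis using hopf_essential_push[OF f] hopf_essential_pull[OF f(1-3)] by blast
qed

lemma hopf_essential_weak_equivalent:
  assumes "weak_equivalent X Y" shows "hopf_essential X \<longleftrightarrow> hopf_essential Y"
  using assms[unfolded weak_equivalent_def]
proof (induction rule: equivclp_induct)
  case (step Y Z)
  then show ?case using hopf_essential_weak_homotopy_equivalence by blast
qed simp

section \<open>The unit sphere of \<open>complex \<times> real\<close> and
  \<open>nsphere 2\<close>\<close>

definition to_nsphere :: "complex \<times> real \<Rightarrow> nat \<Rightarrow> real" where
  "to_nsphere x = (\<lambda>i. if i = 0 then Re (fst x) else if i = 1 then Im (fst x) else if i = 2 then snd x else 0)"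

definition from_nsphere :: "(nat \<Rightarrow> real) \<Rightarrow> complex \<times> real" where
  "from_nsphere x = (Complex (x 0) (x 1), x 2)"

lemma from_to_nsphere: "from_nsphere (to_nsphere x) = x"
  by (simp add: from_nsphere_def to_nsphere_def)

lemma to_from_nsphere: "x \<in> topspace (nsphere 2) \<Longrightarrow> to_nsphere (from_nsphere x) = x"
  by (auto simp: nsphere from_nsphere_def to_nsphere_def fun_eq_iff numeral_2_eq_2)

lemma continuous_map_to_nsphere: "continuous_map (top_of_set usph) (nsphere 2) to_nsphere"
proof -
  have "(\<Sum>i\<le>2. (to_nsphere x i)\<^sup>2) = 1" if "x \<in> usph" for x
    using that usph_prod_iff[of x] by (simp add: to_nsphere_def numeral_2_eq_2 cmod_def)
  then have "to_nsphere ` usph \<subseteq> {x. (\<Sum>i\<le>2. (x i)\<^sup>2) = 1 \<and> (\<forall>i>2. x i = 0)}"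
    by (auto simp: to_nsphere_def simp del: mem_sphere mem_sphere_0)
  moreover have "continuous_map (top_of_set usph) (powertop_real UNIV) to_nsphere"
    unfolding continuous_map_componentwise_UNIV
  proof
    fix k :: nat
    consider "k = 0" | "k = 1" | "k = 2" | "k > 2" by linarith
    then show "continuous_map (top_of_set usph) euclideanreal (\<lambda>x. to_nsphere x k)"
      by cases (auto simp: to_nsphere_def intro!: continuous_intros)
  qed
  ultimately show ?thesis
    unfolding nsphere by (intro continuous_map_into_subtopology) auto
qed

lemma continuous_map_from_nsphere: "continuous_map (nsphere 2) (top_of_set usph) from_nsphere"
proof (rule continuous_map_into_subtopology)
  have "continuous_map (nsphere 2) (prod_topology euclidean euclidean)
      (\<lambda>x. ((\<lambda>p. Complex (fst p) (snd p)) (x 0, x 1), x 2))"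
  proof (intro continuous_map_pairedI continuous_map_nsphere_projection)
    have "continuous_map (nsphere 2) (prod_topology euclidean euclidean) (\<lambda>x. (x 0, x 1))"
      by (intro continuous_map_pairedI continuous_map_nsphere_projection)
    then have "continuous_map (nsphere 2) euclidean ((\<lambda>p. Complex (fst p) (snd p)) \<circ> (\<lambda>x. (x 0, x 1)))"
      by (intro continuous_map_compose[of _ euclidean]) (auto simp: Complex_eq intro!: continuous_intros)
    then show "continuous_map (nsphere 2) euclidean (\<lambda>x. (\<lambda>p. Complex (fst p) (snd p)) (x 0, x 1))"
      by (simp add: o_def)
  qed
  then show "continuous_map (nsphere 2) euclidean from_nsphere"
    by (simp add: from_nsphere_def[abs_def])
  show "from_nsphere \<in> topspace (nsphere 2) \<rightarrow> usph"
  proof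
    fix x assume "x \<in> topspace (nsphere 2)"
    then have "(x 0)\<^sup>2 + (x 1)\<^sup>2 + (x 2)\<^sup>2 = 1" by (simp add: nsphere numeral_2_eq_2)
    then show "from_nsphere x \<in> usph" unfolding usph_prod_iff by (simp add: from_nsphere_def cmod_def)
  qed
qed

lemma infinite_loop_classes_nsphere: "infinite (loop_classes 2 (nsphere 2) (to_nsphere pole))"
proof -
  define p where "p N = to_nsphere \<circ> (\<lambda>t. hopf2 (wind_lift N t))" for N
  have p: "p N \<in> cube_loops 2 (nsphere 2) (to_nsphere pole)" for N
    using wind_loop[of N] continuous_map_compose[OF _ continuous_map_to_nsphere]
    unfolding p_def cube_loops_def by fastforce
  have "inj (\<lambda>N. loop_class 2 (nsphere 2) (to_nsphere pole) (p N))"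
  proof (rule injI)
    fix N M assume "loop_class 2 (nsphere 2) (to_nsphere pole) (p N) = loop_class 2 (nsphere 2) (to_nsphere pole) (p M)"
    then have "loop_homotopic 2 (nsphere 2) (to_nsphere pole) (p N) (p M)"
      using loop_class_eq_iff[OF p p] by simp
    from loop_homotopic_compose[OF this continuous_map_from_nsphere]
    show "N = M" by (intro wind_loop_inj) (simp add: p_def o_def from_to_nsphere)
  qed
  moreover have "range (\<lambda>N. loop_class 2 (nsphere 2) (to_nsphere pole) (p N)) \<subseteq> loop_classes 2 (nsphere 2) (to_nsphere pole)"
    using p by (auto simp: loop_classes_eq)
  ultimately show ?thesis using infinite_UNIV_nat finite_imageD finite_subset by blast
qed

lemma hopf_essential_nsphere: "hopf_essential (nsphere 2)"
  unfolding hopf_essential_def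
proof (intro conjI ballI)
  have "path_connectedin (nsphere 2) (to_nsphere ` usph)"
    by (rule path_connectedin_continuous_map_image[OF continuous_map_to_nsphere])
      (auto simp: path_connectedin_subtopology path_connectedin_euclidean path_connected_sphere)
  moreover have "to_nsphere ` usph = topspace (nsphere 2)"
  proof (intro equalityI subsetI)
    fix x assume x: "x \<in> topspace (nsphere 2)"
    have "from_nsphere x \<in> usph"
      using subsetD[OF continuous_map_image_subset_topspace[OF continuous_map_from_nsphere] imageI[OF x]]
      unfolding topspace_euclidean_subtopology .
    then show "x \<in> to_nsphere ` usph"
      using imageI[of "from_nsphere x" usph to_nsphere] to_from_nsphere[OF x] by simp
  next
    fix x assume "x \<in> to_nsphere ` usph"
    then show "x \<in> topspace (nsphere 2)" using continuous_map_usph_in_topspace[OF continuous_map_to_nsphere] by (elim imageE) simp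
  qed
  ultimately show pc: "path_connected_space (nsphere 2)" by (simp add: path_connectedin_topspace)
  show "\<exists>g. continuous_map (top_of_set usph) (nsphere 2) g \<and> \<not> null_map (nsphere 2) (\<lambda>x. g (hopf x))"
  proof (intro exI conjI notI)
    assume "null_map (nsphere 2) (\<lambda>x. to_nsphere (hopf x))"
    from null_map_compose[OF this continuous_map_from_nsphere]
    show False using hopf_not_null by (simp add: from_to_nsphere)
  qed (rule continuous_map_to_nsphere)
  fix y assume "y \<in> topspace (nsphere 2)"
  then show "infinite (loop_classes 2 (nsphere 2) y)"
    using infinite_loop_classes_path[where 'v=complex, OF pc continuous_map_usph_in_topspace[OF continuous_map_to_nsphere pole_in_usph]]
      infinite_loop_classes_nsphere by simp
qed

lemma hopf_essential_truncation:
  assumes "is_truncation 3 (nsphere 2) T" shows "hopf_essential T"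
proof -
  from assms obtain f where "continuous_map (nsphere 2) T f" "top_pi0_bij (nsphere 2) T f"
    and "\<forall>i. 1 \<le> i \<and> i \<le> 3 \<longrightarrow> top_pi_iso i (nsphere 2) T f" unfolding is_truncation_def by blast
  then show ?thesis using hopf_essential_push[OF _ _ _ _ hopf_essential_nsphere, of T f] by simp
qed

section \<open>Components of raw morphisms and products\<close>

lemma obf_nfun_comp [simp]: "obf (nfun_comp G F) x = obf G (obf F x)"
  by (cases F) auto

text \<open>\<open>homf\<close> is unspecified on \<open>Fun0\<close>, so the rules for
  \<open>homf\<close> need to know the constructor; this is why it is tracked.\<close>

lemma is_Fun0_nfun_comp [simp]: "is_Fun0 (nfun_comp G F) \<longleftrightarrow> is_Fun0 F"
  by (cases F) auto

lemma homf_nfun_comp [simp]: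
  "\<not> is_Fun0 F \<Longrightarrow> homf (nfun_comp G F) x y = nfun_comp (homf G (obf F x) (obf F y)) (homf F x y)"
  by (cases F) auto

lemma obf_nfun_prod [simp]: "obf (nfun_prod F G) = map_prod (obf F) (obf G)"
  by (cases F) auto

lemma is_Fun0_nfun_prod [simp]: "is_Fun0 (nfun_prod F G) \<longleftrightarrow> is_Fun0 F"
  by (cases F) auto

lemma homf_nfun_prod [simp]:
  "\<not> is_Fun0 F \<Longrightarrow> homf (nfun_prod F G) (x, x') (y, y') = nfun_prod (homf F x y) (homf G x' y')"
  by (cases F) auto

lemma obf_nfun_of [simp]: "obf (nfun_of n f) = f"
  by (cases n) auto

lemma is_Fun0_nfun_of [simp]: "is_Fun0 (nfun_of n f) \<longleftrightarrow> n = 0"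
  by (cases n) auto

lemma obf_nfun_point [simp]: "obf (nfun_point n A a) = (\<lambda>_. a)"
  by (cases n) auto

lemma is_Fun0_nfun_point [simp]: "is_Fun0 (nfun_point n A a) \<longleftrightarrow> n = 0"
  by (cases n) auto

lemma Ob_ncat_prod [simp]: "Ob (ncat_prod n A B) = Ob A \<times> Ob B"
  by (cases n) auto

lemma is_nfun_is_Fun0: "is_nfun n A B F \<Longrightarrow> is_Fun0 F \<longleftrightarrow> n = 0"
  by (cases n) auto

lemma is_nfun_obf: "is_nfun n A B F \<Longrightarrow> x \<in> Ob A \<Longrightarrow> obf F x \<in> Ob B"
  by (cases n) auto

lemma nfun_eq_sym: "nfun_eq n A F G \<Longrightarrow> nfun_eq n A G F"
  by (induction n arbitrary: A F G) auto

lemma nfun_eq_trans: "nfun_eq n A F G \<Longrightarrow> nfun_eq n A G H \<Longrightarrow> nfun_eq n A F H"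
  by (induction n arbitrary: A F G H) (auto; blast)+

lemma nfun_eq_id_left: "is_nfun n A B F \<Longrightarrow> nfun_eq n A (nfun_comp (nfun_id n) F) F"
proof (induction n arbitrary: A B F)
  case (Suc n)
  then show ?case by simp blast
qed auto

lemma nfun_eq_id_right:
  "nfun_eq n (ncat_prod n A B) (nfun_comp F (nfun_prod (nfun_id n) (nfun_id n))) F"
  by (induction n arbitrary: A B F) auto

lemma strict_ncatD:
  assumes "strict_ncat (Suc n) A"
  shows strict_ncat_Hom: "x \<in> Ob A \<Longrightarrow> y \<in> Ob A \<Longrightarrow> strict_ncat n (Hom A x y)"
    and strict_ncat_Comp: "\<lbrakk>x \<in> Ob A; y \<in> Ob A; z \<in> Ob A\<rbrakk> \<Longrightarrow>
        is_nfun n (ncat_prod n (Hom A x y) (Hom A y z)) (Hom A x z) (Comp A x y z)"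
    and strict_ncat_Ident: "x \<in> Ob A \<Longrightarrow> Ident A x \<in> Ob (Hom A x x)"
    and strict_ncat_assoc: "\<lbrakk>w \<in> Ob A; x \<in> Ob A; y \<in> Ob A; z \<in> Ob A\<rbrakk> \<Longrightarrow>
        nfun_eq n (ncat_prod n (ncat_prod n (Hom A w x) (Hom A x y)) (Hom A y z)) (nfun_comp (Comp A w y z) (nfun_prod (Comp A w x y) (nfun_id n))) (nfun_comp (nfun_comp (Comp A w x z) (nfun_prod (nfun_id n) (Comp A x y z))) (nfun_of n (\<lambda>((f, g), h). (f, (g, h)))))"
    and strict_ncat_unit_left: "x \<in> Ob A \<Longrightarrow> y \<in> Ob A \<Longrightarrow>
      nfun_eq n (Hom A x y)
          (nfun_comp (Comp A x x y)
             (nfun_comp (nfun_prod (nfun_point n (Hom A x x) (Ident A x)) (nfun_id n))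
               (nfun_of n (\<lambda>f. (f, f)))))
          (nfun_id n)"
    and strict_ncat_unit_right: "x \<in> Ob A \<Longrightarrow> y \<in> Ob A \<Longrightarrow>
      nfun_eq n (Hom A x y)
          (nfun_comp (Comp A x y y)
             (nfun_comp (nfun_prod (nfun_id n) (nfun_point n (Hom A y y) (Ident A y)))
               (nfun_of n (\<lambda>f. (f, f)))))
          (nfun_id n)"
  using assms unfolding strict_ncat.simps by blast+

lemma strict_ngpdD:
  assumes "strict_ngpd (Suc n) A"
  shows strict_ngpd_ncat: "strict_ncat (Suc n) A"
    and strict_ngpd_Hom: "x \<in> Ob A \<Longrightarrow> y \<in> Ob A \<Longrightarrow> strict_ngpd n (Hom A x y)"
    and strict_ngpd_groupoid: "is_groupoid (tau1 A)"
  using assms unfolding strict_ngpd.simps by blast+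

section \<open>Full subcategories\<close>

definition full_sub :: "'a set \<Rightarrow> 'a ncat \<Rightarrow> 'a ncat" where
  "full_sub S A = CatS S (Hom A) (Comp A) (Ident A)"

lemma full_sub_simps [simp]:
  "Ob (full_sub S A) = S" "Hom (full_sub S A) = Hom A" "Comp (full_sub S A) = Comp A"
  "Ident (full_sub S A) = Ident A" "\<not> is_Cat0 (full_sub S A)"
  by (simp_all add: full_sub_def)

lemma ncat_prod_full_sub:
  "ncat_prod (Suc n) (full_sub S A) (full_sub T B) = full_sub (S \<times> T) (ncat_prod (Suc n) A B)"
  by (simp add: full_sub_def)

lemma nfun_point_full_sub: "nfun_point n (full_sub S A) a = nfun_point n A a"
  by (cases n) simp_all

lemma nfun_eq_full_sub: "nfun_eq (Suc n) A F G \<Longrightarrow> S \<subseteq> Ob A \<Longrightarrow> nfun_eq (Suc n) (full_sub S A) F G"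
  by auto

lemma is_nfun_full_sub:
  "\<lbrakk>is_nfun (Suc n) A B F; S \<subseteq> Ob A; obf F ` S \<subseteq> T\<rbrakk> \<Longrightarrow>
        is_nfun (Suc n) (full_sub S A) (full_sub T B) F"
  by (simp add: subset_iff)

lemma strict_ncat_full_sub:
  "strict_ncat (Suc n) A \<Longrightarrow> S \<subseteq> Ob A \<Longrightarrow> strict_ncat (Suc n) (full_sub S A)"
  by (simp add: subset_iff)

lemma is_groupoid_class_cat_subset:
  "is_groupoid (class_cat S P c e) \<Longrightarrow> T \<subseteq> S \<Longrightarrow> is_groupoid (class_cat T P c e)"
  unfolding is_groupoid_def is_category_def is_inverse_def class_cat_def by (simp add: subset_iff)

lemma strict_ngpd_full_sub:
  assumes "strict_ngpd (Suc n) A" "S \<subseteq> Ob A"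
  shows "strict_ngpd (Suc n) (full_sub S A)"
proof -
  have "is_groupoid (tau1 (full_sub S A))"
    unfolding tau1_def full_sub_simps
    by (rule is_groupoid_class_cat_subset[OF strict_ngpd_groupoid[OF assms(1), unfolded tau1_def] assms(2)])
  then show ?thesis
    using strict_ncat_full_sub[OF strict_ngpd_ncat[OF assms(1)] assms(2)] strict_ngpd_Hom[OF assms(1)] assms(2)
    unfolding strict_ngpd.simps full_sub_simps by blast
qed

section \<open>Isomorphism classes\<close>

abbreviation iso_rel :: "('o, 'm) small_cat \<Rightarrow> ('o \<times> 'o) set" where
  "iso_rel K \<equiv> {(x, y). x \<in> Obj K \<and> y \<in> Obj K \<and> (\<exists>f\<in>Mor K x y. \<exists>g\<in>Mor K y x. is_inverse K x y f g)}"

lemma iso_classes_equiv: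
  assumes K: "is_category K"
  shows "equiv (Obj K) (iso_rel K)"
proof (rule equivI)
  show "refl_on (Obj K) (iso_rel K)"
    using K unfolding refl_on_def is_category_def is_inverse_def by blast
  show "sym (iso_rel K)"
    unfolding sym_def is_inverse_def by blast
  show "trans (iso_rel K)"
  proof (rule transI)
    fix x y z
    assume "(x, y) \<in> iso_rel K"
      "(y, z) \<in> iso_rel K"
    then obtain f g f' g' where o: "x \<in> Obj K" "y \<in> Obj K" "z \<in> Obj K"
      and m: "f \<in> Mor K x y" "g \<in> Mor K y x" "f' \<in> Mor K y z" "g' \<in> Mor K z y"
      and i: "is_inverse K x y f g" "is_inverse K y z f' g'" by blast
    have assoc: "Cmp K w y z (Cmp K w x y a b) c = Cmp K w x z a (Cmp K x y z b c)"
      if "w \<in> Obj K" "x \<in> Obj K" "y \<in> Obj K" "z \<in> Obj K" "a \<in> Mor K w x" "b \<in> Mor K x y" "c \<in> Mor K y z"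
      for w x y z a b c using K that unfolding is_category_def by blast
    have comp: "Cmp K x y z a b \<in> Mor K x z"
      if "x \<in> Obj K" "y \<in> Obj K" "z \<in> Obj K" "a \<in> Mor K x y" "b \<in> Mor K y z"
      for x y z a b using K that unfolding is_category_def by blast
    have idl: "Cmp K x x y (Idt K x) a = a" if "x \<in> Obj K" "y \<in> Obj K" "a \<in> Mor K x y" for x y a
      using K that unfolding is_category_def by blast
    \<comment> \<open>Stated for arbitrary arrows in order to yield both composites, the second by
      exchanging \<open>x\<close> with \<open>z\<close> and reversing the order of the
      arrows.\<close>
    have inv: "Cmp K x z x (Cmp K x y z f f') (Cmp K z y x g' g) = Idt K x"
      if o: "x \<in> Obj K" "y \<in> Obj K" "z \<in> Obj K"
      and m: "f \<in> Mor K x y" "g \<in> Mor K y x" "f' \<in> Mor K y z" "g' \<in> Mor K z y"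
      and i: "Cmp K x y x f g = Idt K x" "Cmp K y z y f' g' = Idt K y" for x y z f g f' g'
    proof -
      have "Cmp K x z x (Cmp K x y z f f') (Cmp K z y x g' g) = Cmp K x y x f (Cmp K y z x f' (Cmp K z y x g' g))"
        using assoc o m comp by simp
      also have "Cmp K y z x f' (Cmp K z y x g' g) = Cmp K y y x (Cmp K y z y f' g') g"
        using assoc o m by simp
      also have "\<dots> = g" using i idl o m by simp
      finally show ?thesis using i by simp
    qed
    have "is_inverse K x z (Cmp K x y z f f') (Cmp K z y x g' g)"
      using inv[OF o m] inv[OF o(3,2,1) m(4,3,2,1)] i unfolding is_inverse_def by simp
    then show "(x, z) \<in> iso_rel K"
      using comp o m by blast
  qed
qed auto

lemma block_iso_classes:
  assumes K: "is_category K" and X: "X \<in> iso_classes K"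
  shows "block (iso_classes K) X = X"
  unfolding block_def
proof (rule the_equality)
  fix Y assume Y: "Y \<in> iso_classes K \<and> X \<subseteq> Y"
  have "X \<noteq> {}" using X iso_classes_equiv[OF K] in_quotient_imp_non_empty unfolding iso_classes_def by blast
  then show "Y = X"
    using quotient_disj[OF iso_classes_equiv[OF K], of X Y] X Y unfolding iso_classes_def by blast
qed (use X in simp)

lemma iso_classes_single:
  assumes K: "is_category K" and o: "Obj K = {u}"
  shows "iso_classes K = {{u}}"
proof -
  have "u \<in> iso_rel K `` {u}" by (rule equiv_class_self[OF iso_classes_equiv[OF K]]) (simp add: o)
  moreover have "iso_rel K `` {u} \<subseteq> {u}" using o by auto
  ultimately have "iso_rel K `` {u} = {u}" by blast
  then show ?thesis unfolding iso_classes_def o[symmetric] quotient_def using o by simp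
qed

lemma ncat_pi0_tau1: "\<not> is_Cat0 A \<Longrightarrow> ncat_pi0 A = iso_classes (tau1 A)"
  by (cases A) (auto simp: tau1_def)

lemma strict_ngpd_not_Cat0: "strict_ngpd (Suc n) A \<Longrightarrow> \<not> is_Cat0 A"
  by simp

lemma strict_ngpd_is_category: "strict_ngpd (Suc n) A \<Longrightarrow> is_category (tau1 A)"
  by (simp add: is_groupoid_def)

lemma block_singletons: "x \<in> S \<Longrightarrow> block ((\<lambda>x. {x}) ` S) {x} = {x}"
  unfolding block_def by (rule the_equality) auto

lemma block_ncat_pi0:
  assumes "strict_ngpd n A" "X \<in> ncat_pi0 A"
  shows "block (ncat_pi0 A) X = X"
proof (cases n)
  case 0
  then obtain S where "A = Cat0 S" using assms(1) by (cases A) auto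
  then show ?thesis using assms(2) by (auto simp: block_singletons)
next
  case (Suc m)
  then show ?thesis
    using assms block_iso_classes[OF strict_ngpd_is_category[of m A], of X] ncat_pi0_tau1[OF strict_ngpd_not_Cat0[of m A]] by simp
qed

lemma ncat_pi0_single:
  assumes "strict_ngpd (Suc n) A" "Ob A = {u}"
  shows "ncat_pi0 A = {{u}}"
  using iso_classes_single[OF strict_ngpd_is_category[OF assms(1)], of u] ncat_pi0_tau1[OF strict_ngpd_not_Cat0[OF assms(1)]] assms(2)
  by (simp add: tau1_def class_cat_def)

section \<open>One-object categories\<close>

definition one_obj :: "'a \<Rightarrow> 'a ncat \<Rightarrow> ('a \<times> 'a, 'a) nfun \<Rightarrow> 'a \<Rightarrow> 'a ncat" where
  "one_obj c H \<mu> i = CatS {c} (\<lambda>_ _. H) (\<lambda>_ _ _. \<mu>) (\<lambda>_. i)"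

lemma one_obj_simps [simp]:
  "Ob (one_obj c H \<mu> i) = {c}" "Hom (one_obj c H \<mu> i) x y = H"
  "Comp (one_obj c H \<mu> i) x y z = \<mu>" "Ident (one_obj c H \<mu> i) x = i" "\<not> is_Cat0 (one_obj c H \<mu> i)"
  by (simp_all add: one_obj_def)

lemma strict_ncat_one_obj:
  assumes "strict_ncat n H" "is_nfun n (ncat_prod n H H) H \<mu>" "i \<in> Ob H"
    and "nfun_eq n (ncat_prod n (ncat_prod n H H) H)
          (nfun_comp \<mu> (nfun_prod \<mu> (nfun_id n)))
          (nfun_comp (nfun_comp \<mu> (nfun_prod (nfun_id n) \<mu>)) (nfun_of n (\<lambda>((f, g), h). (f, (g, h)))))"
    and "nfun_eq n H
          (nfun_comp \<mu> (nfun_comp (nfun_prod (nfun_point n H i) (nfun_id n)) (nfun_of n (\<lambda>f. (f, f)))))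
          (nfun_id n)"
    and "nfun_eq n H
          (nfun_comp \<mu> (nfun_comp (nfun_prod (nfun_id n) (nfun_point n H i)) (nfun_of n (\<lambda>f. (f, f)))))
          (nfun_id n)"
  shows "strict_ncat (Suc n) (one_obj c H \<mu> i)"
  using assms unfolding strict_ncat.simps one_obj_simps by (intro conjI ballI) (assumption | simp)+

lemma tau1_one_obj: "tau1 (one_obj c H \<mu> i) = class_cat {c} (\<lambda>_ _. ncat_pi0 H) (\<lambda>_ _ _. obf \<mu>) (\<lambda>_. i)"
  by (simp add: tau1_def one_obj_def)

lemma is_groupoid_one_obj_trivial:
  assumes "ncat_pi0 H = {{u}}" "obf \<mu> (u, u) = u" "i = u"
  shows "is_groupoid (tau1 (one_obj c H \<mu> i))"
proof -
  have "block {{u}} {u} = {u}" unfolding block_def by (rule the_equality) auto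
  then show ?thesis
    unfolding tau1_one_obj assms(1) assms(3)
    by (simp add: is_groupoid_def is_category_def is_inverse_def class_cat_def assms(2))
qed

section \<open>Restriction to one object and one 1-cell\<close>

text \<open>The quotient map to \<open>Q\<close> is defined only on 3-cells between endomorphisms of
  the 1-cell \<open>Ident C c\<close>. Discarding the other objects and 1-cells makes it a functor
  defined everywhere, while the cells in dimensions 2 and 3 over this 1-cell are untouched.\<close>

definition base3 :: "'a ncat \<Rightarrow> 'a \<Rightarrow> 'a ncat" where
  "base3 C c = one_obj c (full_sub {Ident C c} (Hom C c c)) (Comp C c c c) (Ident C c)"

text \<open>This closure property, a consequence of the strict unit law, lets the single 1-cell
  \<open>Ident C c\<close> span a subcategory.\<close>

lemma strict_ncat_Comp_ident:
  assumes "strict_ncat (Suc n) C" "c \<in> Ob C"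
  shows "obf (Comp C c c c) (Ident C c, Ident C c) = Ident C c"
  using strict_ncat_unit_left[OF assms(1) assms(2,2)] strict_ncat_Ident[OF assms] by (cases n) auto

lemma strict_ncat_base3:
  assumes C: "strict_ncat (Suc (Suc n)) C" and c: "c \<in> Ob C"
  shows "strict_ncat (Suc (Suc n)) (base3 C c)"
proof -
  let ?H = "Hom C c c" and ?u = "Ident C c"
  have u: "?u \<in> Ob ?H" using strict_ncat_Ident[OF C c] .
  note fs = nfun_eq_full_sub is_nfun_full_sub
  note P = ncat_prod_full_sub[of n]
  show ?thesis
    unfolding base3_def
  proof (rule strict_ncat_one_obj; (unfold P nfun_point_full_sub)?)
    show "strict_ncat (Suc n) (full_sub {?u} ?H)"
      by (rule strict_ncat_full_sub[OF strict_ncat_Hom[OF C c c]]) (use u in simp)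
    show "is_nfun (Suc n) (full_sub ({?u} \<times> {?u}) (ncat_prod (Suc n) ?H ?H)) (full_sub {?u} ?H) (Comp C c c c)"
      by (rule is_nfun_full_sub[OF strict_ncat_Comp[OF C c c c]])
        (use u strict_ncat_Comp_ident[OF C c] in \<open>simp_all del: ncat_prod.simps\<close>)
    show "?u \<in> Ob (full_sub {?u} ?H)" by simp
  qed (rule nfun_eq_full_sub, rule strict_ncat_assoc[OF C c c c c] strict_ncat_unit_left[OF C c c] strict_ncat_unit_right[OF C c c],
      simp add: u del: ncat_prod.simps)+
qed

lemma strict_ngpd_one_obj:
  assumes "strict_ncat (Suc n) (one_obj c H \<mu> i)" "strict_ngpd n H" "is_groupoid (tau1 (one_obj c H \<mu> i))"
  shows "strict_ngpd (Suc n) (one_obj c H \<mu> i)"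
  using assms unfolding strict_ngpd.simps one_obj_simps by blast

lemma strict_ngpd_base3:
  assumes C: "strict_ngpd (Suc (Suc n)) C" and c: "c \<in> Ob C"
  shows "strict_ngpd (Suc (Suc n)) (base3 C c)"
proof -
  note C' = strict_ngpd_ncat[OF C]
  have H: "strict_ngpd (Suc n) (full_sub {Ident C c} (Hom C c c))"
    by (rule strict_ngpd_full_sub[OF strict_ngpd_Hom[OF C c c]]) (use strict_ncat_Ident[OF C' c] in simp)
  show ?thesis
    unfolding base3_def
    by (rule strict_ngpd_one_obj[OF strict_ncat_base3[OF C' c, unfolded base3_def] H
          is_groupoid_one_obj_trivial[OF ncat_pi0_single[OF H full_sub_simps(1)] strict_ncat_Comp_ident[OF C' c] refl]])
qed

lemma is_nfun_base3_incl:
  assumes C: "strict_ncat (Suc (Suc n)) C" and c: "c \<in> Ob C"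
  shows "is_nfun (Suc (Suc n)) (base3 C c) C (nfun_id (Suc (Suc n)))"
proof -
  let ?H = "Hom C c c" and ?u = "Ident C c"
  have u: "?u \<in> Ob ?H" using strict_ncat_Ident[OF C c] .
  have H: "strict_ncat (Suc n) ?H" using strict_ncat_Hom[OF C c c] .
  have id_nfun: "is_nfun m A A (nfun_id m)" if "strict_ncat m A" for m and A :: "'a ncat"
    using that
  proof (induction m arbitrary: A)
    case (Suc m)
    have "nfun_eq m (ncat_prod m (Hom A x y) (Hom A y z)) (nfun_comp (nfun_id m) (Comp A x y z))
        (nfun_comp (Comp A x y z) (nfun_prod (nfun_id m) (nfun_id m)))"
      if "x \<in> Ob A" "y \<in> Ob A" "z \<in> Ob A" for x y z
      by (rule nfun_eq_trans[OF nfun_eq_id_left[OF strict_ncat_Comp[OF Suc.prems that]] nfun_eq_sym[OF nfun_eq_id_right]])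
    then show ?case using Suc.IH strict_ncat_Hom[OF Suc.prems] by simp
  qed auto
  have incl: "is_nfun (Suc m) (full_sub S A) A F" if "is_nfun (Suc m) A A F" "S \<subseteq> Ob A" for m S F and A :: "'a ncat"
    using that by (simp add: subset_iff) blast
  have P: "ncat_prod (Suc n) (full_sub {?u} ?H) (full_sub {?u} ?H) = full_sub ({?u} \<times> {?u}) (ncat_prod (Suc n) ?H ?H)"
    by (rule ncat_prod_full_sub)
  have i: "is_nfun (Suc n) (full_sub {?u} ?H) ?H (nfun_id (Suc n))"
    by (rule incl[OF id_nfun[OF H]]) (use u in simp)
  have e: "nfun_eq (Suc n) (full_sub ({?u} \<times> {?u}) (ncat_prod (Suc n) ?H ?H)) (nfun_comp (nfun_id (Suc n)) (Comp C c c c))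
      (nfun_comp (Comp C c c c) (nfun_prod (nfun_id (Suc n)) (nfun_id (Suc n))))"
    by (rule nfun_eq_full_sub[OF nfun_eq_trans[OF nfun_eq_id_left[OF strict_ncat_Comp[OF C c c c]] nfun_eq_sym[OF nfun_eq_id_right]]])
      (use u in \<open>simp del: ncat_prod.simps\<close>)
  show ?thesis
    unfolding is_nfun.simps(2)[of "Suc n"] nfun_of.simps(2)[of "Suc n"] nfun.sel base3_def one_obj_simps
    using c i e unfolding P by simp
qed

section \<open>Strictly symmetric categorical groups\<close>

text \<open>Inserting units into the interchange law in two ways turns \<open>q x y\<close> into
  \<open>p x y\<close> and into \<open>p y x\<close>. Everything is an equation, so strictness
  carries over to the conclusion.\<close>

lemma eckmann_hilton:
  assumes "x \<in> A" "y \<in> A" "i \<in> A"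
    and unit: "\<And>x. x \<in> A \<Longrightarrow> p i x = x" "\<And>x. x \<in> A \<Longrightarrow> p x i = x" "\<And>x. x \<in> A \<Longrightarrow> q i x = x" "\<And>x. x \<in> A \<Longrightarrow> q x i = x"
    and inter: "\<And>x x' y y'. \<lbrakk>x \<in> A; x' \<in> A; y \<in> A; y' \<in> A\<rbrakk> \<Longrightarrow>
        q (p x y) (p x' y') = p (q x x') (q y y')"
  shows "q x y = p x y" "p x y = p y x"
proof -
  show "q x y = p x y" using inter[of x i i y] assms by simp
  have "q x y = p y x" using inter[of i y x i] assms by simp
  then show "p x y = p y x" using \<open>q x y = p x y\<close> by simp
qed

text \<open>A groupoid with object set \<open>Obs\<close> and set of arrows \<open>Arr\<close> that carries a strictly associative,
  unital and commutative tensor product on objects and arrows, and whose objects are invertible up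
  to isomorphism.\<close>

locale symmetric_2_group =
  fixes Obs :: "'o set" and Arr :: "'x set" and src tgt :: "'x \<Rightarrow> 'o" and idn :: "'o \<Rightarrow> 'x"
    and cmp :: "'x \<Rightarrow> 'x \<Rightarrow> 'x" and ten :: "'x \<Rightarrow> 'x \<Rightarrow> 'x" and tob :: "'o \<Rightarrow> 'o \<Rightarrow> 'o" and e :: 'o
  assumes src: "f \<in> Arr \<Longrightarrow> src f \<in> Obs" and tgt: "f \<in> Arr \<Longrightarrow> tgt f \<in> Obs"
    and idn: "a \<in> Obs \<Longrightarrow> idn a \<in> Arr" "a \<in> Obs \<Longrightarrow> src (idn a) = a" "a \<in> Obs \<Longrightarrow> tgt (idn a) = a"
    and cmp: "\<lbrakk>f \<in> Arr; g \<in> Arr; tgt f = src g\<rbrakk> \<Longrightarrow> cmp f g \<in> Arr"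
    and cmp_assoc: "\<lbrakk>f \<in> Arr; g \<in> Arr; h \<in> Arr; tgt f = src g; tgt g = src h\<rbrakk> \<Longrightarrow>
        cmp (cmp f g) h = cmp f (cmp g h)"
    and cmp_unit: "f \<in> Arr \<Longrightarrow> cmp (idn (src f)) f = f" "f \<in> Arr \<Longrightarrow> cmp f (idn (tgt f)) = f"
    and cmp_inv: "f \<in> Arr \<Longrightarrow> \<exists>g\<in>Arr. src g = tgt f \<and> tgt g = src f \<and> cmp f g = idn (src f) \<and> cmp g f = idn (tgt f)"
    and tob: "a \<in> Obs \<Longrightarrow> b \<in> Obs \<Longrightarrow> tob a b \<in> Obs" "e \<in> Obs"
    and ten: "f \<in> Arr \<Longrightarrow> g \<in> Arr \<Longrightarrow> ten f g \<in> Arr"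
    and ten_src: "f \<in> Arr \<Longrightarrow> g \<in> Arr \<Longrightarrow> src (ten f g) = tob (src f) (src g)"
    and ten_tgt: "f \<in> Arr \<Longrightarrow> g \<in> Arr \<Longrightarrow> tgt (ten f g) = tob (tgt f) (tgt g)"
    and ten_idn: "a \<in> Obs \<Longrightarrow> b \<in> Obs \<Longrightarrow> ten (idn a) (idn b) = idn (tob a b)"
    and ten_cmp: "\<lbrakk>f \<in> Arr; g \<in> Arr; f' \<in> Arr; g' \<in> Arr; tgt f = src g; tgt f' = src g'\<rbrakk> \<Longrightarrow>
        ten (cmp f g) (cmp f' g') = cmp (ten f f') (ten g g')"
    and ten_assoc: "\<lbrakk>f \<in> Arr; g \<in> Arr; h \<in> Arr\<rbrakk> \<Longrightarrow> ten (ten f g) h = ten f (ten g h)"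
    and ten_comm: "f \<in> Arr \<Longrightarrow> g \<in> Arr \<Longrightarrow> ten f g = ten g f"
    and ten_unit: "f \<in> Arr \<Longrightarrow> ten (idn e) f = f"
    and ob_inv: "a \<in> Obs \<Longrightarrow> \<exists>b\<in>Obs. \<exists>\<phi>\<in>Arr. src \<phi> = tob a b \<and> tgt \<phi> = e"
begin

lemma tob_unit: "a \<in> Obs \<Longrightarrow> tob e a = a"
  using ten_src[of "idn e" "idn a"] idn tob(2) ten_unit by simp

text \<open>The quotient of the arrows by \<open>stably_eq\<close> is an abelian group in which both composition and
  tensor product become the multiplication.\<close>

definition stably_eq :: "'x \<Rightarrow> 'x \<Rightarrow> bool" where
  "stably_eq f g \<longleftrightarrow> f \<in> Arr \<and> g \<in> Arr \<and> (\<exists>a\<in>Obs. \<exists>b\<in>Obs. ten f (idn a) = ten g (idn b))"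

lemma stably_eq_refl: "f \<in> Arr \<Longrightarrow> stably_eq f f"
  using tob(2) by (auto simp: stably_eq_def)

lemma stably_eq_sym: "stably_eq f g \<Longrightarrow> stably_eq g f"
  unfolding stably_eq_def by metis

lemma ten_idn_shift:
  assumes "f \<in> Arr" "a \<in> Obs" "b \<in> Obs" shows "ten (ten f (idn a)) (idn b) = ten f (idn (tob a b))"
  using assms by (simp add: ten_assoc idn ten_idn)

lemma tob_comm: "a \<in> Obs \<Longrightarrow> b \<in> Obs \<Longrightarrow> tob a b = tob b a"
  using ten_src[of "idn a" "idn b"] ten_src[of "idn b" "idn a"] ten_comm[of "idn a" "idn b"] idn by simp

lemma stably_eq_trans:
  assumes "stably_eq f g" "stably_eq g h" shows "stably_eq f h"
proof -
  obtain a b where ab: "f \<in> Arr" "g \<in> Arr" "a \<in> Obs" "b \<in> Obs" "ten f (idn a) = ten g (idn b)"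
    using assms(1) by (auto simp: stably_eq_def)
  obtain c d where cd: "h \<in> Arr" "c \<in> Obs" "d \<in> Obs" "ten g (idn c) = ten h (idn d)"
    using assms(2) by (auto simp: stably_eq_def)
  have "ten f (idn (tob a c)) = ten (ten g (idn b)) (idn c)"
    using ab cd ten_idn_shift[of f a c] by simp
  also have "\<dots> = ten g (idn (tob c b))" using ab cd ten_idn_shift[of g b c] tob_comm[of b c] by simp
  also have "\<dots> = ten (ten h (idn d)) (idn b)" using ab cd ten_idn_shift[of g c b] by simp
  also have "\<dots> = ten h (idn (tob d b))" using ab cd ten_idn_shift[of h d b] by simp
  finally show ?thesis using ab cd tob unfolding stably_eq_def by blast
qed

lemma ten_left_comm: "\<lbrakk>f \<in> Arr; g \<in> Arr; h \<in> Arr\<rbrakk> \<Longrightarrow> ten f (ten g h) = ten g (ten f h)"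
  using ten_assoc[of f g h] ten_assoc[of g f h] ten_comm[of f g] by simp

lemma stably_eq_ten:
  assumes "stably_eq f f'" "stably_eq g g'" shows "stably_eq (ten f g) (ten f' g')"
proof -
  obtain a b where ab: "f \<in> Arr" "f' \<in> Arr" "a \<in> Obs" "b \<in> Obs" "ten f (idn a) = ten f' (idn b)"
    using assms(1) by (auto simp: stably_eq_def)
  obtain c d where cd: "g \<in> Arr" "g' \<in> Arr" "c \<in> Obs" "d \<in> Obs" "ten g (idn c) = ten g' (idn d)"
    using assms(2) by (auto simp: stably_eq_def)
  have sh: "ten (ten f g) (idn (tob a c)) = ten (ten f (idn a)) (ten g (idn c))"
    if "f \<in> Arr" "g \<in> Arr" "a \<in> Obs" "c \<in> Obs" for f g a c
    using that by (simp add: ten_idn[symmetric] idn ten ten_assoc ten_left_comm[of _ g])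
  have "ten (ten f g) (idn (tob a c)) = ten (ten f' g') (idn (tob b d))"
    using sh[of f g a c] sh[of f' g' b d] ab cd by simp
  then show ?thesis using ab cd tob ten unfolding stably_eq_def by blast
qed

text \<open>With \<open>b\<close> the middle object, interchange splits the composite tensored with
  \<open>idn b\<close> into \<open>ten f (idn b)\<close> followed by \<open>ten g (idn b)\<close>.
  Strict commutativity replaces the latter by \<open>ten (idn b) g\<close>, and interchange then
  gives \<open>ten f g\<close>. A nontrivial braiding would break this step.\<close>

lemma stably_eq_cmp:
  assumes "f \<in> Arr" "g \<in> Arr" "tgt f = src g"
  shows "stably_eq (cmp f g) (ten f g)"
proof -
  let ?b = "tgt f"
  have b: "?b \<in> Obs" and ib: "idn ?b \<in> Arr" "src (idn ?b) = ?b" "tgt (idn ?b) = ?b"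
    using tgt[OF assms(1)] idn[OF tgt[OF assms(1)]] by simp_all
  have "ten (cmp f g) (cmp (idn ?b) (idn ?b)) = cmp (ten f (idn ?b)) (ten g (idn ?b))"
    using assms ib by (intro ten_cmp) auto
  also have "ten g (idn ?b) = ten (idn ?b) g" using assms ib ten_comm by simp
  also have "cmp (ten f (idn ?b)) (ten (idn ?b) g) = ten (cmp f (idn ?b)) (cmp (idn ?b) g)"
    using assms ib by (intro ten_cmp[symmetric]) auto
  also have "\<dots> = ten f g" using cmp_unit(2)[OF assms(1)] cmp_unit(1)[OF assms(2)] assms(3) by simp
  also have "\<dots> = ten (ten f g) (idn e)"
    using ten_comm[of "ten f g" "idn e"] ten_unit[of "ten f g"] ten[of f g] assms idn tob(2) by simp
  finally have "ten (cmp f g) (idn ?b) = ten (ten f g) (idn e)"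
    using cmp_unit(1)[OF ib(1)] ib by simp
  then show ?thesis unfolding stably_eq_def using assms b tob(2) cmp ten by blast
qed

lemma stably_eq_idn: "a \<in> Obs \<Longrightarrow> stably_eq (idn a) (idn e)"
  unfolding stably_eq_def using idn tob ten_unit[of "idn a"] ten_comm[of "idn a" "idn e"] by (metis)

lemma stably_eq_inverse:
  assumes "f \<in> Arr" shows "\<exists>g\<in>Arr. stably_eq (ten g f) (idn e)"
proof -
  obtain g where g: "g \<in> Arr" "src g = tgt f" "tgt g = src f" "cmp g f = idn (tgt f)"
    using cmp_inv[OF assms] by blast
  have "stably_eq (ten g f) (cmp g f)" using stably_eq_cmp[of g f] g assms stably_eq_sym by simp
  then show ?thesis using g stably_eq_idn[OF tgt[OF assms]] stably_eq_trans by metis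
qed

text \<open>This is why pi_3 embeds in the quotient. Comparing sources gives the same object
  \<open>a\<close> on both sides; tensoring with a weak inverse of \<open>a\<close> replaces it by
  an object isomorphic to \<open>e\<close>, and conjugation with that isomorphism removes the
  identity factor.\<close>

lemma stably_eq_automorphisms:
  assumes fg: "stably_eq f g" and f: "src f = e" "tgt f = e" and g: "src g = e" "tgt g = e"
  shows "f = g"
proof -
  obtain a b where ab: "f \<in> Arr" "g \<in> Arr" "a \<in> Obs" "b \<in> Obs" "ten f (idn a) = ten g (idn b)"
    using fg by (auto simp: stably_eq_def)
  have "a = b" using ab f g ten_src[of f "idn a"] ten_src[of g "idn b"] idn tob_unit by metis
  obtain c \<phi> where c: "c \<in> Obs" "\<phi> \<in> Arr" "src \<phi> = tob a c" "tgt \<phi> = e" using ob_inv[OF ab(3)] by blast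
  obtain \<psi> where \<psi>: "\<psi> \<in> Arr" "src \<psi> = e" "tgt \<psi> = tob a c" "cmp \<psi> \<phi> = idn e"
    using cmp_inv[OF c(2)] c by metis
  let ?x = "tob a c"
  have x: "?x \<in> Obs" using ab c tob by simp
  \<comment> \<open>By interchange, both \<open>ten h (idn ?x)\<close> followed by
    \<open>\<phi>\<close> and \<open>\<phi>\<close> followed by \<open>h\<close> equal
    \<open>ten h \<phi>\<close>.\<close>
  have conj: "cmp \<psi> (cmp (ten h (idn ?x)) \<phi>) = h" if h: "h \<in> Arr" "src h = e" "tgt h = e" for h
  proof -
    have "cmp (ten h (idn ?x)) \<phi> = cmp (ten h (idn ?x)) (ten (idn e) \<phi>)" using ten_unit c by simp
    also have "\<dots> = ten (cmp h (idn e)) (cmp (idn ?x) \<phi>)"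
      using h x c idn tob by (intro ten_cmp[symmetric]) auto
    also have "\<dots> = ten h \<phi>" using h c cmp_unit by metis
    also have "\<dots> = ten (cmp (idn e) h) (cmp \<phi> (idn e))" using h c cmp_unit by metis
    also have "\<dots> = cmp (ten (idn e) \<phi>) (ten h (idn e))"
      using h x c idn tob by (intro ten_cmp) auto
    also have "\<dots> = cmp \<phi> h" using ten_unit h c ten_comm[of h "idn e"] idn tob by simp
    finally have "cmp \<psi> (cmp (ten h (idn ?x)) \<phi>) = cmp (cmp \<psi> \<phi>) h"
      using cmp_assoc[of \<psi> \<phi> h] h c \<psi> by simp
    then show ?thesis using \<psi> h cmp_unit(1)[of h] by simp
  qed
  have "ten f (idn ?x) = ten g (idn ?x)"
    using ten_idn_shift[of f a c] ten_idn_shift[of g b c] ab c \<open>a = b\<close> by simp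
  then show ?thesis using conj[OF ab(1) f] conj[OF ab(2) g] by metis
qed

text \<open>The elements must have type \<open>'a\<close> for the delooping to be an
  \<open>'a ncat\<close>, so classes are replaced by chosen representatives, encoded by
  \<open>enc\<close>.\<close>

lemma exists_quotient_group:
  assumes enc: "inj_on (enc :: 'x \<Rightarrow> 'a) Arr"
  obtains Q :: "'a monoid" and q :: "'x \<Rightarrow> 'a" where "comm_group Q" "\<And>f. f \<in> Arr \<Longrightarrow> q f \<in> carrier Q"
    "\<And>f g. f \<in> Arr \<Longrightarrow> g \<in> Arr \<Longrightarrow> q (ten f g) = q f \<otimes>\<^bsub>Q\<^esub> q g"
    "\<And>f g. \<lbrakk>f \<in> Arr; g \<in> Arr; tgt f = src g\<rbrakk> \<Longrightarrow>
        q (cmp f g) = q f \<otimes>\<^bsub>Q\<^esub> q g"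
    "\<And>a. a \<in> Obs \<Longrightarrow> q (idn a) = \<one>\<^bsub>Q\<^esub>"
    "\<And>f g. \<lbrakk>f \<in> Arr; g \<in> Arr; src f = e; tgt f = e; src g = e; tgt g = e; q f = q g\<rbrakk> \<Longrightarrow>
        f = g"
proof -
  \<comment> \<open>The choice depends only on the predicate \<open>stably_eq f\<close>, so stably
    equal arrows receive the same representative.\<close>
  define nf where "nf f = (SOME g. stably_eq f g)" for f
  have nf: "stably_eq f (nf f)" if "f \<in> Arr" for f
    unfolding nf_def using stably_eq_refl[OF that] by (rule someI)
  have nfA: "nf f \<in> Arr" if "f \<in> Arr" for f using nf[OF that] by (simp add: stably_eq_def)
  have nf_eq: "nf f = nf g" if "stably_eq f g" for f g
  proof -
    have "stably_eq f = stably_eq g" using that stably_eq_sym stably_eq_trans by blast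
    then show ?thesis by (simp add: nf_def)
  qed
  define q where "q f = enc (nf f)" for f
  define dec where "dec = inv_into Arr enc"
  have dec: "dec (q f) = nf f" if "f \<in> Arr" for f
    using nfA[OF that] enc by (simp add: dec_def q_def)
  have q_iff: "q f = q g \<longleftrightarrow> stably_eq f g" if "f \<in> Arr" "g \<in> Arr" for f g
  proof
    assume "q f = q g"
    then have "nf f = nf g" using dec that by metis
    then show "stably_eq f g" using nf[OF that(1)] nf[OF that(2)] stably_eq_sym stably_eq_trans by metis
  qed (simp add: q_def nf_eq)
  define Q where "Q = \<lparr>carrier = q ` Arr, mult = (\<lambda>x y. q (ten (dec x) (dec y))), one = q (idn e)\<rparr>"
  have mult: "q f \<otimes>\<^bsub>Q\<^esub> q g = q (ten f g)" if "f \<in> Arr" "g \<in> Arr" for f g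
    using that nfA ten stably_eq_ten[OF nf nf] stably_eq_sym by (auto simp: Q_def dec q_iff)
  have one: "\<one>\<^bsub>Q\<^esub> = q (idn e)" and carr: "carrier Q = q ` Arr" by (simp_all add: Q_def)
  have ie: "idn e \<in> Arr" using idn tob by simp
  have "comm_group Q"
  proof (rule comm_groupI)
    fix x assume "x \<in> carrier Q"
    then obtain f where f: "f \<in> Arr" "x = q f" by (auto simp: carr)
    then show "\<one>\<^bsub>Q\<^esub> \<otimes>\<^bsub>Q\<^esub> x = x" using mult[OF ie] ten_unit by (simp add: one)
    obtain g where "g \<in> Arr" "stably_eq (ten g f) (idn e)" using stably_eq_inverse f by blast
    then show "\<exists>y\<in>carrier Q. y \<otimes>\<^bsub>Q\<^esub> x = \<one>\<^bsub>Q\<^esub>"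
      using f mult[of g f] q_iff[of "ten g f" "idn e"] ten ie by (auto simp: carr one)
  qed (use mult ten ie ten_comm ten_assoc in \<open>auto simp: carr one\<close>)
  moreover have "q f \<in> carrier Q" if "f \<in> Arr" for f using that by (simp add: carr)
  moreover have "q (cmp f g) = q f \<otimes>\<^bsub>Q\<^esub> q g" if "f \<in> Arr" "g \<in> Arr" "tgt f = src g" for f g
    using that q_iff[OF cmp[OF that] ten[OF that(1,2)]] stably_eq_cmp mult by simp
  moreover have "q (idn a) = \<one>\<^bsub>Q\<^esub>" if "a \<in> Obs" for a
    using stably_eq_idn[OF that] q_iff idn that ie by (simp add: one)
  moreover have "f = g" if "f \<in> Arr" "g \<in> Arr" "src f = e" "tgt f = e" "src g = e" "tgt g = e" "q f = q g" for f g
    using stably_eq_automorphisms[OF _ that(3-6)] q_iff[OF that(1,2)] that(7) by simp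
  ultimately show ?thesis using that[of Q q] mult by simp
qed

end

section \<open>The symmetric 2-group of 2-cells and 3-cells at an object\<close>

text \<open>Arrows of a 1-category are recorded together with their source and target, because different
  hom-sets may share elements.\<close>

definition arrows :: "'a ncat \<Rightarrow> ('a \<times> 'a \<times> 'a) set" where
  "arrows G = {(a, b, f). a \<in> Ob G \<and> b \<in> Ob G \<and> f \<in> Ob (Hom G a b)}"

definition arr_id :: "'a ncat \<Rightarrow> 'a \<Rightarrow> 'a \<times> 'a \<times> 'a" where
  "arr_id G a = (a, a, Ident G a)"

fun arr_cmp :: "'a ncat \<Rightarrow> 'a \<times> 'a \<times> 'a \<Rightarrow> 'a \<times> 'a \<times> 'a \<Rightarrow> 'a \<times> 'a \<times> 'a" where
  "arr_cmp G (a, b, f) (b', d, g) = (a, d, obf (Comp G a b d) (f, g))"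

fun arr_ten :: "('a \<times> 'a, 'a) nfun \<Rightarrow> 'a \<times> 'a \<times> 'a \<Rightarrow> 'a \<times> 'a \<times> 'a \<Rightarrow> 'a \<times> 'a \<times> 'a" where
  "arr_ten T (a, b, f) (a', b', f') = (obf T (a, a'), obf T (b, b'), obf (homf T (a, a') (b, b')) (f, f'))"

abbreviation arr_src :: "'a \<times> 'a \<times> 'a \<Rightarrow> 'a" where "arr_src \<equiv> fst"
abbreviation arr_tgt :: "'a \<times> 'a \<times> 'a \<Rightarrow> 'a" where "arr_tgt f \<equiv> fst (snd f)"

lemma strict_1cat:
  assumes G: "strict_ncat (Suc 0) G"
  shows arr_id_arrows: "a \<in> Ob G \<Longrightarrow> arr_id G a \<in> arrows G"
    and arr_cmp_arrows: "\<lbrakk>f \<in> arrows G; g \<in> arrows G; arr_tgt f = arr_src g\<rbrakk> \<Longrightarrow>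
        arr_cmp G f g \<in> arrows G"
    and arr_cmp_assoc: "\<lbrakk>f \<in> arrows G; g \<in> arrows G; h \<in> arrows G; arr_tgt f = arr_src g; arr_tgt g = arr_src h\<rbrakk> \<Longrightarrow>
        arr_cmp G (arr_cmp G f g) h = arr_cmp G f (arr_cmp G g h)"
    and arr_cmp_unit_left: "f \<in> arrows G \<Longrightarrow> arr_cmp G (arr_id G (arr_src f)) f = f"
    and arr_cmp_unit_right: "f \<in> arrows G \<Longrightarrow> arr_cmp G f (arr_id G (arr_tgt f)) = f"
proof -
  show "a \<in> Ob G \<Longrightarrow> arr_id G a \<in> arrows G"
    using strict_ncat_Ident[OF G] by (simp add: arr_id_def arrows_def)
  show "arr_cmp G f g \<in> arrows G" if "f \<in> arrows G" "g \<in> arrows G" "arr_tgt f = arr_src g"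
    using strict_ncat_Comp[OF G] that by (cases f; cases g) (fastforce simp: arrows_def)
  show "arr_cmp G (arr_cmp G f g) h = arr_cmp G f (arr_cmp G g h)"
    if as: "f \<in> arrows G" "g \<in> arrows G" "h \<in> arrows G" "arr_tgt f = arr_src g" "arr_tgt g = arr_src h"
  proof -
    obtain a b x c y d z where *: "f = (a, b, x)" "g = (b, c, y)" "h = (c, d, z)"
      using as(4,5) by (cases f; cases g; cases h) auto
    then show ?thesis using strict_ncat_assoc[OF G, of a b c d] as by (simp add: arrows_def)
  qed
  show "arr_cmp G (arr_id G (arr_src f)) f = f" if "f \<in> arrows G"
    using strict_ncat_unit_left[OF G] that by (cases f) (simp add: arrows_def arr_id_def)
  show "arr_cmp G f (arr_id G (arr_tgt f)) = f" if "f \<in> arrows G"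
    using strict_ncat_unit_right[OF G] that by (cases f) (simp add: arrows_def arr_id_def)
qed

lemma bifunctor_arrows:
  assumes T: "is_nfun (Suc 0) (ncat_prod (Suc 0) G G) G T"
  shows obf_bifunctor: "a \<in> Ob G \<Longrightarrow> b \<in> Ob G \<Longrightarrow> obf T (a, b) \<in> Ob G"
    and arr_ten_arrows: "f \<in> arrows G \<Longrightarrow> g \<in> arrows G \<Longrightarrow> arr_ten T f g \<in> arrows G"
    and arr_ten_id: "a \<in> Ob G \<Longrightarrow> b \<in> Ob G \<Longrightarrow> arr_ten T (arr_id G a) (arr_id G b) = arr_id G (obf T (a, b))"
    and arr_ten_cmp: "\<lbrakk>f \<in> arrows G; g \<in> arrows G; f' \<in> arrows G; g' \<in> arrows G; arr_tgt f = arr_src g; arr_tgt f' = arr_src g'\<rbrakk> \<Longrightarrow>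
        arr_ten T (arr_cmp G f g) (arr_cmp G f' g') = arr_cmp G (arr_ten T f f') (arr_ten T g g')"
proof -
  note T' = T[unfolded is_nfun.simps]
  show ob: "obf T (a, b) \<in> Ob G" if "a \<in> Ob G" "b \<in> Ob G" for a b using T' that by auto
  show "arr_ten T f g \<in> arrows G" if "f \<in> arrows G" "g \<in> arrows G"
  proof -
    obtain a b x where f: "f = (a, b, x)" by (cases f)
    obtain c d y where g: "g = (c, d, y)" by (cases g)
    have "obf (homf T (a, c) (b, d)) ` Ob (Hom (ncat_prod (Suc 0) G G) (a, c) (b, d)) \<subseteq> Ob (Hom G (obf T (a, c)) (obf T (b, d)))"
      using T' that f g by (simp add: arrows_def)
    then show ?thesis using that ob f g by (auto simp: arrows_def)
  qed
  show "arr_ten T (arr_id G a) (arr_id G b) = arr_id G (obf T (a, b))" if "a \<in> Ob G" "b \<in> Ob G"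
    using T' that by (simp add: arr_id_def)
  show "arr_ten T (arr_cmp G f g) (arr_cmp G f' g') = arr_cmp G (arr_ten T f f') (arr_ten T g g')"
    if as: "f \<in> arrows G" "g \<in> arrows G" "f' \<in> arrows G" "g' \<in> arrows G" "arr_tgt f = arr_src g" "arr_tgt f' = arr_src g'"
  proof -
    obtain a b x c y where fg: "f = (a, b, x)" "g = (b, c, y)" using as(5) by (cases f; cases g) auto
    obtain a' b' x' c' y' where fg': "f' = (a', b', x')" "g' = (b', c', y')" using as(6) by (cases f'; cases g') auto
    have "\<forall>x\<in>Ob (ncat_prod (Suc 0) G G). \<forall>y\<in>Ob (ncat_prod (Suc 0) G G). \<forall>z\<in>Ob (ncat_prod (Suc 0) G G).
        nfun_eq 0 (ncat_prod 0 (Hom (ncat_prod (Suc 0) G G) x y) (Hom (ncat_prod (Suc 0) G G) y z))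
          (nfun_comp (homf T x z) (Comp (ncat_prod (Suc 0) G G) x y z))
          (nfun_comp (Comp G (obf T x) (obf T y) (obf T z)) (nfun_prod (homf T x y) (homf T y z)))"
      using T unfolding is_nfun.simps by blast
    from this[rule_format, of "(a, a')" "(b, b')" "(c, c')"]
    show ?thesis using as fg fg' by (simp add: arrows_def)
  qed
qed

text \<open>At the lowest level hom-objects are sets and their classes are singletons, so an inverse
  in \<open>tau1 G\<close> is a strict inverse of arrows.\<close>

lemma strict_1gpd_inverse:
  assumes G: "strict_ngpd (Suc 0) G" and f: "f \<in> arrows G"
  shows "\<exists>g\<in>arrows G. arr_src g = arr_tgt f \<and> arr_tgt g = arr_src f \<and>
    arr_cmp G f g = arr_id G (arr_src f) \<and> arr_cmp G g f = arr_id G (arr_tgt f)"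
proof -
  obtain a b x where fx: "f = (a, b, x)" by (cases f)
  have ab: "a \<in> Ob G" "b \<in> Ob G" "x \<in> Ob (Hom G a b)" using f by (auto simp: fx arrows_def)
  have pi0: "ncat_pi0 (Hom G a b) = (\<lambda>x. {x}) ` Ob (Hom G a b)" if "a \<in> Ob G" "b \<in> Ob G" for a b
    using strict_ngpd_Hom[OF G that] by (cases "Hom G a b") auto
  have "\<exists>Y\<in>Mor (tau1 G) b a. is_inverse (tau1 G) a b {x} Y"
    using strict_ngpd_groupoid[OF G] ab pi0[OF ab(1,2)] unfolding is_groupoid_def by (simp add: tau1_def class_cat_def)
  then obtain y where y: "y \<in> Ob (Hom G b a)" "is_inverse (tau1 G) a b {x} {y}"
    using pi0[OF ab(2,1)] by (auto simp: tau1_def class_cat_def)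
  have gA: "(b, a, y) \<in> arrows G" using ab y by (simp add: arrows_def)
  have sing: "obf (Comp G a b a) (x, y) = Ident G a"
    if "block (ncat_pi0 (Hom G a a)) (obf (Comp G a b a) ` ({x} \<times> {y})) = block (ncat_pi0 (Hom G a a)) {Ident G a}"
      "(a, b, x) \<in> arrows G" "(b, a, y) \<in> arrows G" for a b x y
  proof -
    have a: "a \<in> Ob G" using that(2) by (simp add: arrows_def)
    have "obf (Comp G a b a) (x, y) \<in> Ob (Hom G a a)"
      using arr_cmp_arrows[OF strict_ngpd_ncat[OF G] that(2,3)] by (simp add: arrows_def)
    moreover have "Ident G a \<in> Ob (Hom G a a)" using strict_ncat_Ident[OF strict_ngpd_ncat[OF G] a] .
    ultimately show ?thesis using that(1) unfolding pi0[OF a a] by (simp add: block_singletons)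
  qed
  have "obf (Comp G a b a) (x, y) = Ident G a" "obf (Comp G b a b) (y, x) = Ident G b"
    using sing[of a b x y] sing[of b a y x] y(2) gA f
    by (simp_all add: is_inverse_def tau1_def class_cat_def fx)
  then show ?thesis using gA by (intro bexI[of _ "(b, a, y)"]) (simp_all add: fx arr_id_def)
qed

text \<open>All arrows are invertible, so two objects are isomorphic as soon as the hom-set from one
  to the other is inhabited.\<close>

lemma strict_1gpd_pi0:
  assumes G: "strict_ngpd (Suc 0) G"
  shows "ncat_pi0 G = (\<lambda>a. {b \<in> Ob G. Ob (Hom G a b) \<noteq> {}}) ` Ob G"
proof -
  have pi0: "ncat_pi0 (Hom G a b) = (\<lambda>x. {x}) ` Ob (Hom G a b)" if "a \<in> Ob G" "b \<in> Ob G" for a b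
    using strict_ngpd_Hom[OF G that] by (cases "Hom G a b") auto
  have O: "Obj (tau1 G) = Ob G" by (simp add: tau1_def class_cat_def)
  have iff: "(\<exists>f\<in>Mor (tau1 G) a b. \<exists>g\<in>Mor (tau1 G) b a. is_inverse (tau1 G) a b f g) \<longleftrightarrow> Ob (Hom G a b) \<noteq> {}"
    if ab: "a \<in> Ob G" "b \<in> Ob G" for a b
  proof
    assume "Ob (Hom G a b) \<noteq> {}"
    then obtain f where "f \<in> Mor (tau1 G) a b" using pi0[OF ab] by (auto simp: tau1_def class_cat_def)
    moreover from this have "\<exists>g\<in>Mor (tau1 G) b a. is_inverse (tau1 G) a b f g"
      using strict_ngpd_groupoid[OF G] ab unfolding is_groupoid_def by (simp add: tau1_def class_cat_def)
    ultimately show "\<exists>f\<in>Mor (tau1 G) a b. \<exists>g\<in>Mor (tau1 G) b a. is_inverse (tau1 G) a b f g" by blast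
  qed (use pi0[OF ab] in \<open>auto simp: tau1_def class_cat_def\<close>)
  have "iso_rel (tau1 G)
      = {(x, y). x \<in> Ob G \<and> y \<in> Ob G \<and> Ob (Hom G x y) \<noteq> {}}"
    unfolding O using iff by blast
  then have "ncat_pi0 G = Ob G // {(x, y). x \<in> Ob G \<and> y \<in> Ob G \<and> Ob (Hom G x y) \<noteq> {}}"
    unfolding ncat_pi0_tau1[OF strict_ngpd_not_Cat0[OF G]] iso_classes_def O by simp
  then show ?thesis by (auto simp: quotient_def)
qed

lemma block_pi0_1gpd:
  assumes G: "strict_ngpd (Suc 0) G" and a: "a \<in> Ob G"
    and S: "a \<in> S" "\<And>b. b \<in> S \<Longrightarrow> b \<in> Ob G \<and> Ob (Hom G a b) \<noteq> {}"
  shows "block (ncat_pi0 G) S = {b \<in> Ob G. Ob (Hom G a b) \<noteq> {}}"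
proof (rule block_eqI)
  show cl: "{b \<in> Ob G. Ob (Hom G a b) \<noteq> {}} \<in> ncat_pi0 G" using a strict_1gpd_pi0[OF G] by simp
  fix Y assume Y: "Y \<in> ncat_pi0 G" "Y \<inter> {b \<in> Ob G. Ob (Hom G a b) \<noteq> {}} \<noteq> {}"
  show "Y = {b \<in> Ob G. Ob (Hom G a b) \<noteq> {}}"
    using quotient_disj[OF iso_classes_equiv[OF strict_ngpd_is_category[OF G]], of Y "{b \<in> Ob G. Ob (Hom G a b) \<noteq> {}}"]
      Y cl
    unfolding ncat_pi0_tau1[OF strict_ngpd_not_Cat0[OF G]] iso_classes_def by blast
qed (use S in auto)

text \<open>\<open>T\<close> composes cells along the 1-cell \<open>u\<close>, and \<open>T'\<close>
  composes them along the object \<open>c\<close>. Interchange between them comes from the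
  functoriality of \<open>Comp C c c c\<close>, and weak inverses of objects come from the groupoid
  \<open>tau1 H\<close>.\<close>

lemma symmetric_2_group_3gpd:
  assumes C: "strict_ngpd (Suc (Suc (Suc 0))) C" and c: "c \<in> Ob C"
  defines "H \<equiv> Hom C c c" and "u \<equiv> Ident C c"
  defines "G \<equiv> Hom H u u" and "e \<equiv> Ident H u" and "T \<equiv> Comp H u u u"
    and "T' \<equiv> homf (Comp C c c c) (u, u) (u, u)"
  shows "symmetric_2_group (Ob G) (arrows G) arr_src arr_tgt (arr_id G) (arr_cmp G) (arr_ten T) (\<lambda>a b. obf T (a, b)) e"
    and arr_ten_eq: "f \<in> arrows G \<Longrightarrow> g \<in> arrows G \<Longrightarrow> arr_ten T' f g = arr_ten T f g"
    and "is_nfun (Suc 0) (ncat_prod (Suc 0) G G) G T" "is_nfun (Suc 0) (ncat_prod (Suc 0) G G) G T'"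
proof -
  note C' = strict_ngpd_ncat[OF C]
  have H: "strict_ngpd (Suc (Suc 0)) H" unfolding H_def by (rule strict_ngpd_Hom[OF C c c])
  note H' = strict_ngpd_ncat[OF H]
  have u: "u \<in> Ob H" unfolding H_def u_def by (rule strict_ncat_Ident[OF C' c])
  have G: "strict_ngpd (Suc 0) G" unfolding G_def by (rule strict_ngpd_Hom[OF H u u])
  note G' = strict_ngpd_ncat[OF G]
  have e: "e \<in> Ob G" unfolding G_def e_def by (rule strict_ncat_Ident[OF H' u])
  have T: "is_nfun (Suc 0) (ncat_prod (Suc 0) G G) G T"
    unfolding G_def T_def by (rule strict_ncat_Comp[OF H' u u u])
  have uu: "obf (Comp C c c c) (u, u) = u" unfolding u_def by (rule strict_ncat_Comp_ident[OF C' c])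
  have \<mu>: "is_nfun (Suc (Suc 0)) (ncat_prod (Suc (Suc 0)) H H) H (Comp C c c c)"
    unfolding H_def by (rule strict_ncat_Comp[OF C' c c c])
  note \<mu>' = \<mu>[unfolded is_nfun.simps(2)[of "Suc 0"]]
  have HP: "Hom (ncat_prod (Suc (Suc 0)) H H) (u, u) (u, u) = ncat_prod (Suc 0) G G"
    by (simp add: G_def)
  have uP: "(u, u) \<in> Ob (ncat_prod (Suc (Suc 0)) H H)" using u by simp
  have T': "is_nfun (Suc 0) (ncat_prod (Suc 0) G G) G T'"
  proof -
    have "is_nfun (Suc 0) (Hom (ncat_prod (Suc (Suc 0)) H H) (u, u) (u, u))
        (Hom H (obf (Comp C c c c) (u, u)) (obf (Comp C c c c) (u, u))) T'"
      using \<mu>' uP unfolding T'_def by blast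
    then show ?thesis unfolding HP uu G_def[symmetric] .
  qed
  \<comment> \<open>Compatibility of the functor \<open>Comp C c c c\<close> with composition in the
    product of \<open>H\<close> with itself: this is the interchange law.\<close>
  have "nfun_eq (Suc 0) (ncat_prod (Suc 0) (Hom (ncat_prod (Suc (Suc 0)) H H) (u, u) (u, u)) (Hom (ncat_prod (Suc (Suc 0)) H H) (u, u) (u, u)))
      (nfun_comp T' (Comp (ncat_prod (Suc (Suc 0)) H H) (u, u) (u, u) (u, u)))
      (nfun_comp (Comp H (obf (Comp C c c c) (u, u)) (obf (Comp C c c c) (u, u)) (obf (Comp C c c c) (u, u))) (nfun_prod T' T'))"
    using \<mu>' uP unfolding T'_def by blast
  then have inter: "nfun_eq (Suc 0) (ncat_prod (Suc 0) (ncat_prod (Suc 0) G G) (ncat_prod (Suc 0) G G))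
      (nfun_comp T' (nfun_comp (nfun_prod T T) (nfun_of (Suc 0) (\<lambda>((f, f'), (g, g')). ((f, g), (f', g'))))))
      (nfun_comp T (nfun_prod T' T'))"
    unfolding HP uu T_def[symmetric] by (simp only: ncat_prod.simps ncat.sel prod.case T_def)
  have F0: "\<not> is_Fun0 T" "\<not> is_Fun0 T'" using is_nfun_is_Fun0[OF T] is_nfun_is_Fun0[OF T'] by simp_all
  have interA: "arr_ten T' (arr_ten T x y) (arr_ten T x' y') = arr_ten T (arr_ten T' x x') (arr_ten T' y y')"
    if "x \<in> arrows G" "x' \<in> arrows G" "y \<in> arrows G" "y' \<in> arrows G" for x x' y y'
    using inter that F0 by (cases x; cases x'; cases y; cases y') (simp add: arrows_def)
  have unitT: "arr_ten T (arr_id G e) x = x" "arr_ten T x (arr_id G e) = x" if "x \<in> arrows G" for x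
    using strict_ncat_unit_left[OF H' u u, folded G_def e_def T_def] strict_ncat_unit_right[OF H' u u, folded G_def e_def T_def] that F0
    by (cases x; simp add: arrows_def arr_id_def)+
  have F0C: "\<not> is_Fun0 (Comp C c c c)" using is_nfun_is_Fun0[OF \<mu>] by simp
  \<comment> \<open>The unit laws of \<open>C\<close> are equations of functors on \<open>H\<close>.
    Their components on \<open>Hom H u u\<close> are the unit laws for \<open>T'\<close>, where the
    constant functor contributes \<open>e\<close> and its identity.\<close>
  have unitT': "arr_ten T' (arr_id G e) x = x" "arr_ten T' x (arr_id G e) = x" if "x \<in> arrows G" for x
  proof -
    have l: "nfun_eq (Suc 0) (Hom H u u)
        (homf (nfun_comp (Comp C c c c) (nfun_comp (nfun_prod (nfun_point (Suc (Suc 0)) H u) (nfun_id (Suc (Suc 0)))) (nfun_of (Suc (Suc 0)) (\<lambda>f. (f, f))))) u u)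
        (homf (nfun_id (Suc (Suc 0))) u u)"
      using strict_ncat_unit_left[OF C' c c, folded H_def u_def] u unfolding nfun_eq.simps(2)[of "Suc 0"] by blast
    have r: "nfun_eq (Suc 0) (Hom H u u)
        (homf (nfun_comp (Comp C c c c) (nfun_comp (nfun_prod (nfun_id (Suc (Suc 0))) (nfun_point (Suc (Suc 0)) H u)) (nfun_of (Suc (Suc 0)) (\<lambda>f. (f, f))))) u u)
        (homf (nfun_id (Suc (Suc 0))) u u)"
      using strict_ncat_unit_right[OF C' c c, folded H_def u_def] u unfolding nfun_eq.simps(2)[of "Suc 0"] by blast
    show "arr_ten T' (arr_id G e) x = x" "arr_ten T' x (arr_id G e) = x"
      using l r that F0 F0C by (cases x; simp add: arrows_def arr_id_def G_def[symmetric] e_def[symmetric] T'_def[symmetric])+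
  qed
  have ie: "arr_id G e \<in> arrows G" using arr_id_arrows[OF G' e] .
  note EH = eckmann_hilton[of _ "arrows G" _ "arr_id G e" "arr_ten T" "arr_ten T'", OF _ _ ie unitT unitT' interA]
  show eqT: "arr_ten T' f g = arr_ten T f g" if "f \<in> arrows G" "g \<in> arrows G" for f g
    using EH(1) that by blast
  have commT: "arr_ten T f g = arr_ten T g f" if "f \<in> arrows G" "g \<in> arrows G" for f g
    using EH(2) that by blast
  have assocT: "arr_ten T (arr_ten T f g) h = arr_ten T f (arr_ten T g h)"
    if "f \<in> arrows G" "g \<in> arrows G" "h \<in> arrows G" for f g h
    using strict_ncat_assoc[OF H' u u u u, folded G_def T_def] that F0
    by (cases f; cases g; cases h) (simp add: arrows_def)
  \<comment> \<open>An inverse class in \<open>tau1 H\<close> only says that the product of the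
    classes is the class of \<open>e\<close>; membership of \<open>e\<close> in the class of the
    product supplies the arrow.\<close>
  have inv: "\<exists>b\<in>Ob G. \<exists>\<phi>\<in>arrows G. arr_src \<phi> = obf T (a, b) \<and> arr_tgt \<phi> = e" if a: "a \<in> Ob G" for a
  proof -
    define cl where "cl a = {b \<in> Ob G. Ob (Hom G a b) \<noteq> {}}" for a
    have cl: "cl a \<in> ncat_pi0 G" using strict_1gpd_pi0[OF G] a by (auto simp: cl_def)
    have "\<exists>Y\<in>Mor (tau1 H) u u. is_inverse (tau1 H) u u (cl a) Y"
      using strict_ngpd_groupoid[OF H] u cl unfolding is_groupoid_def
      by (simp add: tau1_def class_cat_def G_def)
    then obtain Y where Y: "Y \<in> ncat_pi0 G"
      "block (ncat_pi0 G) (obf T ` (cl a \<times> Y)) = block (ncat_pi0 G) {e}"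
      by (auto simp: tau1_def class_cat_def is_inverse_def G_def e_def T_def)
    obtain b where b: "b \<in> Ob G" "Y = cl b" using Y(1) strict_1gpd_pi0[OF G] by (auto simp: cl_def)
    have refl: "x \<in> cl x" if "x \<in> Ob G" for x
      using strict_ncat_Ident[OF G' that] that by (auto simp: cl_def)
    have "block (ncat_pi0 G) (obf T ` (cl a \<times> cl b)) = cl (obf T (a, b))"
      unfolding cl_def[of "obf T (a, b)"]
    proof (rule block_pi0_1gpd[OF G])
      show "obf T (a, b) \<in> Ob G" by (rule obf_bifunctor[OF T a b(1)])
      show "obf T (a, b) \<in> obf T ` (cl a \<times> cl b)" using refl a b by blast
      fix z assume "z \<in> obf T ` (cl a \<times> cl b)"
      then obtain x y f g where "z = obf T (x, y)" "(a, x, f) \<in> arrows G" "(b, y, g) \<in> arrows G"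
        using a b(1) by (fastforce simp: cl_def arrows_def)
      then show "z \<in> Ob G \<and> Ob (Hom G (obf T (a, b)) z) \<noteq> {}"
        using arr_ten_arrows[OF T, of "(a, x, f)" "(b, y, g)"] by (auto simp: arrows_def)
    qed
    moreover have "block (ncat_pi0 G) {e} = cl e"
      unfolding cl_def by (rule block_pi0_1gpd[OF G e]) (use strict_ncat_Ident[OF G' e] e in auto)
    ultimately have "e \<in> cl (obf T (a, b))" using Y(2) b(2) refl[OF e] by simp
    then obtain \<phi> where "\<phi> \<in> Ob (Hom G (obf T (a, b)) e)" by (auto simp: cl_def)
    then have "(obf T (a, b), e, \<phi>) \<in> arrows G" using obf_bifunctor[OF T a b(1)] e by (simp add: arrows_def)
    then show ?thesis using b(1) by (metis fst_conv snd_conv)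
  qed
  have arr_ends: "arr_src f \<in> Ob G" "arr_tgt f \<in> Ob G" if "f \<in> arrows G" for f
    using that by (auto simp: arrows_def)
  have id_ends: "arr_src (arr_id G a) = a" "arr_tgt (arr_id G a) = a" for a by (simp_all add: arr_id_def)
  have ten_ends: "arr_src (arr_ten T f g) = obf T (arr_src f, arr_src g)" "arr_tgt (arr_ten T f g) = obf T (arr_tgt f, arr_tgt g)"
    for f g by (cases f; cases g; simp)+
  show "symmetric_2_group (Ob G) (arrows G) arr_src arr_tgt (arr_id G) (arr_cmp G) (arr_ten T) (\<lambda>a b. obf T (a, b)) e"
    by unfold_locales
      (rule arr_ends id_ends ten_ends e arr_id_arrows[OF G'] arr_cmp_arrows[OF G'] arr_cmp_assoc[OF G']
        arr_cmp_unit_left[OF G'] arr_cmp_unit_right[OF G'] strict_1gpd_inverse[OF G] obf_bifunctor[OF T]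
        arr_ten_arrows[OF T] arr_ten_id[OF T] arr_ten_cmp[OF T] assocT commT unitT(1) inv; assumption)+
  show "is_nfun (Suc 0) (ncat_prod (Suc 0) G G) G T" "is_nfun (Suc 0) (ncat_prod (Suc 0) G G) G T'" by (fact T T')+
qed

section \<open>Threefold delooping of an abelian group\<close>

definition mult_fun :: "('a, 'm) monoid_scheme \<Rightarrow> 'a \<times> 'a \<Rightarrow> 'a" where
  "mult_fun Q = (\<lambda>(x, y). x \<otimes>\<^bsub>Q\<^esub> y)"

abbreviation mult_nfun1 :: "('a, 'm) monoid_scheme \<Rightarrow> ('a \<times> 'a, 'a) nfun" where
  "mult_nfun1 Q \<equiv> FunS (\<lambda>_. \<one>\<^bsub>Q\<^esub>) (\<lambda>_ _. Fun0 (mult_fun Q))"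

abbreviation mult_nfun2 :: "('a, 'm) monoid_scheme \<Rightarrow> ('a \<times> 'a, 'a) nfun" where
  "mult_nfun2 Q \<equiv> FunS (\<lambda>_. \<one>\<^bsub>Q\<^esub>) (\<lambda>_ _. mult_nfun1 Q)"

text \<open>The neutral element also names the only cell in each lower dimension of the deloopings;
  this is harmless because hom-objects may share elements.\<close>

definition deloop1 :: "('a, 'm) monoid_scheme \<Rightarrow> 'a ncat" where
  "deloop1 Q = one_obj \<one>\<^bsub>Q\<^esub> (Cat0 (carrier Q)) (Fun0 (mult_fun Q)) \<one>\<^bsub>Q\<^esub>"

definition deloop2 :: "('a, 'm) monoid_scheme \<Rightarrow> 'a ncat" where
  "deloop2 Q = one_obj \<one>\<^bsub>Q\<^esub> (deloop1 Q) (mult_nfun1 Q) \<one>\<^bsub>Q\<^esub>"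

definition deloop3 :: "('a, 'm) monoid_scheme \<Rightarrow> 'a ncat" where
  "deloop3 Q = one_obj \<one>\<^bsub>Q\<^esub> (deloop2 Q)
     (mult_nfun2 Q) \<one>\<^bsub>Q\<^esub>"

lemma deloop_simps [simp]:
  "Ob (deloop1 Q) = {\<one>\<^bsub>Q\<^esub>}" "Hom (deloop1 Q) x y = Cat0 (carrier Q)"
  "Comp (deloop1 Q) x y z = Fun0 (mult_fun Q)" "Ident (deloop1 Q) x = \<one>\<^bsub>Q\<^esub>"
  "Ob (deloop2 Q) = {\<one>\<^bsub>Q\<^esub>}" "Hom (deloop2 Q) x y = deloop1 Q"
  "Comp (deloop2 Q) x y z = mult_nfun1 Q" "Ident (deloop2 Q) x = \<one>\<^bsub>Q\<^esub>"
  "Ob (deloop3 Q) = {\<one>\<^bsub>Q\<^esub>}" "Hom (deloop3 Q) x y = deloop2 Q"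
  "Comp (deloop3 Q) x y z = mult_nfun2 Q"
  "Ident (deloop3 Q) x = \<one>\<^bsub>Q\<^esub>"
  by (simp_all add: deloop1_def deloop2_def deloop3_def)

context comm_group
begin

lemma strict_ncat_deloop1: "strict_ncat (Suc 0) (deloop1 G)"
  unfolding deloop1_def by (rule strict_ncat_one_obj) (auto simp: mult_fun_def m_assoc)

text \<open>From here on commutativity matters: multiplication is a functor, that is, satisfies
  interchange, because the group is abelian.\<close>

lemma strict_ncat_deloop2: "strict_ncat (Suc (Suc 0)) (deloop2 G)"
  unfolding deloop2_def
  by (rule strict_ncat_one_obj[OF strict_ncat_deloop1]) (auto simp: mult_fun_def m_assoc m_ac)

lemma strict_ncat_deloop3: "strict_ncat (Suc (Suc (Suc 0))) (deloop3 G)"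
  unfolding deloop3_def
  by (rule strict_ncat_one_obj[OF strict_ncat_deloop2]) (auto simp: mult_fun_def m_assoc m_ac)

lemma strict_ngpd_deloop1: "strict_ngpd (Suc 0) (deloop1 G)"
proof -
  let ?K = "tau1 (deloop1 G)"
  have K: "Obj ?K = {\<one>}" "Mor ?K x y = (\<lambda>x. {x}) ` carrier G" "Idt ?K x = {\<one>}" for x y
    by (simp_all add: deloop1_def tau1_one_obj class_cat_def block_singletons)
  have cmp: "Cmp ?K x y z {f} {g} = {f \<otimes> g}" if "f \<in> carrier G" "g \<in> carrier G" for x y z f g
    using that block_singletons[of "f \<otimes> g" "carrier G"]
    by (simp add: deloop1_def tau1_one_obj class_cat_def mult_fun_def)
  have "is_groupoid ?K"
    unfolding is_groupoid_def is_category_def is_inverse_def K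
  proof (intro conjI ballI)
    fix f assume "f \<in> (\<lambda>x. {x}) ` carrier G"
    then obtain x where "x \<in> carrier G" "f = {x}" by auto
    then show "\<exists>g\<in>(\<lambda>x. {x}) ` carrier G. Cmp ?K y z y f g = {\<one>} \<and> Cmp ?K z y z g f = {\<one>}" for y z
      using cmp[of x "inv x"] cmp[of "inv x" x] by (intro bexI[of _ "{inv x}"]) auto
  qed (auto simp: cmp m_assoc)
  then show ?thesis
    unfolding deloop1_def by (intro strict_ngpd_one_obj strict_ncat_deloop1[unfolded deloop1_def]) simp_all
qed

lemma strict_ngpd_deloop2: "strict_ngpd (Suc (Suc 0)) (deloop2 G)"
  unfolding deloop2_def
  by (rule strict_ngpd_one_obj[OF strict_ncat_deloop2[unfolded deloop2_def] strict_ngpd_deloop1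
        is_groupoid_one_obj_trivial[OF ncat_pi0_single[OF strict_ngpd_deloop1]]]) simp_all

lemma strict_ngpd_deloop3: "strict_ngpd (Suc (Suc (Suc 0))) (deloop3 G)"
  unfolding deloop3_def
  by (rule strict_ngpd_one_obj[OF strict_ncat_deloop3[unfolded deloop3_def] strict_ngpd_deloop2
        is_groupoid_one_obj_trivial[OF ncat_pi0_single[OF strict_ngpd_deloop2]]]) simp_all

end

definition deloop_fun :: "('a, 'm) monoid_scheme \<Rightarrow> ('a \<times> 'a \<times> 'a \<Rightarrow> 'a) \<Rightarrow> ('a, 'a) nfun" where
  "deloop_fun Q q = FunS (\<lambda>_. \<one>\<^bsub>Q\<^esub>) (\<lambda>_ _. FunS (\<lambda>_. \<one>\<^bsub>Q\<^esub>) (\<lambda>_ _. FunS (\<lambda>_. \<one>\<^bsub>Q\<^esub>) (\<lambda>a b. Fun0 (\<lambda>f. q (a, b, f)))))"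

text \<open>A 3-cell can be composed along a 2-cell, along the 1-cell \<open>u\<close> and along the
  object \<open>c\<close>. The assumptions \<open>q_cmp\<close>, \<open>q_ten\<close> and
  \<open>q_ten'\<close> are compatibility with these three compositions.\<close>

lemma is_nfun_deloop_fun:
  assumes C: "strict_ncat (Suc (Suc (Suc 0))) C" and c: "c \<in> Ob C"
  defines "H \<equiv> Hom C c c" and "u \<equiv> Ident C c"
  defines "G \<equiv> Hom H u u" and "T \<equiv> Comp H u u u" and "T' \<equiv> homf (Comp C c c c) (u, u) (u, u)"
  assumes T: "is_nfun (Suc 0) (ncat_prod (Suc 0) G G) G T" "is_nfun (Suc 0) (ncat_prod (Suc 0) G G) G T'"
    and q: "\<And>f. f \<in> arrows G \<Longrightarrow> q f \<in> carrier Q"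
    and q_id: "\<And>a. a \<in> Ob G \<Longrightarrow> q (arr_id G a) = \<one>\<^bsub>Q\<^esub>"
    and q_cmp: "\<And>f g. \<lbrakk>f \<in> arrows G; g \<in> arrows G; arr_tgt f = arr_src g\<rbrakk> \<Longrightarrow>
        q (arr_cmp G f g) = q f \<otimes>\<^bsub>Q\<^esub> q g"
    and q_ten: "\<And>f g. f \<in> arrows G \<Longrightarrow> g \<in> arrows G \<Longrightarrow> q (arr_ten T f g) = q f \<otimes>\<^bsub>Q\<^esub> q g"
    and q_ten': "\<And>f g. f \<in> arrows G \<Longrightarrow> g \<in> arrows G \<Longrightarrow> q (arr_ten T' f g) = q f \<otimes>\<^bsub>Q\<^esub> q g"
  shows "is_nfun (Suc (Suc (Suc 0))) (base3 C c) (deloop3 Q) (deloop_fun Q q)"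
proof -
  have H: "strict_ncat (Suc (Suc 0)) H" unfolding H_def by (rule strict_ncat_Hom[OF C c c])
  have u: "u \<in> Ob H" unfolding H_def u_def by (rule strict_ncat_Ident[OF C c])
  have G: "strict_ncat (Suc 0) G" unfolding G_def by (rule strict_ncat_Hom[OF H u u])
  let ?F1 = "FunS (\<lambda>_. \<one>\<^bsub>Q\<^esub>) (\<lambda>a b. Fun0 (\<lambda>f. q (a, b, f)))"
  let ?F2 = "FunS (\<lambda>_. \<one>\<^bsub>Q\<^esub>) (\<lambda>_ _. ?F1)"
  have F0: "is_Fun0 (Comp G a b d)" if "a \<in> Ob G" "b \<in> Ob G" "d \<in> Ob G" for a b d
    using is_nfun_is_Fun0[OF strict_ncat_Comp[OF G that]] by simp
  have FT: "\<not> is_Fun0 T" "\<not> is_Fun0 T'" using is_nfun_is_Fun0[OF T(1)] is_nfun_is_Fun0[OF T(2)] by simp_all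
  have F1: "is_nfun (Suc 0) G (deloop1 Q) ?F1"
  proof -
    have "q (a, d, obf (Comp G a b d) (f, g)) = mult_fun Q (q (a, b, f), q (b, d, g))"
      if "a \<in> Ob G" "b \<in> Ob G" "d \<in> Ob G" "f \<in> Ob (Hom G a b)" "g \<in> Ob (Hom G b d)" for a b d f g
      using q_cmp[of "(a, b, f)" "(b, d, g)"] that by (simp add: arrows_def mult_fun_def)
    then show ?thesis
      using q q_id by (auto simp: arrows_def arr_id_def)
  qed
  \<comment> \<open>Generic in \<open>S\<close>, because the same computation is needed for
    \<open>T\<close> and for \<open>T'\<close>.\<close>
  have ten: "nfun_eq (Suc 0) (ncat_prod (Suc 0) G G) (nfun_comp ?F1 S)
      (nfun_comp (mult_nfun1 Q) (nfun_prod ?F1 ?F1))"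
    if S: "\<not> is_Fun0 S" "\<And>f g. f \<in> arrows G \<Longrightarrow> g \<in> arrows G \<Longrightarrow> q (arr_ten S f g) = q f \<otimes>\<^bsub>Q\<^esub> q g" for S
  proof -
    have "q (obf S (a, a'), obf S (b, b'), obf (homf S (a, a') (b, b')) (f, f')) = mult_fun Q (q (a, b, f), q (a', b', f'))"
      if "a \<in> Ob G" "b \<in> Ob G" "a' \<in> Ob G" "b' \<in> Ob G" "f \<in> Ob (Hom G a b)" "f' \<in> Ob (Hom G a' b')" for a b a' b' f f'
      using S(2)[of "(a, b, f)" "(a', b', f')"] that by (simp add: arrows_def mult_fun_def)
    then show ?thesis using S(1) by auto
  qed
  have uu: "obf (Comp C c c c) (u, u) = u" unfolding u_def by (rule strict_ncat_Comp_ident[OF C c])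
  have F0C: "\<not> is_Fun0 (Comp C c c c)" using is_nfun_is_Fun0[OF strict_ncat_Comp[OF C c c c]] by simp
  have F2: "is_nfun (Suc (Suc 0)) (full_sub {u} H) (deloop2 Q) ?F2"
    unfolding is_nfun.simps(2)[of "Suc 0"]
  proof (intro conjI ballI)
    fix x y z assume "x \<in> Ob (full_sub {u} H)" "y \<in> Ob (full_sub {u} H)" "z \<in> Ob (full_sub {u} H)"
    then have xyz: "x = u" "y = u" "z = u" by simp_all
    show "nfun_eq (Suc 0) (ncat_prod (Suc 0) (Hom (full_sub {u} H) x y) (Hom (full_sub {u} H) y z))
         (nfun_comp (homf ?F2 x z) (Comp (full_sub {u} H) x y z))
         (nfun_comp (Comp (deloop2 Q) (obf ?F2 x) (obf ?F2 y) (obf ?F2 z)) (nfun_prod (homf ?F2 x y) (homf ?F2 y z)))"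
      using ten[OF FT(1) q_ten] unfolding xyz full_sub_simps deloop_simps nfun.sel G_def T_def .
  next
    fix x y assume "x \<in> Ob (full_sub {u} H)" "y \<in> Ob (full_sub {u} H)"
    then show "is_nfun (Suc 0) (Hom (full_sub {u} H) x y) (Hom (deloop2 Q) (obf ?F2 x) (obf ?F2 y)) (homf ?F2 x y)"
      using F1 unfolding G_def full_sub_simps deloop_simps nfun.sel by simp
  qed auto
  have P: "ncat_prod (Suc (Suc 0)) (full_sub {u} H) (full_sub {u} H) = full_sub ({u} \<times> {u}) (ncat_prod (Suc (Suc 0)) H H)"
    by (rule ncat_prod_full_sub)
  have HP: "Hom (ncat_prod (Suc (Suc 0)) H H) (u, u) (u, u) = ncat_prod (Suc 0) G G"
    by (simp add: G_def)
  have e3: "nfun_eq (Suc (Suc 0)) (ncat_prod (Suc (Suc 0)) (full_sub {u} H) (full_sub {u} H))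
      (nfun_comp ?F2 (Comp C c c c))
      (nfun_comp (mult_nfun2 Q) (nfun_prod ?F2 ?F2))"
    unfolding P nfun_eq.simps(2)[of "Suc 0"]
  proof (intro conjI ballI)
    fix x y assume "x \<in> Ob (full_sub ({u} \<times> {u}) (ncat_prod (Suc (Suc 0)) H H))"
      "y \<in> Ob (full_sub ({u} \<times> {u}) (ncat_prod (Suc (Suc 0)) H H))"
    then have xy: "x = (u, u)" "y = (u, u)" by simp_all
    have "homf (nfun_comp ?F2 (Comp C c c c)) (u, u) (u, u) = nfun_comp ?F1 T'"
      using F0C by (simp add: T'_def)
    moreover have "homf (nfun_comp (mult_nfun2 Q) (nfun_prod ?F2 ?F2)) (u, u) (u, u)
        = nfun_comp (mult_nfun1 Q) (nfun_prod ?F1 ?F1)"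
      by simp
    ultimately show "nfun_eq (Suc 0) (Hom (full_sub ({u} \<times> {u}) (ncat_prod (Suc (Suc 0)) H H)) x y)
       (homf (nfun_comp ?F2 (Comp C c c c)) x y)
       (homf (nfun_comp (mult_nfun2 Q) (nfun_prod ?F2 ?F2)) x y)"
      using ten[OF FT(2) q_ten'] unfolding xy full_sub_simps HP by simp
  qed simp
  show ?thesis
    unfolding is_nfun.simps(2)[of "Suc (Suc 0)"] base3_def one_obj_simps deloop_simps deloop_fun_def nfun.sel
      H_def[symmetric] u_def[symmetric]
    using F2 e3 by (intro conjI ballI) (assumption | simp)+
qed

section \<open>Realization functors\<close>

context realization_functor
begin

lemma \<zeta>_bij:
  assumes "strict_ngpd n A" "a \<in> Ob A" "1 \<le> i" "i \<le> n"
  shows "bij_betw (\<zeta> i A a) (carrier (ncat_pi i A a)) (loop_classes i (R A) (r A a))"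
  using \<zeta>_iso[OF assms] by (simp add: iso_def top_pi_def)

text \<open>Naturality identifies the topological map with the algebraic one through the bijections
  \<open>\<zeta>\<close>, so injectivity and bijectivity carry over.\<close>

lemma top_pi_map_\<zeta>_image:
  assumes "strict_ngpd n A" "strict_ngpd n B" "is_nfun n A B F" "a \<in> Ob A" "1 \<le> i" "i \<le> n"
    and inj: "inj_on (ncat_pi_map i A B F a) (carrier (ncat_pi i A a))"
    and im: "ncat_pi_map i A B F a ` carrier (ncat_pi i A a) \<subseteq> carrier (ncat_pi i B (obf F a))"
  shows "inj_on (top_pi_map i (R B) (Rm A B F) (r A a)) (loop_classes i (R A) (r A a))"
    and "ncat_pi_map i A B F a ` carrier (ncat_pi i A a) = carrier (ncat_pi i B (obf F a)) \<Longrightarrow>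
      pi_bij i (R A) (R B) (Rm A B F) (r A a)"
proof -
  let ?P = "ncat_pi_map i A B F a" and ?T = "top_pi_map i (R B) (Rm A B F) (r A a)"
    and ?c = "carrier (ncat_pi i A a)"
  have Fa: "obf F a \<in> Ob B" using is_nfun_obf[OF assms(3,4)] .
  have A: "loop_classes i (R A) (r A a) = \<zeta> i A a ` ?c"
    using \<zeta>_bij[OF assms(1,4,5,6)] by (simp add: bij_betw_def)
  have B: "inj_on (\<zeta> i B (obf F a)) (carrier (ncat_pi i B (obf F a)))"
    "loop_classes i (R B) (r B (obf F a)) = \<zeta> i B (obf F a) ` carrier (ncat_pi i B (obf F a))"
    using \<zeta>_bij[OF assms(2) Fa assms(5,6)] by (simp_all add: bij_betw_def)
  have nat: "?T (\<zeta> i A a X) = \<zeta> i B (obf F a) (?P X)" if "X \<in> ?c" for X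
    using \<zeta>_natural[OF assms(1-6) that] .
  show inj': "inj_on ?T (loop_classes i (R A) (r A a))"
    unfolding A
  proof (rule inj_onI, elim imageE)
    fix x y X Y assume "?T x = ?T y" "x = \<zeta> i A a X" "X \<in> ?c" "y = \<zeta> i A a Y" "Y \<in> ?c"
    then have "\<zeta> i B (obf F a) (?P X) = \<zeta> i B (obf F a) (?P Y)" using nat by metis
    then have "?P X = ?P Y" using B(1) im \<open>X \<in> ?c\<close> \<open>Y \<in> ?c\<close> by (meson image_subset_iff inj_on_eq_iff)
    then show "x = y" using inj \<open>X \<in> ?c\<close> \<open>Y \<in> ?c\<close> \<open>x = _\<close> \<open>y = _\<close> by (metis inj_on_eq_iff)
  qed
  assume onto: "?P ` ?c = carrier (ncat_pi i B (obf F a))"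
  have "?T ` \<zeta> i A a ` ?c = (\<lambda>X. \<zeta> i B (obf F a) (?P X)) ` ?c"
    unfolding image_image by (rule image_cong) (simp_all add: nat)
  also have "\<dots> = \<zeta> i B (obf F a) ` ?P ` ?c" by (simp add: image_image)
  finally have "?T ` loop_classes i (R A) (r A a) = loop_classes i (R B) (r B (obf F a))"
    unfolding A B(2) onto .
  then show "pi_bij i (R A) (R B) (Rm A B F) (r A a)"
    using inj' r_natural[OF assms(1-4)] by (simp add: pi_bij_def bij_betw_def)
qed

end

text \<open>An infinite set is equinumerous with its square; applying this twice encodes an arrow
  together with its source and target.\<close>

lemma infinite_inj_triple:
  assumes "infinite (UNIV :: 'a set)"
  obtains enc :: "'a \<times> 'a \<times> 'a \<Rightarrow> 'a" where "inj enc"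
proof -
  have "(card_of (UNIV \<times> UNIV :: ('a \<times> 'a) set), card_of (UNIV :: 'a set)) \<in> ordIso"
    by (rule card_of_Times_same_infinite[OF assms])
  then obtain p :: "'a \<times> 'a \<Rightarrow> 'a" where "bij_betw p (UNIV \<times> UNIV) UNIV"
    using card_of_ordIso by blast
  then have p: "inj p" by (simp add: bij_betw_def)
  have "inj (\<lambda>(a, b, c). p (a, p (b, c)))"
    by (rule injI) (auto dest!: injD[OF p])
  then show ?thesis by (rule that)
qed

theorem proposition5p1:
  fixes R :: "'a ncat \<Rightarrow> 'b topology"
    and Rm :: "'a ncat \<Rightarrow> 'a ncat \<Rightarrow> ('a, 'a) nfun \<Rightarrow> 'b \<Rightarrow> 'b"
    and r :: "'a ncat \<Rightarrow> 'a \<Rightarrow> 'b"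
    and \<zeta>0 :: "'a ncat \<Rightarrow> 'a set \<Rightarrow> 'b set"
    and \<zeta> :: "nat \<Rightarrow> 'a ncat \<Rightarrow> 'a \<Rightarrow> 'a set \<Rightarrow> ((nat \<Rightarrow> real) \<Rightarrow> 'b) set"
  assumes "realization_functor 3 R Rm r \<zeta>0 \<zeta>"
  shows "\<not> (\<exists>(C :: 'a ncat) (T :: 'b topology).
           strict_ngpd 3 C \<and> is_truncation 3 (nsphere 2) T \<and> weak_equivalent (R C) T)"
proof
  interpret realization_functor 3 R Rm r \<zeta>0 \<zeta> by (rule assms)
  assume "\<exists>(C :: 'a ncat) (T :: 'b topology).
           strict_ngpd 3 C \<and> is_truncation 3 (nsphere 2) T \<and> weak_equivalent (R C) T"
  then obtain C :: "'a ncat" and T0 :: "'b topology" where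
    C: "strict_ngpd 3 C" and "is_truncation 3 (nsphere 2) T0" "weak_equivalent (R C) T0" by blast
  then have ess: "hopf_essential (R C)"
    using hopf_essential_weak_equivalent hopf_essential_truncation by blast
  then obtain g where g: "continuous_map (top_of_set usph) (R C) g" "\<not> null_map (R C) (\<lambda>x. g (hopf x))"
    and pc: "path_connected_space (R C)"
    by (auto simp: hopf_essential_def)
  note n3 = numeral_3_eq_3
  note C3 = C[unfolded n3]
  note C' = strict_ngpd_ncat[OF C3]
  \<comment> \<open>An object of \<open>C\<close> has to be found first: \<open>R C\<close> has a
    point, hence a path component, and \<open>\<zeta>0\<close> turns it into a class of
    objects.\<close>
  have "g pole \<in> topspace (R C)" by (rule continuous_map_usph_in_topspace[OF g(1) pole_in_usph])
  then have "path_components_of (R C) \<noteq> {}" by (auto simp: path_components_of_def)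
  then have "ncat_pi0 C \<noteq> {}" using \<zeta>0_bij[OF C] by (auto simp: bij_betw_def)
  then have "Ob C \<noteq> {}"
    unfolding ncat_pi0_tau1[OF strict_ngpd_not_Cat0[OF C3]] iso_classes_def tau1_def class_cat_def by (auto simp: quotient_def)
  then obtain c where c: "c \<in> Ob C" by blast
  define H u where "H = Hom C c c" and "u = Ident C c"
  define G e T T' where "G = Hom H u u" and "e = Ident H u" and "T = Comp H u u u"
    and "T' = homf (Comp C c c c) (u, u) (u, u)"
  note defs = H_def u_def G_def e_def T_def T'_def
  have H: "strict_ngpd (Suc (Suc 0)) H" unfolding H_def by (rule strict_ngpd_Hom[OF C3 c c])
  have u: "u \<in> Ob H" unfolding H_def u_def by (rule strict_ncat_Ident[OF C' c])
  have G: "strict_ngpd (Suc 0) G" unfolding G_def by (rule strict_ngpd_Hom[OF H u u])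
  have e: "e \<in> Ob G" unfolding G_def e_def by (rule strict_ncat_Ident[OF strict_ngpd_ncat[OF H] u])

  have pi2: "carrier (ncat_pi 2 A a) = ncat_pi0 (Hom (Hom A a a) (Ident A a) (Ident A a))" for A :: "'a ncat" and a
    by (simp add: numeral_2_eq_2)
  have pi3: "carrier (ncat_pi 3 A a) = ncat_pi0 (Hom (Hom (Hom A a a) (Ident A a) (Ident A a))
      (Ident (Hom A a a) (Ident A a)) (Ident (Hom A a a) (Ident A a)))" for A :: "'a ncat" and a
    by (simp add: numeral_3_eq_3)

  have "infinite (loop_classes 2 (R C) (r C c))"
    using ess r_point[OF C c] by (simp add: hopf_essential_def)
  then have "infinite (carrier (ncat_pi 2 C c))"
    using \<zeta>_bij[OF C c, of 2] by (simp add: bij_betw_finite)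
  \<comment> \<open>The elements of pi_2 are subsets of the universe, so a finite universe would
    allow only finitely many.\<close>
  then have "infinite (UNIV :: 'a set)"
    by (metis finite_Pow_iff finite_subset Pow_UNIV subset_UNIV)
  then obtain enc :: "'a \<times> 'a \<times> 'a \<Rightarrow> 'a" where enc: "inj enc" by (rule infinite_inj_triple)

  interpret S: symmetric_2_group "Ob G" "arrows G" arr_src arr_tgt "arr_id G" "arr_cmp G" "arr_ten T" "\<lambda>a b. obf T (a, b)" e
    unfolding defs by (rule symmetric_2_group_3gpd[OF C3 c])
  obtain Q :: "'a monoid" and q where Q: "comm_group Q" and q: "\<And>f. f \<in> arrows G \<Longrightarrow> q f \<in> carrier Q"
    and q_ten: "\<And>f g. f \<in> arrows G \<Longrightarrow> g \<in> arrows G \<Longrightarrow> q (arr_ten T f g) = q f \<otimes>\<^bsub>Q\<^esub> q g"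
    and q_cmp: "\<And>f g. \<lbrakk>f \<in> arrows G; g \<in> arrows G; arr_tgt f = arr_src g\<rbrakk> \<Longrightarrow>
        q (arr_cmp G f g) = q f \<otimes>\<^bsub>Q\<^esub> q g"
    and q_id: "\<And>a. a \<in> Ob G \<Longrightarrow> q (arr_id G a) = \<one>\<^bsub>Q\<^esub>"
    and q_inj: "\<And>f g. \<lbrakk>f \<in> arrows G; g \<in> arrows G; arr_src f = e; arr_tgt f = e; arr_src g = e; arr_tgt g = e; q f = q g\<rbrakk> \<Longrightarrow>
        f = g"
    using S.exists_quotient_group[OF inj_on_subset[OF enc subset_UNIV]] by blast
  have q_ten': "q (arr_ten T' f g) = q f \<otimes>\<^bsub>Q\<^esub> q g" if "f \<in> arrows G" "g \<in> arrows G" for f g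
    using arr_ten_eq[OF C3 c, folded H_def u_def, folded G_def e_def T_def T'_def, OF that] q_ten[OF that] by simp
  define B where "B = base3 C c"
  define D where "D = deloop3 Q"
  define F where "F = deloop_fun Q q"
  let ?I = "nfun_id 3 :: ('a, 'a) nfun"
  have B: "strict_ngpd 3 B" unfolding B_def n3 by (rule strict_ngpd_base3[OF C3 c])
  have cB: "c \<in> Ob B" by (simp add: B_def base3_def)
  have D: "strict_ngpd 3 D" unfolding D_def n3 by (rule comm_group.strict_ngpd_deloop3[OF Q])
  have I: "is_nfun 3 B C ?I" unfolding B_def n3 by (rule is_nfun_base3_incl[OF C' c])
  have F: "is_nfun 3 B D F"
    unfolding B_def D_def F_def n3
    by (rule is_nfun_deloop_fun[OF C' c, folded H_def u_def, folded G_def e_def T_def T'_def, OF symmetric_2_group_3gpd(3,4)[OF C3 c, folded H_def u_def, folded G_def e_def T_def T'_def] q q_id q_cmp q_ten q_ten'])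
  have Bs: "Hom B c c = full_sub {u} H" "Ident B c = u" by (simp_all add: B_def base3_def defs)
  have Fs: "obf F x = \<one>\<^bsub>Q\<^esub>" "obf (homf F x y) z = \<one>\<^bsub>Q\<^esub>" "obf (homf (homf F x y) z w) v = \<one>\<^bsub>Q\<^esub>"
    "obf (homf (homf (homf F x y) z w) a b) f = q (a, b, f)" for x y z w v a b f
    by (simp_all add: F_def deloop_fun_def)

  \<comment> \<open>\<open>B\<close> and \<open>C\<close> have the same 2-cells and 3-cells over
    \<open>u\<close>, so the inclusion induces the identity on pi_2.\<close>
  have bij2: "pi_bij 2 (R B) (R C) (Rm B C ?I) (r B c)"
  proof -
    have "ncat_pi_map 2 B C ?I c X = X" if "X \<in> ncat_pi0 G" for X
      using block_ncat_pi0[OF G that] by (simp add: numeral_2_eq_2 numeral_3_eq_3 ncat_pi0_map_def Bs defs[symmetric])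
    moreover have "carrier (ncat_pi 2 B c) = ncat_pi0 G" "carrier (ncat_pi 2 C c) = ncat_pi0 G"
      unfolding pi2 Bs by (simp_all add: defs)
    ultimately have "inj_on (ncat_pi_map 2 B C ?I c) (carrier (ncat_pi 2 B c))"
      "ncat_pi_map 2 B C ?I c ` carrier (ncat_pi 2 B c) = carrier (ncat_pi 2 C (obf ?I c))"
      by (auto simp: inj_on_def)
    then show ?thesis using top_pi_map_\<zeta>_image(2)[OF B C I cB, of 2] by simp
  qed
  have rF: "Rm B D F (r B c) = r D \<one>\<^bsub>Q\<^esub>" using r_natural[OF B D F cB] by (simp add: Fs)
  \<comment> \<open>Elements of pi_3 are automorphisms of \<open>e\<close>, on which the quotient
    map \<open>q\<close> is injective.\<close>
  have inj3: "inj_on (top_pi_map 3 (R D) (Rm B D F) (r B c)) (loop_classes 3 (R B) (r B c))"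
  proof -
    have "Ob (Hom G e e) = {f. (e, e, f) \<in> arrows G}" using e by (simp add: arrows_def)
    moreover have "is_Cat0 (Hom G e e)" using strict_ngpd_Hom[OF G e e] by simp
    then have "ncat_pi0 (Hom G e e) = (\<lambda>x. {x}) ` Ob (Hom G e e)" by (cases "Hom G e e") auto
    ultimately have B3: "carrier (ncat_pi 3 B c) = (\<lambda>x. {x}) ` {f. (e, e, f) \<in> arrows G}"
      unfolding pi3 Bs by (simp add: defs)
    have D3: "carrier (ncat_pi 3 D \<one>\<^bsub>Q\<^esub>) = (\<lambda>x. {x}) ` carrier Q"
      unfolding pi3 by (simp add: D_def)
    have map: "ncat_pi_map 3 B D F c {f} = {q (e, e, f)}" if "(e, e, f) \<in> arrows G" for f
      using block_singletons[OF q[OF that]]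
      by (simp add: numeral_3_eq_3 ncat_pi0_map_def Bs Fs D_def e_def[symmetric])
    have "inj_on (ncat_pi_map 3 B D F c) (carrier (ncat_pi 3 B c))"
    proof (rule inj_onI)
      fix X Y assume "X \<in> carrier (ncat_pi 3 B c)" "Y \<in> carrier (ncat_pi 3 B c)"
        and eq: "ncat_pi_map 3 B D F c X = ncat_pi_map 3 B D F c Y"
      then obtain f g where fg: "X = {f}" "Y = {g}" "(e, e, f) \<in> arrows G" "(e, e, g) \<in> arrows G"
        by (auto simp: B3)
      then have "(e, e, f) = (e, e, g)" using eq map[of f] map[of g] by (intro q_inj) auto
      then show "X = Y" using fg by simp
    qed
    moreover have "ncat_pi_map 3 B D F c ` carrier (ncat_pi 3 B c) \<subseteq> carrier (ncat_pi 3 D (obf F c))"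
      unfolding B3 Fs D3 using map q by auto
    ultimately show ?thesis using top_pi_map_\<zeta>_image(1)[OF B D F cB, of 3] by simp
  qed
  have single: "loop_classes DIM(complex) (R D) (r D \<one>\<^bsub>Q\<^esub>) \<subseteq> {\<zeta> 2 D \<one>\<^bsub>Q\<^esub> {\<one>\<^bsub>Q\<^esub>}}"
  proof -
    have "carrier (ncat_pi 2 D \<one>\<^bsub>Q\<^esub>) = {{\<one>\<^bsub>Q\<^esub>}}"
      unfolding pi2 using ncat_pi0_single[OF comm_group.strict_ngpd_deloop1[OF Q]] by (simp add: D_def)
    then show ?thesis using \<zeta>_bij[OF D, of "\<one>\<^bsub>Q\<^esub>" 2] by (simp add: bij_betw_def D_def)
  qed

  have contI: "continuous_map (R B) (R C) (Rm B C ?I)" and contF: "continuous_map (R B) (R D) (Rm B D F)"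
    by (rule functor_continuous[OF B C I], rule functor_continuous[OF B D F])
  \<comment> \<open>The essential class is moved from \<open>R C\<close> back to \<open>R B\<close>,
    the source of the functor \<open>F\<close>.\<close>
  obtain k where k: "k \<in> sphere_maps (R B) (r B c)" "\<not> null_map (R B) (\<lambda>x. k (hopf x))"
    by (rule hopf_composite_lift[OF pc contI bij2 r_point[OF B cB] g])
  \<comment> \<open>The delooping has trivial pi_2, so the image of \<open>k\<close> is null even
    before it is composed with \<open>hopf\<close>; injectivity on pi_3 then contradicts the choice
    of \<open>k\<close>.\<close>
  have "null_map (R D) (\<lambda>z. Rm B D F (k z))"
    using sphere_maps_null_if_singleton[OF single sphere_maps_compose[OF k(1) contF, unfolded rF]] .
  then have "null_map (R D) (\<lambda>x. Rm B D F (k (hopf x)))"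
    by (rule null_map_compose_right[OF _ continuous_on_hopf]) (use hopf_usph in blast)
  from null_map_hopf_reflect[OF contF inj3 k(1) this] show False using k(2) by simp
qed

end
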